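(* Let $\mathcal{A}$ be an ergodic algebra with mean value on $\mathbb{R}^d$ and let $A=A(y)\in L^\infty(\mathbb{R}^d)^{d\times d}$ be a symmetric matrix with $A\in(B^2_{\mathcal{A}}(\mathbb{R}^d))^{d\times d}$ and, for some constants $\alpha,\beta>0$, $\alpha|\lambda|^2\le A(y)\lambda\cdot\lambda\le\beta|\lambda|^2$ for all $\lambda\in\mathbb{R}^d$ and a.e. $y\in\mathbb{R}^d$. Let $\chi$ be the corrector and $A^*=M(A(I+\nabla\chi))$ the homogenized matrix associated with $A$. For $R,T>0$ and $1\le j\le d$ let $\chi^R_{T,j}\in H^1_0(Q_R)$ be the solution of $$-\nabla\cdot\big(A(e_j+\nabla\chi^R_{T,j})\big)+T^{-2}\chi^R_{T,j}=0\ \text{ in }Q_R,$$ set $\chi^R_T=(\chi^R_{T,j})_{1\le j\le d}$ and $A^*_{R,T}=\frac1{|Q_R|}\int_{Q_R}A(I+\nabla\chi^R_T)\,dy$. Suppose $\chi\in B^2_{\mathcal{A}}(\mathbb{R}^d)^d$. Let $\delta\in(0,1)$. Then there exist $C=C(d,\delta,A)$ and a continuous function $\eta_\delta:[1,\infty)\to[0,\infty)$, which depends only on $A$ and $\delta$, such that $\lim_{t\to\infty}\eta_\delta(t)=0$ and $$|A^*-A^*_{T,T}|\le C\,\eta_\delta(T)\quad\text{for all }T\ge1 .$$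
   Context: $Q_R$ is the closed cube in $\mathbb{R}^d$ centred at the origin with side length $R$; $e_j$ is the $j$-th canonical basis vector, $I$ the $d\times d$ identity; $\nabla\chi$ and $\nabla\chi_T^R$ are the matrices whose $j$-th columns are $\nabla\chi_j$ and $\nabla\chi_{T,j}^R$. An algebra with mean value on $\mathbb{R}^d$ is a closed subalgebra $\mathcal{A}$ of the algebra $\mathrm{BUC}(\mathbb{R}^d)$ of bounded uniformly continuous real-valued functions (sup norm) which contains the constants, is translation invariant, and each of whose elements $u$ has a mean value: $u(\cdot/\varepsilon)$ converges weakly-$*$ in $L^\infty(\mathbb{R}^d)$, as $\varepsilon\to0$, to a real constant $M(u)$; then $M(u)=\lim_{R\to\infty}\frac1{|B_R|}\int_{B_R}u\,dy$. For $1\le p<\infty$ and $u\in L^p_{loc}(\mathbb{R}^d)$, $\|u\|_p:=\big(\limsup_{R\to\infty}\frac1{|B_R|}\int_{B_R}|u|^p\,dy\big)^{1/p}$, and $B^p_{\mathcal{A}}(\mathbb{R}^d)$ is the closure of $\mathcal{A}$ in $\{u\in L^p_{loc}(\mathbb{R}^d):\|u\|_p<\infty\}$ for $\|\cdot\|_p$; $M$ extends by continuity to $B^p_{\mathcal{A}}(\mathbb{R}^d)$. $\mathcal{A}$ is ergodic if, whenever $u\in B^p_{\mathcal{A}}(\mathbb{R}^d)$ satisfies $\|u(\cdot+y)-u\|_p=0$ for every $y$, there is a constant $c$ with $\|u-c\|_p=0$. Corrector: $\chi=(\chi_j)_{1\le j\le d}$, where $\chi_j\in H^1_{loc}(\mathbb{R}^d)$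 is the unique (up to an additive constant) function with $\nabla\chi_j\in B^2_{\mathcal{A}}(\mathbb{R}^d)^d$, $M(\nabla\chi_j)=0$ and $\nabla\cdot(A(e_j+\nabla\chi_j))=0$ in $\mathbb{R}^d$ in the sense of distributions. *)

theory Defs
  imports "HOL-Analysis.Analysis"
begin

text \<open>
  The space \<open>\<real>\<^sup>d\<close> is \<open>real ^ 'n\<close> with \<open>d = CARD('n)\<close>. Measurability and integrals refer to
  the completed Lebesgue measure, and elements of Lebesgue and Sobolev spaces are represented by
  functions; every notion below that is applied to them is invariant under modification on a
  null set. A Sobolev function \<open>u\<close> is always accompanied by a representative \<open>g\<close> of its gradient.
\<close>

definition Lp_on :: "real \<Rightarrow> (real ^ 'n) set \<Rightarrow> (real ^ 'n \<Rightarrow> 'b::euclidean_space) \<Rightarrow> bool" where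
  "Lp_on p S f \<longleftrightarrow>
     set_borel_measurable lebesgue S f \<and> set_integrable lebesgue S (\<lambda>x. norm (f x) powr p)"

definition Lp_loc :: "real \<Rightarrow> (real ^ 'n) set \<Rightarrow> (real ^ 'n \<Rightarrow> 'b::euclidean_space) \<Rightarrow> bool" where
  "Lp_loc p U f \<longleftrightarrow> (\<forall>K. compact K \<and> K \<subseteq> U \<longrightarrow> Lp_on p K f)"

definition L_infty :: "(real ^ 'n \<Rightarrow> 'b::euclidean_space) \<Rightarrow> bool" where
  "L_infty f \<longleftrightarrow> f \<in> borel_measurable lebesgue \<and> (\<exists>c. AE x in lebesgue. norm (f x) \<le> c)"

definition partial :: "'n \<Rightarrow> (real ^ 'n \<Rightarrow> real) \<Rightarrow> real ^ 'n \<Rightarrow> real" where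
  "partial i f x = frechet_derivative f (at x) (axis i 1)"

definition grad :: "(real ^ 'n \<Rightarrow> real) \<Rightarrow> real ^ 'n \<Rightarrow> real ^ 'n" where
  "grad f x = (\<chi> i. partial i f x)"

primrec C_k :: "nat \<Rightarrow> (real ^ 'n \<Rightarrow> real) \<Rightarrow> bool" where
  "C_k 0 f \<longleftrightarrow> continuous_on UNIV f"
| "C_k (Suc k) f \<longleftrightarrow> (\<forall>x. f differentiable at x) \<and> (\<forall>i. C_k k (partial i f))"

definition test_function :: "(real ^ 'n) set \<Rightarrow> (real ^ 'n \<Rightarrow> real) \<Rightarrow> bool" where
  "test_function U \<phi> \<longleftrightarrow>
     (\<forall>k. C_k k \<phi>) \<and> compact (closure {x. \<phi> x \<noteq> 0}) \<and> closure {x. \<phi> x \<noteq> 0} \<subseteq> U"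

definition weak_gradient ::
  "(real ^ 'n) set \<Rightarrow> (real ^ 'n \<Rightarrow> real) \<Rightarrow> (real ^ 'n \<Rightarrow> real ^ 'n) \<Rightarrow> bool" where
  "weak_gradient U u g \<longleftrightarrow> Lp_loc 1 U u \<and> Lp_loc 1 U g \<and>
     (\<forall>\<phi>. test_function U \<phi> \<longrightarrow>
        (LINT x:U|lebesgue. u x *\<^sub>R grad \<phi> x) = - (LINT x:U|lebesgue. \<phi> x *\<^sub>R g x))"

definition H1_loc ::
  "(real ^ 'n) set \<Rightarrow> (real ^ 'n \<Rightarrow> real) \<Rightarrow> (real ^ 'n \<Rightarrow> real ^ 'n) \<Rightarrow> bool" where
  "H1_loc U u g \<longleftrightarrow> weak_gradient U u g \<and> Lp_loc 2 U u \<and> Lp_loc 2 U g"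

definition H1 ::
  "(real ^ 'n) set \<Rightarrow> (real ^ 'n \<Rightarrow> real) \<Rightarrow> (real ^ 'n \<Rightarrow> real ^ 'n) \<Rightarrow> bool" where
  "H1 U u g \<longleftrightarrow> weak_gradient U u g \<and> Lp_on 2 U u \<and> Lp_on 2 U g"

definition H1_0 ::
  "(real ^ 'n) set \<Rightarrow> (real ^ 'n \<Rightarrow> real) \<Rightarrow> (real ^ 'n \<Rightarrow> real ^ 'n) \<Rightarrow> bool" where
  "H1_0 U u g \<longleftrightarrow> H1 U u g \<and>
     (\<exists>\<phi>. (\<forall>n::nat. test_function U (\<phi> n)) \<and>
        (\<lambda>n. LINT x:U|lebesgue. (u x - \<phi> n x)\<^sup>2) \<longlonglongrightarrow> 0 \<and>
        (\<lambda>n. LINT x:U|lebesgue. (norm (g x - grad (\<phi> n) x))\<^sup>2) \<longlonglongrightarrow> 0)"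

definition has_mean_value :: "(real ^ 'n \<Rightarrow> real) \<Rightarrow> real \<Rightarrow> bool" where
  "has_mean_value u c \<longleftrightarrow>
     (\<forall>f :: real ^ 'n \<Rightarrow> real. integrable lebesgue f \<longrightarrow>
        ((\<lambda>\<epsilon>. LINT x|lebesgue. u (x /\<^sub>R \<epsilon>) * f x) \<longlongrightarrow> c * (LINT x|lebesgue. f x)) (at_right 0))"

definition mean_value :: "(real ^ 'n \<Rightarrow> real) \<Rightarrow> real" where
  "mean_value u = (THE c. has_mean_value u c)"

definition algebra_with_mean_value :: "(real ^ 'n \<Rightarrow> real) set \<Rightarrow> bool" where
  "algebra_with_mean_value \<A> \<longleftrightarrow>
     (\<forall>u\<in>\<A>. bounded (range u) \<and> uniformly_continuous_on UNIV u) \<and>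
     (\<forall>c. (\<lambda>x. c) \<in> \<A>) \<and>
     (\<forall>u\<in>\<A>. \<forall>v\<in>\<A>. (\<lambda>x. u x + v x) \<in> \<A>) \<and>
     (\<forall>u\<in>\<A>. \<forall>c. (\<lambda>x. c * u x) \<in> \<A>) \<and>
     (\<forall>u\<in>\<A>. \<forall>v\<in>\<A>. (\<lambda>x. u x * v x) \<in> \<A>) \<and>
     (\<forall>f u. (\<forall>n::nat. f n \<in> \<A>) \<and> uniform_limit UNIV f u sequentially \<longrightarrow> u \<in> \<A>) \<and>
     (\<forall>u\<in>\<A>. \<forall>y. (\<lambda>x. u (x + y)) \<in> \<A>) \<and>
     (\<forall>u\<in>\<A>. \<exists>c. has_mean_value u c)"

definition limsup_mean :: "real \<Rightarrow> (real ^ 'n \<Rightarrow> real) \<Rightarrow> ereal" where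
  "limsup_mean p u =
     Limsup at_top (\<lambda>R. ereal ((LINT x:ball 0 R|lebesgue. \<bar>u x\<bar> powr p) / measure lebesgue (ball (0 :: real ^ 'n) R)))"

definition finite_seminorm_space :: "real \<Rightarrow> (real ^ 'n \<Rightarrow> real) set" where
  "finite_seminorm_space p = {u. Lp_loc p UNIV u \<and> limsup_mean p u < \<infinity>}"

text \<open>
  Only meaningful on \<^term>\<open>finite_seminorm_space p\<close>, since \<^const>\<open>real_of_ereal\<close> sends \<open>\<infinity>\<close> to \<open>0\<close>.
  It is applied below only to differences of elements of that space.
\<close>
definition besicovitch_seminorm :: "real \<Rightarrow> (real ^ 'n \<Rightarrow> real) \<Rightarrow> real" where
  "besicovitch_seminorm p u = real_of_ereal (limsup_mean p u) powr (1 / p)"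

definition besicovitch :: "real \<Rightarrow> (real ^ 'n \<Rightarrow> real) set \<Rightarrow> (real ^ 'n \<Rightarrow> real) set" where
  "besicovitch p \<A> =
     {u \<in> finite_seminorm_space p. \<forall>\<epsilon>>0. \<exists>v\<in>\<A>. besicovitch_seminorm p (\<lambda>x. u x - v x) < \<epsilon>}"

text \<open>The extension by continuity of \<^const>\<open>mean_value\<close> from \<open>\<A>\<close> to \<^term>\<open>besicovitch p \<A>\<close>.\<close>
definition besicovitch_mean ::
  "real \<Rightarrow> (real ^ 'n \<Rightarrow> real) set \<Rightarrow> (real ^ 'n \<Rightarrow> real) \<Rightarrow> real" where
  "besicovitch_mean p \<A> u =
     (THE m. \<forall>f. (\<forall>n::nat. f n \<in> \<A>) \<and>
        (\<lambda>n. besicovitch_seminorm p (\<lambda>x. u x - f n x)) \<longlonglongrightarrow> 0 \<longrightarrow>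
        (\<lambda>n. mean_value (f n)) \<longlonglongrightarrow> m)"

definition ergodic :: "(real ^ 'n \<Rightarrow> real) set \<Rightarrow> bool" where
  "ergodic \<A> \<longleftrightarrow>
     (\<forall>p\<ge>1. \<forall>u\<in>besicovitch p \<A>.
        (\<forall>y. besicovitch_seminorm p (\<lambda>x. u (x + y) - u x) = 0) \<longrightarrow>
        (\<exists>c. besicovitch_seminorm p (\<lambda>x. u x - c) = 0))"

definition corrector ::
  "(real ^ 'n \<Rightarrow> real) set \<Rightarrow> (real ^ 'n \<Rightarrow> real ^ 'n ^ 'n) \<Rightarrow>
     ('n \<Rightarrow> real ^ 'n \<Rightarrow> real) \<Rightarrow> ('n \<Rightarrow> real ^ 'n \<Rightarrow> real ^ 'n) \<Rightarrow> bool" where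
  "corrector \<A> A X DX \<longleftrightarrow>
     (\<forall>j. H1_loc UNIV (X j) (DX j) \<and>
        (\<forall>i. (\<lambda>y. DX j y $ i) \<in> besicovitch 2 \<A> \<and>
             besicovitch_mean 2 \<A> (\<lambda>y. DX j y $ i) = 0) \<and>
        (\<forall>\<phi>. test_function UNIV \<phi> \<longrightarrow>
           (LINT y|lebesgue. (A y *v (axis j 1 + DX j y)) \<bullet> grad \<phi> y) = 0))"

definition column_matrix :: "('n \<Rightarrow> real ^ 'n \<Rightarrow> real ^ 'n) \<Rightarrow> real ^ 'n \<Rightarrow> real ^ 'n ^ 'n" where
  "column_matrix G y = (\<chi> i j. G j y $ i)"

definition homogenized_matrix ::
  "(real ^ 'n \<Rightarrow> real) set \<Rightarrow> (real ^ 'n \<Rightarrow> real ^ 'n ^ 'n) \<Rightarrow>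
     ('n \<Rightarrow> real ^ 'n \<Rightarrow> real ^ 'n) \<Rightarrow> real ^ 'n ^ 'n" where
  "homogenized_matrix \<A> A DX =
     (\<chi> i j. besicovitch_mean 2 \<A> (\<lambda>y. (A y ** (mat 1 + column_matrix DX y)) $ i $ j))"

definition cube :: "real \<Rightarrow> (real ^ 'n) set" where
  "cube R = cbox (\<chi> i. - R / 2) (\<chi> i. R / 2)"

definition regularized_corrector ::
  "(real ^ 'n \<Rightarrow> real ^ 'n ^ 'n) \<Rightarrow> real \<Rightarrow> real \<Rightarrow>
     ('n \<Rightarrow> real ^ 'n \<Rightarrow> real) \<Rightarrow> ('n \<Rightarrow> real ^ 'n \<Rightarrow> real ^ 'n) \<Rightarrow> bool" where
  "regularized_corrector A R T X DX \<longleftrightarrow>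
     (\<forall>j. H1_0 (interior (cube R)) (X j) (DX j) \<and>
        (\<forall>\<phi>. test_function (interior (cube R)) \<phi> \<longrightarrow>
           (LINT y:cube R|lebesgue. (A y *v (axis j 1 + DX j y)) \<bullet> grad \<phi> y)
             + T powi (-2) * (LINT y:cube R|lebesgue. X j y * \<phi> y) = 0))"

definition approx_homogenized_matrix ::
  "(real ^ 'n \<Rightarrow> real ^ 'n ^ 'n) \<Rightarrow> real \<Rightarrow> ('n \<Rightarrow> real ^ 'n \<Rightarrow> real ^ 'n) \<Rightarrow> real ^ 'n ^ 'n" where
  "approx_homogenized_matrix A R DX =
     (LINT y:cube R|lebesgue. A y ** (mat 1 + column_matrix DX y))
       /\<^sub>R measure lebesgue (cube R :: (real ^ 'n) set)"

end

theory Submission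
  imports Defs
begin

text \<open>
  Write \<open>F\<^sub>j = A (e\<^sub>j + \<nabla>\<chi>\<^sub>T\<^sub>,\<^sub>j)\<close> for the flux of the regularized corrector on the cube of side \<open>T\<close>,
  \<open>G\<^sub>k = A (e\<^sub>k + \<nabla>\<chi>\<^sub>k)\<close> for the flux of the corrector, and average over that cube. Since \<open>A\<close> is
  symmetric, expanding \<open>A (e\<^sub>j + \<nabla>\<chi>\<^sub>T\<^sub>,\<^sub>j) \<bullet> (e\<^sub>k + \<nabla>\<chi>\<^sub>k)\<close> in two ways gives
  \<open>avg F\<^sub>j \<bullet> e\<^sub>k + avg F\<^sub>j \<bullet> \<nabla>\<chi>\<^sub>k = avg G\<^sub>k \<bullet> e\<^sub>j + avg G\<^sub>k \<bullet> \<nabla>\<chi>\<^sub>T\<^sub>,\<^sub>j\<close>. The first term is the entry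
  \<open>(k, j)\<close> of the approximate matrix. The third tends to the entry \<open>(j, k)\<close> of the homogenized one, by
  the mean value property. The fourth is zero, because \<open>\<chi>\<^sub>T\<^sub>,\<^sub>j\<close> vanishes on the boundary and is therefore
  an admissible test function for the corrector equation. So everything rests on showing that the
  second term tends to zero, that is, on a compensated compactness argument.

  This is the content of \<open>duality_small\<close>: if a field \<open>F\<close> has bounded mean square on the cube and its
  divergence is \<open>s\<close> with \<open>T s\<close> bounded in mean square, then \<open>F\<close> is almost orthogonal to every
  gradient \<open>\<nabla>u\<close> such that \<open>u\<close> and \<open>\<nabla>u\<close> belong to the Besicovitch space, uniformly in \<open>F\<close>. One tests
  with \<open>\<theta>\<^sub>T (\<rho> * u)\<close>, where \<open>\<rho>\<close> is a mollifier of fixed width and \<open>\<theta>\<^sub>T\<close> is a cutoff that varies on the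
  scale \<open>T\<close>. As \<open>u\<close> has bounded mean square, the terms with \<open>\<nabla>\<theta>\<^sub>T\<close> and with \<open>s\<close> are of order \<open>1/T\<close>. What
  remains is controlled by two properties that \<open>\<nabla>u\<close> inherits from its approximation by bounded
  uniformly continuous functions: it is close to \<open>\<rho> * \<nabla>u\<close> in mean square (\<open>besicovitch_mollify\<close>), and
  little of its mean square lies in a thin boundary layer of the cube (\<open>besicovitch_layer\<close>). For
  \<open>F\<^sub>j\<close> the two bounds come from testing the regularized equation with its own solution
  (\<open>regularized_energy\<close>); they depend only on the ellipticity and the sup bound of \<open>A\<close>.

  Applied to \<open>F = A (e\<^sub>j + \<nabla>\<chi>'\<^sub>j)\<close> with a second corrector, possibly for a second algebra, the same
  estimate shows that the homogenized matrix is symmetric and is the same for every algebra and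
  every corrector (\<open>homogenized_matrix_swap\<close>). Hence the possible errors on the cube of side \<open>T\<close> are
  determined by \<open>A\<close> and \<open>T\<close>; they are uniformly bounded and tend to zero, and a continuous function of
  \<open>T\<close> that dominates them and tends to zero is built in \<open>continuous_majorant\<close>.
\<close>

section \<open>Smooth functions and test functions\<close>

definition smooth :: "(real ^ 'n \<Rightarrow> real) \<Rightarrow> bool" where
  "smooth f \<longleftrightarrow> (\<forall>k. C_k k f)"

text \<open>
  Smoothness is a greatest fixed point: a set of differentiable functions that is closed under
  partial derivatives consists of smooth functions. All smoothness proofs below exhibit such a set.
\<close>
lemma smooth_coinduct:
  assumes "\<And>f. f \<in> S \<Longrightarrow> (\<forall>x. f differentiable at x) \<and> (\<forall>i. partial i f \<in> S)" and "f \<in> S"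
  shows "smooth f"
proof -
  have "C_k k f" if "f \<in> S" for k f using that
  proof (induction k arbitrary: f)
    case 0
    then show ?case
      using assms(1)[OF 0] by (auto intro!: continuous_at_imp_continuous_on differentiable_imp_continuous_within)
  next
    case (Suc k)
    then show ?case using assms(1)[OF Suc.prems] by auto
  qed
  with assms(2) show ?thesis by (auto simp: smooth_def)
qed

lemma smooth_differentiable: "smooth f \<Longrightarrow> f differentiable at x"
  unfolding smooth_def by (metis C_k.simps(2))

lemma smooth_partial: "smooth f \<Longrightarrow> smooth (partial i f)"
  unfolding smooth_def by (metis C_k.simps(2))

lemma smooth_continuous: "smooth f \<Longrightarrow> continuous_on S f"
  by (auto intro!: continuous_at_imp_continuous_on differentiable_imp_continuous_within smooth_differentiable)

lemma grad_has_derivative: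
  assumes "f differentiable at x"
  shows "(f has_derivative (\<lambda>h. grad f x \<bullet> h)) (at x)"
proof -
  have d: "(f has_derivative frechet_derivative f (at x)) (at x)"
    using assms frechet_derivative_works by blast
  then have lin: "linear (frechet_derivative f (at x))" by (rule has_derivative_linear)
  have "frechet_derivative f (at x) h = grad f x \<bullet> h" for h
  proof -
    have "frechet_derivative f (at x) (\<Sum>i\<in>UNIV. h $ i *\<^sub>R axis i 1) = (\<Sum>i\<in>UNIV. h $ i *\<^sub>R partial i f x)"
      by (simp add: linear_sum[OF lin] linear_scale[OF lin] partial_def)
    moreover have "(\<Sum>i\<in>UNIV. h $ i *\<^sub>R axis i 1) = h"
      using basis_expansion[of h] by (simp add: scalar_mult_eq_scaleR)
    ultimately show ?thesis by (simp add: inner_vec_def grad_def mult.commute)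
  qed
  then have "frechet_derivative f (at x) = (\<lambda>h. grad f x \<bullet> h)" by auto
  with d show ?thesis by simp
qed

lemma partial_eqI: "(f has_derivative f') (at x) \<Longrightarrow> partial i f x = f' (axis i 1)"
  unfolding partial_def using frechet_derivative_at by metis

lemma grad_eqI: "(f has_derivative (\<lambda>h. v \<bullet> h)) (at x) \<Longrightarrow> grad f x = v"
  by (simp add: vec_eq_iff grad_def partial_eqI[of f "\<lambda>h. v \<bullet> h"] inner_axis)

inductive_set generated_alg :: "(real ^ 'n \<Rightarrow> real) set \<Rightarrow> (real ^ 'n \<Rightarrow> real) set" for B where
  base: "f \<in> B \<Longrightarrow> f \<in> generated_alg B"
| const: "(\<lambda>x. c) \<in> generated_alg B"
| add: "f \<in> generated_alg B \<Longrightarrow> g \<in> generated_alg B \<Longrightarrow> (\<lambda>x. f x + g x) \<in> generated_alg B"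
| mult: "f \<in> generated_alg B \<Longrightarrow> g \<in> generated_alg B \<Longrightarrow> (\<lambda>x. f x * g x) \<in> generated_alg B"

text \<open>
  By the product rule it is enough to look at generators whose partial derivatives lie in the
  generated algebra, even if they are no generators themselves.
\<close>
lemma smooth_alg:
  fixes B :: "(real ^ 'n \<Rightarrow> real) set"
  assumes B: "\<And>f. f \<in> B \<Longrightarrow> (\<forall>x. f differentiable at x) \<and> (\<forall>i. partial i f \<in> generated_alg B)"
    and "f \<in> generated_alg B"
  shows "smooth f"
proof (rule smooth_coinduct[OF _ assms(2)])
  fix f assume "f \<in> generated_alg B"
  then show "(\<forall>x. f differentiable at x) \<and> (\<forall>i. partial i f \<in> generated_alg B)"
  proof induction
    case (base f)
    then show ?case using B by blast
  next
    case (const c)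
    have "partial i (\<lambda>x. c) = (\<lambda>x. 0)" for i :: 'n
      by (rule ext, subst partial_eqI[of _ "\<lambda>h. 0"]) auto
    then show ?case by (auto intro: generated_alg.const)
  next
    case (add f g)
    have "partial i (\<lambda>x. f x + g x) = (\<lambda>x. partial i f x + partial i g x)" for i
    proof (rule ext)
      fix x
      show "partial i (\<lambda>x. f x + g x) x = partial i f x + partial i g x"
        using add.IH by (subst partial_eqI[OF has_derivative_add[OF grad_has_derivative grad_has_derivative]])
          (auto simp: inner_axis grad_def)
    qed
    then show ?case using add.IH by (auto intro!: generated_alg.add)
  next
    case (mult f g)
    have "partial i (\<lambda>x. f x * g x) = (\<lambda>x. f x * partial i g x + partial i f x * g x)" for i
    proof (rule ext)
      fix x
      show "partial i (\<lambda>x. f x * g x) x = f x * partial i g x + partial i f x * g x"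
        using mult.IH by (subst partial_eqI[OF has_derivative_mult[OF grad_has_derivative grad_has_derivative]])
          (auto simp: inner_axis grad_def)
    qed
    then show ?case using mult.IH mult.hyps by (auto intro!: generated_alg.add generated_alg.mult)
  qed
qed

lemma smooth_mult: "smooth f \<Longrightarrow> smooth g \<Longrightarrow> smooth (\<lambda>x. f x * g x)"
  by (rule smooth_alg[where B = "{f. smooth f}"])
    (auto intro: generated_alg.intros smooth_partial smooth_differentiable)

lemma grad_mult:
  assumes "smooth f" "smooth g"
  shows "grad (\<lambda>x. f x * g x) x = f x *\<^sub>R grad g x + g x *\<^sub>R grad f x"
  using has_derivative_mult[OF grad_has_derivative grad_has_derivative, of f x g] assms
  by (intro grad_eqI) (auto simp: smooth_differentiable inner_left_distrib algebra_simps)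

lemma partial_affine:
  assumes "smooth f"
  shows "partial i (\<lambda>x. k * f (c *\<^sub>R x + a)) x = k * c * partial i f (c *\<^sub>R x + a)"
    and "(\<lambda>x. k * f (c *\<^sub>R x + a)) differentiable at x"
proof -
  have "((\<lambda>x. k * f (c *\<^sub>R x + a)) has_derivative (\<lambda>h. k * (grad f (c *\<^sub>R x + a) \<bullet> (c *\<^sub>R h)))) (at x)"
    by (auto intro!: derivative_eq_intros has_derivative_compose[of "\<lambda>x. c *\<^sub>R x + a" "\<lambda>h. c *\<^sub>R h" x UNIV f]
        grad_has_derivative smooth_differentiable assms)
  then show "(\<lambda>x. k * f (c *\<^sub>R x + a)) differentiable at x"
    and "partial i (\<lambda>x. k * f (c *\<^sub>R x + a)) x = k * c * partial i f (c *\<^sub>R x + a)"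
    by (auto simp: partial_eqI inner_axis grad_def differentiable_def)
qed

lemma smooth_affine:
  fixes f :: "real ^ 'n \<Rightarrow> real"
  assumes "smooth f"
  shows "smooth (\<lambda>x. k * f (c *\<^sub>R x + a))"
proof (rule smooth_coinduct)
  let ?S = "{g. \<exists>k f. smooth f \<and> g = (\<lambda>x. k * f (c *\<^sub>R x + a))}"
  show "(\<lambda>x. k * f (c *\<^sub>R x + a)) \<in> ?S" using assms by blast
  fix g assume "g \<in> ?S"
  then obtain k f where f: "smooth f" and g: "g = (\<lambda>x. k * f (c *\<^sub>R x + a))" by blast
  have "partial i g = (\<lambda>x. (k * c) * partial i f (c *\<^sub>R x + a))" for i
    unfolding g by (rule ext) (rule partial_affine(1)[OF f])
  then have p: "partial i g \<in> ?S" for i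
    by (intro CollectI exI[of _ "k * c"] exI[of _ "partial i f"] conjI smooth_partial[OF f])
  then show "(\<forall>x. g differentiable at x) \<and> (\<forall>i. partial i g \<in> ?S)"
    by (intro conjI allI p) (simp only: g partial_affine(2)[OF f])
qed

lemma test_functionD:
  assumes "test_function U \<phi>"
  shows "smooth \<phi>" "compact (closure {x. \<phi> x \<noteq> 0})" "\<And>x. x \<notin> U \<Longrightarrow> \<phi> x = 0"
    "\<And>i x. x \<notin> U \<Longrightarrow> partial i \<phi> x = 0"  "\<And>x. x \<notin> U \<Longrightarrow> grad \<phi> x = 0"
    "\<And>i. test_function U (partial i \<phi>)"
proof -
  show s: "smooth \<phi>" and c: "compact (closure {x. \<phi> x \<noteq> 0})"
    using assms by (auto simp: test_function_def smooth_def)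
  have sub: "closure {x. \<phi> x \<noteq> 0} \<subseteq> U" using assms by (auto simp: test_function_def)
  show "\<And>x. x \<notin> U \<Longrightarrow> \<phi> x = 0" using sub closure_subset[of "{x. \<phi> x \<noteq> 0}"] by auto
  have z: "partial i \<phi> x = 0" if "x \<notin> closure {x. \<phi> x \<noteq> 0}" for i x
  proof -
    have "((\<lambda>x. 0) has_derivative (\<lambda>h. 0)) (at x)" by simp
    then have "(\<phi> has_derivative (\<lambda>h. 0)) (at x)"
    proof (rule has_derivative_transform_within_open)
      show "open (- closure {x. \<phi> x \<noteq> 0})" by auto
      show "x \<in> - closure {x. \<phi> x \<noteq> 0}" using that by simp
    next
      fix y assume "y \<in> - closure {x. \<phi> x \<noteq> 0}"
      then show "0 = \<phi> y" using closure_subset[of "{x. \<phi> x \<noteq> 0}"] by auto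
    qed
    then show ?thesis by (simp add: partial_eqI)
  qed
  then show p: "\<And>i x. x \<notin> U \<Longrightarrow> partial i \<phi> x = 0" using sub by blast
  then show "\<And>x. x \<notin> U \<Longrightarrow> grad \<phi> x = 0" by (simp add: grad_def vec_eq_iff)
  have "closure {x. partial i \<phi> x \<noteq> 0} \<subseteq> closure {x. \<phi> x \<noteq> 0}" for i
    by (rule closure_minimal) (use z in auto)
  then show "\<And>i. test_function U (partial i \<phi>)"
    using sub c smooth_partial[OF s] unfolding test_function_def smooth_def
    by (metis (no_types, lifting) bounded_subset closed_closure compact_eq_bounded_closed subset_trans)
qed

lemma test_functionI:
  assumes "smooth \<phi>" "compact K" "K \<subseteq> U" "\<And>x. x \<notin> K \<Longrightarrow> \<phi> x = 0"
  shows "test_function U \<phi>"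
proof -
  have "closure {x. \<phi> x \<noteq> 0} \<subseteq> K"
    by (rule closure_minimal) (use assms compact_imp_closed in auto)
  then show ?thesis using assms unfolding test_function_def smooth_def
    by (metis (no_types, lifting) bounded_subset closed_closure compact_eq_bounded_closed subset_trans)
qed

lemma test_function_mult:
  assumes "test_function U \<theta>" "smooth f"
  shows "test_function U (\<lambda>x. \<theta> x * f x)"
proof (rule test_functionI)
  show "smooth (\<lambda>x. \<theta> x * f x)" by (rule smooth_mult[OF test_functionD(1)[OF assms(1)] assms(2)])
  show "compact (closure {x. \<theta> x \<noteq> 0})" "closure {x. \<theta> x \<noteq> 0} \<subseteq> U" using assms by (auto simp: test_function_def)
  show "\<And>x. x \<notin> closure {x. \<theta> x \<noteq> 0} \<Longrightarrow> \<theta> x * f x = 0" using closure_subset[of "{x. \<theta> x \<noteq> 0}"] by auto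
qed

lemma test_function_affine:
  assumes "test_function U \<phi>" "c \<noteq> 0" "\<And>x. c *\<^sub>R x + a \<in> U \<Longrightarrow> x \<in> V"
  shows "test_function V (\<lambda>x. k * \<phi> (c *\<^sub>R x + a))"
proof (rule test_functionI)
  let ?K = "closure {x. \<phi> x \<noteq> 0}"
  show "smooth (\<lambda>x. k * \<phi> (c *\<^sub>R x + a))" using assms by (intro smooth_affine test_functionD(1)[OF assms(1)])
  show "compact ((\<lambda>y. inverse c *\<^sub>R (y - a)) ` ?K)"
    by (intro compact_continuous_image continuous_intros) (use assms in \<open>auto simp: test_function_def\<close>)
  show "(\<lambda>y. inverse c *\<^sub>R (y - a)) ` ?K \<subseteq> V"
    using assms by (auto simp: test_function_def)
  show "k * \<phi> (c *\<^sub>R x + a) = 0" if "x \<notin> (\<lambda>y. inverse c *\<^sub>R (y - a)) ` ?K" for x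
  proof (rule ccontr)
    assume "k * \<phi> (c *\<^sub>R x + a) \<noteq> 0"
    then have "\<phi> (c *\<^sub>R x + a) \<noteq> 0" by simp
    then have "c *\<^sub>R x + a \<in> ?K" using closure_subset[of "{x. \<phi> x \<noteq> 0}"] by (simp add: subset_iff)
    then have "inverse c *\<^sub>R ((c *\<^sub>R x + a) - a) \<in> (\<lambda>y. inverse c *\<^sub>R (y - a)) ` ?K" by blast
    then show False using that assms by simp
  qed
qed

lemma test_function_mono: "test_function U \<phi> \<Longrightarrow> U \<subseteq> V \<Longrightarrow> test_function V \<phi>"
  by (auto simp: test_function_def)

lemma test_function_support:
  assumes "test_function U \<phi>" obtains R where "R > 0" "\<And>x. norm x > R \<Longrightarrow> \<phi> x = 0"
proof -
  obtain R where "R > 0" "\<forall>x\<in>closure {x. \<phi> x \<noteq> 0}. norm x \<le> R"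
    using test_functionD(2)[OF assms] compact_imp_bounded bounded_pos by metis
  then have "\<phi> x = 0" if "norm x > R" for x
    using closure_subset[of "{x. \<phi> x \<noteq> 0}"] that by fastforce
  with \<open>R > 0\<close> show ?thesis by (rule that)
qed

lemma test_function_bounded:
  assumes "test_function U \<phi>" obtains B where "B > 0" "\<And>x. \<bar>\<phi> x\<bar> \<le> B"
proof -
  have "bounded (\<phi> ` closure {x. \<phi> x \<noteq> 0})"
    by (intro compact_imp_bounded compact_continuous_image smooth_continuous test_functionD(1,2)[OF assms])
  then obtain B where "B > 0" "\<And>x. x \<in> closure {x. \<phi> x \<noteq> 0} \<Longrightarrow> norm (\<phi> x) \<le> B"
    unfolding bounded_pos by auto
  then have "\<bar>\<phi> x\<bar> \<le> B" for x
    using closure_subset[of "{x. \<phi> x \<noteq> 0}"] by (cases "\<phi> x = 0") auto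
  with \<open>B > 0\<close> show ?thesis by (rule that)
qed

lemma test_function_uniformly_continuous:
  fixes \<phi> :: "real ^ 'n \<Rightarrow> real"
  assumes "test_function U \<phi>"
  shows "uniformly_continuous_on UNIV \<phi>"
proof -
  obtain R where R: "R > 0" "\<And>x. norm x > R \<Longrightarrow> \<phi> x = 0" using test_function_support[OF assms] by blast
  have uc: "uniformly_continuous_on (cball 0 (R + 1)) \<phi>"
    by (intro compact_uniformly_continuous smooth_continuous test_functionD(1,2)[OF assms]) auto
  show ?thesis unfolding uniformly_continuous_on_def
  proof (intro allI impI)
    fix e :: real assume "e > 0"
    then obtain d where d: "d > 0" "\<And>x y. x \<in> cball 0 (R+1) \<Longrightarrow> y \<in> cball 0 (R+1) \<Longrightarrow> dist y x < d \<Longrightarrow> dist (\<phi> y) (\<phi> x) < e"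
      using uc unfolding uniformly_continuous_on_def by metis
    show "\<exists>d>0. \<forall>x\<in>UNIV. \<forall>x'\<in>UNIV. dist x' x < d \<longrightarrow> dist (\<phi> x') (\<phi> x) < e"
    proof (intro exI[of _ "min d 1"] conjI ballI impI)
      fix x y :: "real ^ 'n" assume xy: "dist y x < min d 1"
      have n: "norm x \<le> norm y + dist y x" "norm y \<le> norm x + dist y x"
        using norm_triangle_sub[of x y] norm_triangle_sub[of y x] by (auto simp: dist_norm norm_minus_commute)
      consider "norm x \<le> R + 1 \<and> norm y \<le> R + 1" | "norm x > R" "norm y > R" using xy n by force
      then show "dist (\<phi> y) (\<phi> x) < e"
        by cases (use d xy R \<open>e > 0\<close> in auto)
    qed (use d in auto)
  qed
qed

text \<open>
  The linearization error is uniform in the base point; this is what allows differentiation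
  under a convolution integral.
\<close>
lemma test_function_uniform_derivative:
  fixes \<phi> :: "real ^ 'a \<Rightarrow> real"
  assumes "test_function U \<phi>" and "e > 0"
  obtains d where "d > 0" "\<And>x h. norm h < d \<Longrightarrow> \<bar>\<phi> (x + h) - \<phi> x - grad \<phi> x \<bullet> h\<bar> \<le> e * norm h"
proof -
  have "uniformly_continuous_on UNIV (grad \<phi>)"
  proof -
    have uc: "uniformly_continuous_on UNIV (partial i \<phi>)" for i
      using assms by (intro test_function_uniformly_continuous) (rule test_functionD(6))
    then have "\<exists>d>0. \<forall>x y. dist x y < d \<longrightarrow> dist (partial i \<phi> x) (partial i \<phi> y) < e / CARD('a)" if "e > 0" for i e
    proof -
      have "e / CARD('a) > 0" using that by simp
      then show ?thesis
        using uc[of i] unfolding uniformly_continuous_on_def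
        by (metis UNIV_I)
    qed
    then have "\<forall>e. \<forall>i. \<exists>d. e > 0 \<longrightarrow> d>0 \<and> (\<forall>x y. dist x y < d \<longrightarrow> dist (partial i \<phi> x) (partial i \<phi> y) < e / CARD('a))"
      by blast
    then obtain D where D: "\<And>e i. e > 0 \<Longrightarrow> D e i > 0"
      "\<And>e i x y. e > 0 \<Longrightarrow> dist x y < D e i \<Longrightarrow> dist (partial i \<phi> x) (partial i \<phi> y) < e / CARD('a)" by metis
    show ?thesis unfolding uniformly_continuous_on_def
    proof (intro allI impI)
      fix e :: real assume e: "e > 0"
      show "\<exists>d>0. \<forall>x\<in>UNIV. \<forall>x'\<in>UNIV. dist x' x < d \<longrightarrow> dist (grad \<phi> x') (grad \<phi> x) < e"
      proof (intro exI[of _ "Min (range (D e))"] conjI ballI impI)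
        show "0 < Min (range (D e))" using D(1)[OF e] by auto
        fix x y :: "real ^ 'a" assume "dist y x < Min (range (D e))"
        then have *: "dist y x < D e i" for i by simp
        have "norm (grad \<phi> y - grad \<phi> x) \<le> (\<Sum>i\<in>UNIV. \<bar>(grad \<phi> y - grad \<phi> x) $ i\<bar>)" by (rule norm_le_l1_cart)
        also have "\<dots> < (\<Sum>i\<in>(UNIV::'a set). e / CARD('a))"
          by (rule sum_strict_mono) (use D(2)[OF e *] in \<open>auto simp: grad_def dist_real_def\<close>)
        finally show "dist (grad \<phi> y) (grad \<phi> x) < e" by (simp add: dist_norm)
      qed
    qed
  qed
  then obtain d where d: "d > 0" "\<And>x y. dist x y < d \<Longrightarrow> dist (grad \<phi> x) (grad \<phi> y) < e"
    using assms(2) unfolding uniformly_continuous_on_def by (metis UNIV_I)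
  show ?thesis
  proof (rule that[OF d(1)])
    fix x h :: "real ^ 'a" assume h: "norm h < d"
    have "norm (\<phi> (x + h) - \<phi> x - grad \<phi> x \<bullet> ((x + h) - x)) \<le> norm ((x + h) - x) * e"
    proof (rule differentiable_bound_linearization[where f' = "\<lambda>y h. grad \<phi> y \<bullet> h" and S = "closed_segment x (x + h)"])
      show "x + t *\<^sub>R ((x + h) - x) \<in> closed_segment x (x + h)" if "t \<in> {0..1}" for t
        using that by (auto simp: closed_segment_def algebra_simps intro!: exI[of _ t])
      show "(\<phi> has_derivative (\<lambda>h. grad \<phi> y \<bullet> h)) (at y within closed_segment x (x + h))" for y
        by (rule has_derivative_at_withinI[OF grad_has_derivative[OF smooth_differentiable[OF test_functionD(1)[OF assms(1)]]]])
    next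
      fix y :: "real ^ 'a" assume "y \<in> closed_segment x (x + h)"
      then have "dist y x < d" using h dist_in_closed_segment[of y x "x+h"]
        by (simp add: dist_norm norm_minus_commute)
      then have "norm (grad \<phi> y - grad \<phi> x) \<le> e" using d(2)[of y x] by (simp add: dist_norm)
      then show "onorm ((\<lambda>v. grad \<phi> y \<bullet> v) - (\<lambda>v. grad \<phi> x \<bullet> v)) \<le> e"
        by (intro onorm_le) (auto simp: inner_diff_left[symmetric] intro!: order_trans[OF Cauchy_Schwarz_ineq2] mult_right_mono)
    qed auto
    then show "\<bar>\<phi> (x + h) - \<phi> x - grad \<phi> x \<bullet> h\<bar> \<le> e * norm h" by (simp add: mult.commute)
  qed
qed

section \<open>A smooth bump function\<close>

text \<open>The factor \<open>1 / t ^ n\<close> makes the family closed under differentiation, up to linear combinations.\<close>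
definition flat :: "nat \<Rightarrow> real \<Rightarrow> real" where
  "flat n t = (if t > 0 then exp (- 1 / t) / t ^ n else 0)"

lemma flat_tendsto_0: "(flat n \<longlongrightarrow> 0) (at 0)"
proof (rule filterlim_split_at_real)
  have "eventually (\<lambda>t. flat n t = 0) (at_left (0::real))"
    by (auto simp: flat_def eventually_at_filter)
  then show "(flat n \<longlongrightarrow> 0) (at_left 0)" by (rule tendsto_eventually)
  have "((\<lambda>t. inverse t ^ n / exp (inverse t)) \<longlongrightarrow> 0) (at_right (0::real))"
    by (rule filterlim_compose[OF tendsto_power_div_exp_0 filterlim_inverse_at_top_right])
  then show "(flat n \<longlongrightarrow> 0) (at_right 0)"
    by (rule filterlim_cong[THEN iffD1, rotated -1])
      (auto simp: flat_def eventually_at_filter exp_minus field_simps)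
qed

lemma flat_DERIV: "(flat n has_real_derivative flat (n + 2) t - n * flat (n + 1) t) (at t)"
proof -
  consider "t < 0" | "t = 0" | "t > 0" by linarith
  then show ?thesis
  proof cases
    case 1
    have "((\<lambda>t. 0) has_real_derivative 0) (at t)" by simp
    then have "(flat n has_real_derivative 0) (at t)"
      by (rule has_field_derivative_transform_within_open[where S = "{..<0}"]) (use 1 in \<open>auto simp: flat_def\<close>)
    then show ?thesis using 1 by (simp add: flat_def)
  next
    case 2
    \<comment> \<open>the difference quotient at the origin is again a function of the family\<close>
    have "(\<lambda>h. (flat n (0 + h) - flat n 0) / h) = flat (n + 1)"
      by (rule ext) (auto simp: flat_def)
    then show ?thesis using 2 flat_tendsto_0[of "n + 1"] by (simp add: DERIV_def flat_def)
  next
    case 3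
    have "((\<lambda>t. exp (- 1 / t) * (inverse t) ^ n) has_real_derivative
        exp (- 1 / t) * (1 / t\<^sup>2) * (inverse t) ^ n + exp (- 1 / t) * (real n * (inverse t) ^ (n - 1) * (- inverse (t\<^sup>2)))) (at t)"
      using 3 by (auto intro!: derivative_eq_intros simp: power2_eq_square divide_inverse)
    moreover have "exp (- 1 / t) * (1 / t\<^sup>2) * (inverse t) ^ n + exp (- 1 / t) * (real n * (inverse t) ^ (n - 1) * (- inverse (t\<^sup>2)))
       = flat (n + 2) t - n * flat (n + 1) t"
      using 3 by (cases n) (auto simp: flat_def power2_eq_square field_simps)
    ultimately have "((\<lambda>t. exp (- 1 / t) * (inverse t) ^ n) has_real_derivative flat (n + 2) t - n * flat (n + 1) t) (at t)"
      by simp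
    then show ?thesis
      by (rule has_field_derivative_transform_within_open[where S = "{0<..}"]) (use 3 in \<open>auto simp: flat_def field_simps\<close>)
  qed
qed

lemma smooth_bump: "smooth (\<lambda>x :: real ^ 'n. flat 0 (1 - x \<bullet> x))"
proof -
  let ?B = "range (\<lambda>n (x :: real ^ 'n). flat n (1 - x \<bullet> x)) \<union> range (\<lambda>i x. x $ i)"
  show ?thesis
  proof (rule smooth_alg[where B = ?B])
    show "(\<lambda>x. flat 0 (1 - x \<bullet> x)) \<in> generated_alg ?B" by (intro generated_alg.base) auto
    fix f :: "real ^ 'n \<Rightarrow> real" assume "f \<in> ?B"
    then consider n where "f = (\<lambda>x. flat n (1 - x \<bullet> x))" | i where "f = (\<lambda>x. x $ i)" by auto
    then show "(\<forall>x. f differentiable at x) \<and> (\<forall>i. partial i f \<in> generated_alg ?B)"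
    proof cases
      case 1
      have d: "(f has_derivative (\<lambda>h. (flat (n + 2) (1 - x \<bullet> x) - n * flat (n + 1) (1 - x \<bullet> x)) * (- 2 * (x \<bullet> h)))) (at x)" for x
        unfolding 1
        by (rule has_derivative_eq_rhs[OF has_derivative_compose[OF _ flat_DERIV[unfolded has_field_derivative_def]]])
          (auto intro!: derivative_eq_intros simp: inner_commute)
      have "partial i f = (\<lambda>x. (flat (n + 2) (1 - x \<bullet> x) + (- real n) * flat (n + 1) (1 - x \<bullet> x)) * (- 2 * x $ i))" for i
        by (rule ext, subst partial_eqI[OF d]) (simp add: inner_axis)
      moreover have "(\<lambda>x. (flat (n + 2) (1 - x \<bullet> x) + (- real n) * flat (n + 1) (1 - x \<bullet> x)) * (- 2 * x $ i)) \<in> generated_alg ?B" for i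
        by (intro generated_alg.mult[of "\<lambda>x. flat (n + 2) (1 - x \<bullet> x) + (- real n) * flat (n + 1) (1 - x \<bullet> x)" _ "\<lambda>x. - 2 * x $ i"]
          generated_alg.add[of "\<lambda>x. flat (n + 2) (1 - x \<bullet> x)" _ "\<lambda>x. (- real n) * flat (n + 1) (1 - x \<bullet> x)"]
          generated_alg.mult[of "\<lambda>x. - real n" _ "\<lambda>x. flat (n + 1) (1 - x \<bullet> x)"] generated_alg.mult[of "\<lambda>x. - 2" _ "\<lambda>x. x $ i"] generated_alg.const)
          (auto intro: generated_alg.base)
      ultimately show ?thesis using d by (auto simp: differentiable_def)
    next
      case 2
      have d: "(f has_derivative (\<lambda>h. h $ i)) (at x)" for x
        unfolding 2 by (rule bounded_linear_imp_has_derivative) (rule bounded_linear_vec_nth)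
      have "partial k f = (\<lambda>x. axis k 1 $ i)" for k
        by (rule ext, subst partial_eqI[OF d]) simp
      then show ?thesis using d by (auto simp: differentiable_def intro: generated_alg.const)
    qed
  qed
qed

lemma flat_0_bounds: "0 \<le> flat 0 t" "t > 0 \<Longrightarrow> flat 0 t > 0" "t \<le> 0 \<Longrightarrow> flat 0 t = 0"
  "s \<le> t \<Longrightarrow> flat 0 s \<le> flat 0 t"
  by (auto simp: flat_def frac_le)

section \<open>Locally integrable functions and mollifiers\<close>

lemma integrable_indicator_compact: "compact K \<Longrightarrow> integrable lebesgue (indicat_real (K :: (real ^ 'n) set))"
  using lmeasurable_compact lmeasurable_iff_integrable by blast

lemma set_borel_measurable_compact:
  fixes w :: "real ^ 'n \<Rightarrow> 'b::euclidean_space"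
  shows "w \<in> borel_measurable lebesgue \<Longrightarrow> compact K \<Longrightarrow> set_borel_measurable lebesgue K w"
  unfolding set_borel_measurable_def
  by (intro borel_measurable_scaleR borel_measurable_indicator fmeasurableD lmeasurable_compact)

text \<open>
  Local integrability gives measurability on compact sets only; the ball cutoffs converge pointwise.
\<close>
lemma Lp_loc_measurable:
  fixes w :: "real ^ 'n \<Rightarrow> 'b::euclidean_space"
  assumes "Lp_loc p UNIV w" shows "w \<in> borel_measurable lebesgue"
proof (rule borel_measurable_LIMSEQ_metric)
  show "(\<lambda>x. indicator (cball 0 (real n)) x *\<^sub>R w x) \<in> borel_measurable lebesgue" for n
    using assms by (auto simp: Lp_loc_def Lp_on_def set_borel_measurable_def)
  fix x :: "real ^ 'n"
  obtain N where "norm x \<le> real N" using real_arch_simple by blast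
  then have "\<forall>n\<ge>N. indicator (cball 0 (real n)) x *\<^sub>R w x = w x" by (auto simp: indicator_def)
  then show "(\<lambda>n. indicator (cball 0 (real n)) x *\<^sub>R w x) \<longlonglongrightarrow> w x"
    by (intro tendsto_eventually) (auto simp: eventually_sequentially)
qed

lemma Lp_loc_iff:
  fixes w :: "real ^ 'n \<Rightarrow> 'b::euclidean_space"
  shows "Lp_loc p UNIV w \<longleftrightarrow> w \<in> borel_measurable lebesgue \<and>
    (\<forall>K. compact K \<longrightarrow> set_integrable lebesgue K (\<lambda>x. norm (w x) powr p))"
proof -
  have "Lp_loc p UNIV w \<longleftrightarrow> (\<forall>K. compact K \<longrightarrow>
      set_borel_measurable lebesgue K w \<and> set_integrable lebesgue K (\<lambda>x. norm (w x) powr p))"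
    by (simp only: Lp_loc_def Lp_on_def subset_UNIV simp_thms)
  moreover have "\<And>K. w \<in> borel_measurable lebesgue \<Longrightarrow> compact K \<Longrightarrow> set_borel_measurable lebesgue K w"
    by (rule set_borel_measurable_compact)
  moreover have "Lp_loc p UNIV w \<Longrightarrow> w \<in> borel_measurable lebesgue" by (rule Lp_loc_measurable)
  ultimately show ?thesis by metis
qed

lemma Lp_loc_1_iff:
  fixes w :: "real ^ 'n \<Rightarrow> 'b::euclidean_space"
  shows "Lp_loc 1 UNIV w \<longleftrightarrow> w \<in> borel_measurable lebesgue \<and> (\<forall>K. compact K \<longrightarrow> set_integrable lebesgue K w)"
proof -
  have "set_integrable lebesgue K (\<lambda>x. norm (w x) powr 1) \<longleftrightarrow> set_integrable lebesgue K w"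
    if "w \<in> borel_measurable lebesgue" "compact K" for K
  proof -
    have m: "(\<lambda>x. indicator K x *\<^sub>R w x) \<in> borel_measurable lebesgue"
      using set_borel_measurable_compact[OF that] by (simp only: set_borel_measurable_def)
    have "integrable lebesgue (\<lambda>x. indicator K x *\<^sub>R w x) \<longleftrightarrow> integrable lebesgue (\<lambda>x. norm (indicator K x *\<^sub>R w x))"
      using m by (simp only: integrable_norm_iff)
    then show ?thesis by (simp add: set_integrable_def)
  qed
  then show ?thesis unfolding Lp_loc_iff by metis
qed

lemma Lp_loc_2_iff:
  fixes w :: "real ^ 'n \<Rightarrow> 'b::euclidean_space"
  shows "Lp_loc 2 UNIV w \<longleftrightarrow> w \<in> borel_measurable lebesgue \<and> (\<forall>K. compact K \<longrightarrow> set_integrable lebesgue K (\<lambda>x. (norm (w x))\<^sup>2))"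
proof -
  have "(\<lambda>x. norm (w x) powr 2) = (\<lambda>x. (norm (w x))\<^sup>2)" by (rule ext) (case_tac "w x = 0"; simp)
  then show ?thesis unfolding Lp_loc_iff by simp
qed

lemma Lp_loc_2_imp_1:
  fixes w :: "real ^ 'n \<Rightarrow> 'b::euclidean_space"
  assumes "Lp_loc 2 UNIV w" shows "Lp_loc 1 UNIV w"
  unfolding Lp_loc_1_iff
proof (intro conjI allI impI)
  show m: "w \<in> borel_measurable lebesgue" using assms by (rule Lp_loc_measurable)
  fix K :: "(real ^ 'n) set" assume K: "compact K"
  have "integrable lebesgue (\<lambda>x. indicator K x + indicator K x *\<^sub>R (norm (w x))\<^sup>2)"
    using assms K unfolding Lp_loc_2_iff set_integrable_def
    by (intro Bochner_Integration.integrable_add integrable_indicator_compact) auto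
  then show "set_integrable lebesgue K w" unfolding set_integrable_def
  proof (rule Bochner_Integration.integrable_bound)
    show "(\<lambda>x. indicator K x *\<^sub>R w x) \<in> borel_measurable lebesgue"
      using m K by (intro borel_measurable_scaleR borel_measurable_indicator) (auto simp: lmeasurable_compact fmeasurableD)
    have "norm (w x) \<le> 1 + (norm (w x))\<^sup>2" for x
    proof -
      have "0 \<le> (norm (w x) - 1)\<^sup>2 + norm (w x)" by simp
      then show ?thesis by (simp add: power2_eq_square algebra_simps)
    qed
    then show "AE x in lebesgue. norm (indicator K x *\<^sub>R w x) \<le> norm (indicator K x + indicator K x *\<^sub>R (norm (w x))\<^sup>2)"
      by (auto simp: indicator_def)
  qed
qed

lemma smooth_measurable:
  assumes "smooth \<phi>" shows "\<phi> \<in> borel_measurable borel" "\<phi> \<in> borel_measurable lebesgue"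
proof -
  show "\<phi> \<in> borel_measurable borel" by (intro borel_measurable_continuous_onI smooth_continuous assms)
  then show "\<phi> \<in> borel_measurable lebesgue" by (simp add: measurable_completion)
qed

lemma test_function_mult_integrable:
  fixes w :: "real ^ 'n \<Rightarrow> 'b::euclidean_space"
  assumes "test_function U \<phi>" "Lp_loc 1 UNIV w"
  shows "integrable lebesgue (\<lambda>x. \<phi> x *\<^sub>R w x)"
proof -
  obtain B where B: "B > 0" "\<And>x. \<bar>\<phi> x\<bar> \<le> B" using test_function_bounded[OF assms(1)] by blast
  obtain R where R: "R > 0" "\<And>x. norm x > R \<Longrightarrow> \<phi> x = 0" using test_function_support[OF assms(1)] by blast
  have "integrable lebesgue (\<lambda>x. B *\<^sub>R (indicator (cball 0 R) x *\<^sub>R w x))"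
    using assms(2) unfolding Lp_loc_1_iff set_integrable_def by (intro integrable_scaleR_right) auto
  then show ?thesis
  proof (rule Bochner_Integration.integrable_bound)
    show "(\<lambda>x. \<phi> x *\<^sub>R w x) \<in> borel_measurable lebesgue"
      using assms(2) smooth_measurable(2)[OF test_functionD(1)[OF assms(1)]]
      by (intro borel_measurable_scaleR) (auto simp: Lp_loc_1_iff)
    show "AE x in lebesgue. norm (\<phi> x *\<^sub>R w x) \<le> norm (B *\<^sub>R (indicator (cball 0 R) x *\<^sub>R w x))"
    proof (rule AE_I2)
      fix x
      show "norm (\<phi> x *\<^sub>R w x) \<le> norm (B *\<^sub>R (indicator (cball 0 R) x *\<^sub>R w x))"
        using R(2)[of x] B by (cases "norm x \<le> R") (auto simp: mult_right_mono)
    qed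
  qed
qed

lemma Lp_loc_1_const: "Lp_loc 1 UNIV (\<lambda>x. c)"
  unfolding Lp_loc_1_iff set_integrable_def
  by (auto intro!: integrable_scaleR_left integrable_indicator_compact)

lemma test_function_integrable: "test_function U \<phi> \<Longrightarrow> integrable lebesgue \<phi>"
  using test_function_mult_integrable[OF _ Lp_loc_1_const[of "1::real"]] by simp

lemma test_function_reflect: "test_function UNIV \<rho> \<Longrightarrow> test_function UNIV (\<lambda>y. \<rho> (x - y))"
  using test_function_affine[of UNIV \<rho> "-1" x UNIV 1] by (simp add: algebra_simps)

lemma mollifier_exists:
  assumes "\<epsilon> > 0"
  obtains \<rho> :: "real ^ 'n \<Rightarrow> real" where "test_function UNIV \<rho>" "\<And>x. \<rho> x \<ge> 0"
    "\<And>x. norm x > \<epsilon> \<Longrightarrow> \<rho> x = 0" "(LINT x|lebesgue. \<rho> x) = 1"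
proof -
  define b where "b = (\<lambda>x :: real ^ 'n. 1 * flat 0 (1 - (inverse \<epsilon> *\<^sub>R x + 0) \<bullet> (inverse \<epsilon> *\<^sub>R x + 0)))"
  have sm: "smooth b" unfolding b_def by (rule smooth_affine[OF smooth_bump])
  have b: "b x = flat 0 (1 - (norm x / \<epsilon>)\<^sup>2)" for x
    using assms by (simp add: b_def power2_norm_eq_inner[symmetric] power_divide field_simps)
  have b0: "b x \<ge> 0" for x by (simp add: b flat_0_bounds)
  have bs: "b x = 0" if "norm x > \<epsilon>" for x
    using assms that unfolding b by (intro flat_0_bounds(3)) (simp add: one_le_power)
  have t: "test_function UNIV b"
    by (rule test_functionI[OF sm, of "cball 0 \<epsilon>"]) (use bs in auto)
  define I where "I = (LINT x|lebesgue. b x)"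
  have "0 < flat 0 (3/4) * measure lebesgue (ball (0 :: real ^ 'n) (\<epsilon> / 2))"
    using assms by (intro mult_pos_pos flat_0_bounds) (auto simp: content_ball_pos)
  also have "\<dots> = (LINT x|lebesgue. flat 0 (3/4) * indicator (ball (0 :: real ^ 'n) (\<epsilon> / 2)) x)" by simp
  also have "\<dots> \<le> I" unfolding I_def
  proof (rule integral_mono)
    show "integrable lebesgue b" using t by (rule test_function_integrable)
    show "integrable lebesgue (\<lambda>x. flat 0 (3/4) * indicator (ball (0 :: real ^ 'n) (\<epsilon> / 2)) x)"
      using lmeasurable_ball lmeasurable_iff_integrable by (intro integrable_mult_right) blast
    fix x :: "real ^ 'n"
    have "flat 0 (3/4) \<le> b x" if "norm x < \<epsilon> / 2"
      unfolding b
    proof (rule flat_0_bounds(4))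
      have "norm x / \<epsilon> \<le> 1/2" using that assms by (simp add: field_simps)
      then have "(norm x / \<epsilon>)\<^sup>2 \<le> (1/2)\<^sup>2" using assms by (intro power_mono) auto
      then show "3/4 \<le> 1 - (norm x / \<epsilon>)\<^sup>2" by (simp add: power2_eq_square)
    qed
    then show "flat 0 (3/4) * indicator (ball 0 (\<epsilon> / 2)) x \<le> b x" using b0 by (auto simp: indicator_def)
  qed
  finally have I: "I > 0" .
  show ?thesis
  proof (rule that[of "\<lambda>x. inverse I * b (1 *\<^sub>R x + 0)"])
    show "test_function UNIV (\<lambda>x. inverse I * b (1 *\<^sub>R x + 0))"
      by (rule test_function_affine) (use t in auto)
    show "(LINT x|lebesgue. inverse I * b (1 *\<^sub>R x + 0)) = 1"
      using I by (simp add: I_def)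
  qed (use b0 bs I in auto)
qed

section \<open>Convolution with a test function\<close>

definition conv :: "(real ^ 'n \<Rightarrow> real) \<Rightarrow> (real ^ 'n \<Rightarrow> real) \<Rightarrow> real ^ 'n \<Rightarrow> real" where
  "conv \<rho> w x = (LINT y|lebesgue. \<rho> (x - y) * w y)"

lemma conv_integrable:
  assumes "test_function UNIV \<rho>" "Lp_loc 1 UNIV w"
  shows "integrable lebesgue (\<lambda>y. \<rho> (x - y) * w y)"
  using test_function_mult_integrable[OF test_function_reflect[OF assms(1)] assms(2), of x] by simp

text \<open>
  Near \<open>x\<close> the integrand is supported in a fixed compact ball, on which \<open>w\<close> is integrable and the
  linearization error of \<open>\<rho>\<close> is uniformly small.
\<close>
lemma conv_has_derivative:
  assumes \<rho>: "test_function UNIV \<rho>" and w: "Lp_loc 1 UNIV w"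
  shows "(conv \<rho> w has_derivative (\<lambda>h. (\<chi> i. conv (partial i \<rho>) w x) \<bullet> h)) (at x)"
  unfolding has_derivative_at_alt
proof (intro conjI allI impI)
  show "bounded_linear (\<lambda>h. (\<chi> i. conv (partial i \<rho>) w x) \<bullet> h)" by (rule bounded_linear_inner_right)
  fix e :: real assume e: "e > 0"
  obtain R where R: "R > 0" "\<And>x. norm x > R \<Longrightarrow> \<rho> x = 0" using test_function_support[OF \<rho>] by blast
  have gR: "grad \<rho> x = 0" if "norm x > R" for x
    using test_functionD(5)[of "cball 0 R" \<rho> x] test_functionI[OF test_functionD(1)[OF \<rho>], of "cball 0 R" "cball 0 R"] R that
    by auto
  let ?K = "cball x (R + 1)"
  define J where "J = (LINT y|lebesgue. indicator ?K y * \<bar>w y\<bar>)"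
  have Ji: "integrable lebesgue (\<lambda>y. indicator ?K y * \<bar>w y\<bar>)"
  proof -
    have "integrable lebesgue (\<lambda>y. norm (indicator ?K y *\<^sub>R w y))"
      by (rule integrable_norm) (use w in \<open>auto simp: Lp_loc_1_iff set_integrable_def\<close>)
    then show ?thesis by (simp add: abs_mult)
  qed
  have J0: "J \<ge> 0" unfolding J_def by (rule integral_nonneg_AE) auto
  define e' where "e' = e / (J + 1)"
  have e': "e' > 0" "e' * J \<le> e" using e J0 by (auto simp: e'_def field_simps)
  obtain d where d: "d > 0" "\<And>x h. norm h < d \<Longrightarrow> \<bar>\<rho> (x + h) - \<rho> x - grad \<rho> x \<bullet> h\<bar> \<le> e' * norm h"
    using test_function_uniform_derivative[OF \<rho> e'(1)] by blast
  have pt: "test_function UNIV (partial i \<rho>)" for i by (rule test_functionD(6)[OF \<rho>])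
  have main: "norm (conv \<rho> w (x + h) - conv \<rho> w x - (\<chi> i. conv (partial i \<rho>) w x) \<bullet> h) \<le> e * norm h"
    if h: "norm h < min d 1" for h
  proof -
    have ii: "integrable lebesgue (\<lambda>y. h $ i * (partial i \<rho> (x - y) * w y))" for i
      by (intro integrable_mult_right conv_integrable pt w)
    have "(\<chi> i. conv (partial i \<rho>) w x) \<bullet> h = (LINT y|lebesgue. (\<Sum>i\<in>UNIV. h $ i * (partial i \<rho> (x - y) * w y)))"
      by (subst Bochner_Integration.integral_sum[OF ii]) (simp add: inner_vec_def conv_def mult.commute)
    also have "\<dots> = (LINT y|lebesgue. (grad \<rho> (x - y) \<bullet> h) * w y)"
      by (intro Bochner_Integration.integral_cong) (auto simp: inner_vec_def grad_def sum_distrib_left sum_distrib_right mult_ac)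
    finally have g: "(\<chi> i. conv (partial i \<rho>) w x) \<bullet> h = (LINT y|lebesgue. (grad \<rho> (x - y) \<bullet> h) * w y)" .
    have gi: "integrable lebesgue (\<lambda>y. (grad \<rho> (x - y) \<bullet> h) * w y)"
    proof -
      have "integrable lebesgue (\<lambda>y. (\<Sum>i\<in>UNIV. h $ i * (partial i \<rho> (x - y) * w y)))"
        by (intro Bochner_Integration.integrable_sum ii)
      then show ?thesis
        by (rule Bochner_Integration.integrable_cong[THEN iffD1, rotated -1])
          (auto simp: inner_vec_def grad_def sum_distrib_left sum_distrib_right mult_ac)
    qed
    have i: "integrable lebesgue (\<lambda>y. (\<rho> (x + h - y) * w y - \<rho> (x - y) * w y) - (grad \<rho> (x - y) \<bullet> h) * w y)"
      by (intro Bochner_Integration.integrable_diff conv_integrable \<rho> w gi)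
    have "conv \<rho> w (x + h) - conv \<rho> w x - (\<chi> i. conv (partial i \<rho>) w x) \<bullet> h
      = (LINT y|lebesgue. (\<rho> (x + h - y) * w y - \<rho> (x - y) * w y) - (grad \<rho> (x - y) \<bullet> h) * w y)"
      unfolding g unfolding conv_def by (simp add: conv_integrable \<rho> w gi)
    also have "norm \<dots> \<le> (LINT y|lebesgue. (e' * norm h) * (indicator ?K y * \<bar>w y\<bar>))"
    proof (rule Bochner_Integration.integral_norm_bound_integral[OF i])
      show "integrable lebesgue (\<lambda>y. (e' * norm h) * (indicator ?K y * \<bar>w y\<bar>))" using Ji by simp
      fix y
      have eq: "(\<rho> (x + h - y) * w y - \<rho> (x - y) * w y) - (grad \<rho> (x - y) \<bullet> h) * w y
        = (\<rho> ((x - y) + h) - \<rho> (x - y) - grad \<rho> (x - y) \<bullet> h) * w y" by (simp add: algebra_simps)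
      show "norm ((\<rho> (x + h - y) * w y - \<rho> (x - y) * w y) - (grad \<rho> (x - y) \<bullet> h) * w y)
        \<le> (e' * norm h) * (indicator ?K y * \<bar>w y\<bar>)"
      proof (cases "y \<in> ?K")
        case True
        have "\<bar>\<rho> ((x - y) + h) - \<rho> (x - y) - grad \<rho> (x - y) \<bullet> h\<bar> * \<bar>w y\<bar> \<le> (e' * norm h) * \<bar>w y\<bar>"
          using d(2)[of h "x - y"] h by (intro mult_right_mono) auto
        then show ?thesis unfolding eq using True by (simp add: abs_mult)
      next
        case False
        then have n: "norm (x - y) > R + 1" by (simp add: dist_norm)
        moreover have "norm ((x - y) + h) > R"
          using norm_triangle_ineq4[of "(x - y) + h" h] n h by simp
        ultimately have "\<rho> (x - y) = 0" "\<rho> ((x - y) + h) = 0" "grad \<rho> (x - y) = 0"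
          using R gR by auto
        then show ?thesis unfolding eq using False by simp
      qed
    qed
    also have "\<dots> = (e' * J) * norm h" by (simp add: J_def)
    also have "\<dots> \<le> e * norm h" using e' by (intro mult_right_mono) auto
    finally show ?thesis .
  qed
  show "\<exists>d>0. \<forall>y. norm (y - x) < d \<longrightarrow>
      norm (conv \<rho> w y - conv \<rho> w x - (\<chi> i. conv (partial i \<rho>) w x) \<bullet> (y - x)) \<le> e * norm (y - x)"
  proof (intro exI[of _ "min d 1"] conjI allI impI)
    fix y assume "norm (y - x) < min d 1"
    then show "norm (conv \<rho> w y - conv \<rho> w x - (\<chi> i. conv (partial i \<rho>) w x) \<bullet> (y - x)) \<le> e * norm (y - x)"
      using main[of "y - x"] by simp
  qed (use d in auto)
qed

lemma partial_conv:
  assumes "test_function UNIV \<rho>" "Lp_loc 1 UNIV w"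
  shows "partial i (conv \<rho> w) = conv (partial i \<rho>) w"
  by (rule ext, subst partial_eqI[OF conv_has_derivative[OF assms]]) (simp add: inner_axis)

lemma smooth_conv:
  assumes "test_function UNIV \<rho>" "Lp_loc 1 UNIV w"
  shows "smooth (conv \<rho> w)"
proof (rule smooth_coinduct)
  let ?S = "{conv \<rho> w | \<rho>. test_function UNIV \<rho>}"
  show "conv \<rho> w \<in> ?S" using assms by blast
  fix f assume "f \<in> ?S"
  then obtain \<rho> where \<rho>: "test_function UNIV \<rho>" and f: "f = conv \<rho> w" by blast
  have "partial i f \<in> ?S" for i
    unfolding f partial_conv[OF \<rho> assms(2)] using test_functionD(6)[OF \<rho>] by blast
  moreover have "f differentiable at x" for x
    unfolding f using conv_has_derivative[OF \<rho> assms(2)] differentiableI by blast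
  ultimately show "(\<forall>x. f differentiable at x) \<and> (\<forall>i. partial i f \<in> ?S)" by blast
qed

lemma partial_reflect:
  assumes "smooth \<rho>" shows "partial i (\<lambda>y. \<rho> (x - y)) y = - partial i \<rho> (x - y)"
  using partial_affine(1)[OF assms, of i 1 "-1" x y] by (simp add: algebra_simps)

text \<open>
  The function \<open>y \<mapsto> \<rho> (x - y)\<close> is a test function, so this is the definition of the weak gradient.
\<close>
lemma conv_weak_gradient:
  assumes \<rho>: "test_function UNIV \<rho>" and "weak_gradient UNIV u g"
  shows "partial i (conv \<rho> u) x = conv \<rho> (\<lambda>y. g y $ i) x"
proof -
  have u: "Lp_loc 1 UNIV u" and g: "Lp_loc 1 UNIV g" using assms by (auto simp: weak_gradient_def)
  let ?\<phi> = "\<lambda>y. \<rho> (x - y)"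
  have t: "test_function UNIV ?\<phi>" by (rule test_function_reflect[OF \<rho>])
  have i1: "integrable lebesgue (\<lambda>y. \<rho> (x - y) *\<^sub>R g y)" by (rule test_function_mult_integrable[OF t g])
  have i2: "integrable lebesgue (\<lambda>y. u y *\<^sub>R grad ?\<phi> y)"
  proof -
    have "integrable lebesgue (\<lambda>y. \<Sum>k\<in>UNIV. (partial k ?\<phi> y *\<^sub>R u y) *\<^sub>R axis k (1::real))"
      by (intro Bochner_Integration.integrable_sum integrable_scaleR_left test_function_mult_integrable[OF test_functionD(6)[OF t] u])
    then show ?thesis
      by (rule Bochner_Integration.integrable_cong[THEN iffD1, rotated -1])
        (auto simp: vec_eq_iff grad_def axis_def if_distrib[where f = "\<lambda>x. _ * x"] cong: if_cong)
  qed
  have "(LINT y|lebesgue. u y *\<^sub>R grad ?\<phi> y) = - (LINT y|lebesgue. ?\<phi> y *\<^sub>R g y)"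
    using assms t by (auto simp: weak_gradient_def set_lebesgue_integral_def)
  then have "(LINT y|lebesgue. u y *\<^sub>R grad ?\<phi> y) $ i = - (LINT y|lebesgue. ?\<phi> y *\<^sub>R g y) $ i" by simp
  moreover have "(LINT y|lebesgue. u y *\<^sub>R grad ?\<phi> y) $ i = (LINT y|lebesgue. - (partial i \<rho> (x - y) * u y))"
    using integral_bounded_linear[OF bounded_linear_vec_nth i2, of i]
    by (simp add: grad_def partial_reflect[OF test_functionD(1)[OF \<rho>]] mult.commute)
  moreover have "(LINT y|lebesgue. ?\<phi> y *\<^sub>R g y) $ i = (LINT y|lebesgue. ?\<phi> y * g y $ i)"
    using integral_bounded_linear[OF bounded_linear_vec_nth i1, of i] by simp
  ultimately have "conv (partial i \<rho>) u x = conv \<rho> (\<lambda>y. g y $ i) x" by (simp add: conv_def)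
  then show ?thesis by (simp add: partial_conv[OF \<rho> u])
qed

section \<open>Cubes, mollification and cutoff functions\<close>

lemma lebesgue_integral_affine:
  fixes f :: "real ^ 'n \<Rightarrow> real"
  assumes c: "c \<noteq> 0" and f[measurable]: "f \<in> borel_measurable borel"
  shows "(LINT x|lebesgue. f x) = \<bar>c\<bar> ^ CARD('n) * (LINT x|lebesgue. f (t + c *\<^sub>R x))"
proof -
  have "(LINT x|lborel. f x) = (LINT x|density (distr lborel borel (\<lambda>x :: real ^ 'n. t + c *\<^sub>R x)) (\<lambda>_. \<bar>c\<bar> ^ DIM(real ^ 'n)). f x)"
    using lborel_affine[OF c, of t] by simp
  also have "\<dots> = \<bar>c\<bar> ^ CARD('n) * (LINT x|lborel. f (t + c *\<^sub>R x))"
    by (subst integral_real_density) (auto simp: integral_distr)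
  finally show ?thesis by (simp add: integral_completion)
qed

lemma mem_cube: "x \<in> cube T \<longleftrightarrow> (\<forall>i. \<bar>x $ i\<bar> \<le> T / 2)"
proof -
  have "(- T / 2 \<le> a \<and> a \<le> T / 2) = (\<bar>a\<bar> \<le> T / 2)" for a :: real by arith
  then show ?thesis by (simp only: cube_def mem_box_cart vec_lambda_beta)
qed

lemma mem_interior_cube: "x \<in> interior (cube T) \<longleftrightarrow> (\<forall>i. \<bar>x $ i\<bar> < T / 2)"
proof -
  have "(- T / 2 < a \<and> a < T / 2) = (\<bar>a\<bar> < T / 2)" for a :: real by arith
  then show ?thesis by (simp only: cube_def interior_cbox mem_box_cart vec_lambda_beta)
qed

lemma compact_cube: "compact (cube T)" and cube_borel[measurable]: "cube T \<in> sets borel"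
  and cube_lebesgue[simp]: "cube T \<in> sets lebesgue"
  by (auto simp: cube_def)

lemma measure_cube: "T \<ge> 0 \<Longrightarrow> measure lebesgue (cube T :: (real ^ 'n) set) = T ^ CARD('n)"
  unfolding cube_def by (subst measure_completion) (auto simp: content_cbox_cart interval_ne_empty_cart)

lemma cube_mono: "S \<le> T \<Longrightarrow> cube S \<subseteq> cube T"
  unfolding subset_iff mem_cube by (meson divide_right_mono order_trans zero_le_numeral)

lemma cube_add: "x \<in> cube T \<Longrightarrow> norm (x - y) \<le> \<epsilon> \<Longrightarrow> y \<in> cube (T + 2 * \<epsilon>)"
proof (unfold mem_cube, rule allI)
  fix i assume *: "\<forall>i. \<bar>x $ i\<bar> \<le> T / 2" "norm (x - y) \<le> \<epsilon>"
  have "\<bar>(x - y) $ i\<bar> \<le> \<epsilon>" using component_le_norm_cart[of "x - y" i] * by linarith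
  then show "\<bar>y $ i\<bar> \<le> (T + 2 * \<epsilon>) / 2" using *(1)[rule_format, of i] by (auto simp: field_simps)
qed

lemma cube_scale: "T > 0 \<Longrightarrow> inverse T *\<^sub>R x \<in> cube r \<longleftrightarrow> x \<in> cube (r * T)"
  by (simp add: mem_cube abs_mult field_simps)

lemma interior_cube_scale: "T > 0 \<Longrightarrow> inverse T *\<^sub>R x \<in> interior (cube r) \<longleftrightarrow> x \<in> interior (cube (r * T))"
  by (simp add: mem_interior_cube abs_mult field_simps)

definition mollifier :: "real \<Rightarrow> (real ^ 'n \<Rightarrow> real) \<Rightarrow> bool" where
  "mollifier \<epsilon> \<rho> \<longleftrightarrow> test_function UNIV \<rho> \<and> (\<forall>x. \<rho> x \<ge> 0) \<and> (\<forall>x. norm x > \<epsilon> \<longrightarrow> \<rho> x = 0) \<and>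
     (LINT x|lebesgue. \<rho> x) = 1"

lemma mollifierD:
  assumes "mollifier \<epsilon> \<rho>"
  shows "test_function UNIV \<rho>" "\<rho> x \<ge> 0" "norm x > \<epsilon> \<Longrightarrow> \<rho> x = 0" "(LINT x|lebesgue. \<rho> x) = 1"
    "\<rho> \<in> borel_measurable borel" "(LINT y|lebesgue. \<rho> (x - y)) = 1" "integrable lebesgue \<rho>"
    "integrable lebesgue (\<lambda>y. \<rho> (x - y))" "integrable lebesgue (\<lambda>x. \<rho> (x - y))" "(LINT x|lebesgue. \<rho> (x - y)) = 1"
proof -
  show t: "test_function UNIV \<rho>" and "\<rho> x \<ge> 0" "norm x > \<epsilon> \<Longrightarrow> \<rho> x = 0" and 1: "(LINT x|lebesgue. \<rho> x) = 1"
    using assms by (auto simp: mollifier_def)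
  show m[measurable]: "\<rho> \<in> borel_measurable borel" by (rule smooth_measurable(1)[OF test_functionD(1)[OF t]])
  show "(LINT y|lebesgue. \<rho> (x - y)) = 1"
    using lebesgue_integral_affine[of "-1" \<rho> x] 1 by simp
  show "(LINT x|lebesgue. \<rho> (x - y)) = 1"
    using lebesgue_integral_affine[of "1" \<rho> "-y"] 1 by simp
  show "integrable lebesgue \<rho>" by (rule test_function_integrable[OF t])
  show "integrable lebesgue (\<lambda>y. \<rho> (x - y))" by (rule test_function_integrable[OF test_function_reflect[OF t]])
  have "test_function UNIV (\<lambda>x. 1 * \<rho> (1 *\<^sub>R x + (- y)))" by (rule test_function_affine[OF t]) auto
  then show "integrable lebesgue (\<lambda>x. \<rho> (x - y))" using test_function_integrable by fastforce
qed

lemma mollifier_ex: "\<epsilon> > 0 \<Longrightarrow> \<exists>\<rho>. mollifier \<epsilon> \<rho>"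
  by (rule mollifier_exists[of \<epsilon>]) (auto simp: mollifier_def)

text \<open>
  Jensen's inequality for the probability density \<open>y \<mapsto> \<rho> (x - y)\<close>, in the form that a variance is
  nonnegative.
\<close>
lemma conv_Jensen:
  assumes \<rho>: "mollifier \<epsilon> \<rho>" and w: "Lp_loc 2 UNIV w"
  shows "integrable lebesgue (\<lambda>y. \<rho> (x - y) * (w y)\<^sup>2)"
    "(conv \<rho> w x)\<^sup>2 \<le> (LINT y|lebesgue. \<rho> (x - y) * (w y)\<^sup>2)"
proof -
  have w2: "Lp_loc 1 UNIV (\<lambda>y. (w y)\<^sup>2)" using w by (auto simp: Lp_loc_2_iff Lp_loc_1_iff)
  note t = mollifierD(1)[OF \<rho>]
  show i2: "integrable lebesgue (\<lambda>y. \<rho> (x - y) * (w y)\<^sup>2)" by (rule conv_integrable[OF t w2])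
  have i1: "integrable lebesgue (\<lambda>y. \<rho> (x - y) * w y)" by (rule conv_integrable[OF t Lp_loc_2_imp_1[OF w]])
  let ?m = "conv \<rho> w x"
  have "0 \<le> (LINT y|lebesgue. \<rho> (x - y) * (w y - ?m)\<^sup>2)"
    using mollifierD(2)[OF \<rho>] by (intro integral_nonneg_AE AE_I2 mult_nonneg_nonneg) auto
  also have "\<dots> = (LINT y|lebesgue. \<rho> (x - y) * (w y)\<^sup>2 - (2 * ?m) * (\<rho> (x - y) * w y) + ?m\<^sup>2 * \<rho> (x - y))"
    by (intro Bochner_Integration.integral_cong) (auto simp: power2_eq_square algebra_simps)
  also have "\<dots> = (LINT y|lebesgue. \<rho> (x - y) * (w y)\<^sup>2) - 2 * ?m * (LINT y|lebesgue. \<rho> (x - y) * w y) + ?m\<^sup>2"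
    using i1 i2 mollifierD(8,6)[OF \<rho>] by simp
  also have "\<dots> = (LINT y|lebesgue. \<rho> (x - y) * (w y)\<^sup>2) - ?m\<^sup>2"
    by (simp add: conv_def power2_eq_square)
  finally show "?m\<^sup>2 \<le> (LINT y|lebesgue. \<rho> (x - y) * (w y)\<^sup>2)" by simp
qed

text \<open>
  Integrate Jensen's inequality and exchange the integrals. Tonelli's theorem is applied to Borel
  measurable functions, hence the Borel representative of \<open>w\<close>.
\<close>
lemma conv_L2_nn:
  fixes w :: "real ^ 'n \<Rightarrow> real"
  assumes \<rho>: "mollifier \<epsilon> \<rho>" and w: "Lp_loc 2 UNIV w"
    and [measurable]: "S \<in> sets borel" "S' \<in> sets borel"
    and SS': "\<And>x y. x \<in> S \<Longrightarrow> norm (x - y) \<le> \<epsilon> \<Longrightarrow> y \<in> S'"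
  shows "(\<integral>\<^sup>+x. ennreal (indicator S x * (conv \<rho> w x)\<^sup>2) \<partial>lebesgue) \<le> (\<integral>\<^sup>+y. ennreal (indicator S' y * (w y)\<^sup>2) \<partial>lebesgue)"
proof -
  have "w \<in> borel_measurable lebesgue" using w Lp_loc_measurable by blast
  then obtain v where v[measurable]: "v \<in> borel_measurable borel" and vw: "AE x in lborel. w x = v x"
    using completion_ex_borel_measurable_real[of w lborel] by auto
  note [measurable] = mollifierD(5)[OF \<rho>]
  have 1: "ennreal (indicator S x * (conv \<rho> w x)\<^sup>2) \<le> (\<integral>\<^sup>+y. ennreal (indicator S x * (\<rho> (x - y) * (v y)\<^sup>2)) \<partial>lborel)" for x
  proof -
    have "ennreal (indicator S x * (conv \<rho> w x)\<^sup>2) \<le> ennreal (indicator S x * (LINT y|lebesgue. \<rho> (x - y) * (w y)\<^sup>2))"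
      by (intro ennreal_leI mult_left_mono conv_Jensen(2)[OF \<rho> w]) auto
    also have "\<dots> = ennreal (LINT y|lebesgue. indicator S x * (\<rho> (x - y) * (w y)\<^sup>2))" by simp
    also have "\<dots> = (\<integral>\<^sup>+y. ennreal (indicator S x * (\<rho> (x - y) * (w y)\<^sup>2)) \<partial>lebesgue)"
      using mollifierD(2)[OF \<rho>] by (intro nn_integral_eq_integral[symmetric] integrable_mult_right conv_Jensen(1)[OF \<rho> w]) auto
    also have "\<dots> = (\<integral>\<^sup>+y. ennreal (indicator S x * (\<rho> (x - y) * (v y)\<^sup>2)) \<partial>lborel)"
      unfolding nn_integral_completion using vw by (intro nn_integral_cong_AE) auto
    finally show ?thesis .
  qed
  have "(\<integral>\<^sup>+x. ennreal (indicator S x * (conv \<rho> w x)\<^sup>2) \<partial>lebesgue) \<le> (\<integral>\<^sup>+x. (\<integral>\<^sup>+y. ennreal (indicator S x * (\<rho> (x - y) * (v y)\<^sup>2)) \<partial>lborel) \<partial>lborel)"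
    unfolding nn_integral_completion by (intro nn_integral_mono 1)
  also have "\<dots> = (\<integral>\<^sup>+y. (\<integral>\<^sup>+x. ennreal (indicator S x * (\<rho> (x - y) * (v y)\<^sup>2)) \<partial>lborel) \<partial>lborel)"
    by (rule lborel_pair.Fubini'[symmetric]) measurable
  also have "\<dots> \<le> (\<integral>\<^sup>+y. ennreal (indicator S' y * (v y)\<^sup>2) \<partial>lborel)"
  proof (rule nn_integral_mono)
    fix y
    have "(\<integral>\<^sup>+x. ennreal (indicator S x * (\<rho> (x - y) * (v y)\<^sup>2)) \<partial>lborel) \<le> (\<integral>\<^sup>+x. ennreal (indicator S' y * (v y)\<^sup>2) * ennreal (\<rho> (x - y)) \<partial>lborel)"
    proof (rule nn_integral_mono)
      fix x
      have "indicator S x * (\<rho> (x - y) * (v y)\<^sup>2) \<le> (indicator S' y * (v y)\<^sup>2) * \<rho> (x - y)"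
      proof (cases "x \<in> S \<and> norm (x - y) \<le> \<epsilon>")
        case True
        then have "y \<in> S'" by (intro SS'[of x]) auto
        then show ?thesis using True by simp
      next
        case False
        then have "indicator S x * \<rho> (x - y) = 0" using mollifierD(3)[OF \<rho>, of "x - y"] by auto
        then have "indicator S x * (\<rho> (x - y) * (v y)\<^sup>2) = 0" by (metis mult.assoc mult_zero_left)
        moreover have "0 \<le> indicator S' y * (v y)\<^sup>2 * \<rho> (x - y)"
          using mollifierD(2)[OF \<rho>, of "x - y"] by (intro mult_nonneg_nonneg) auto
        ultimately show ?thesis by (simp only:)
      qed
      then show "ennreal (indicator S x * (\<rho> (x - y) * (v y)\<^sup>2)) \<le> ennreal (indicator S' y * (v y)\<^sup>2) * ennreal (\<rho> (x - y))"
        using mollifierD(2)[OF \<rho>, of "x - y"] by (subst ennreal_mult[symmetric]) (auto intro: ennreal_leI)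
    qed
    also have "\<dots> = ennreal (indicator S' y * (v y)\<^sup>2) * (\<integral>\<^sup>+x. ennreal (\<rho> (x - y)) \<partial>lborel)"
      by (rule nn_integral_cmult) measurable
    also have "(\<integral>\<^sup>+x. ennreal (\<rho> (x - y)) \<partial>lborel) = (\<integral>\<^sup>+x. ennreal (\<rho> (x - y)) \<partial>lebesgue)" by (simp add: nn_integral_completion)
    also have "\<dots> = ennreal (LINT x|lebesgue. \<rho> (x - y))"
      using mollifierD(2,9)[OF \<rho>] by (intro nn_integral_eq_integral) auto
    finally show "(\<integral>\<^sup>+x. ennreal (indicator S x * (\<rho> (x - y) * (v y)\<^sup>2)) \<partial>lborel) \<le> ennreal (indicator S' y * (v y)\<^sup>2)"
      by (simp add: mollifierD(10)[OF \<rho>])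
  qed
  also have "\<dots> = (\<integral>\<^sup>+y. ennreal (indicator S' y * (w y)\<^sup>2) \<partial>lebesgue)"
    unfolding nn_integral_completion using vw by (intro nn_integral_cong_AE) auto
  finally show ?thesis .
qed

lemma integrable_indicator_Lp_loc_2:
  assumes "Lp_loc 2 UNIV w" "compact S"
  shows "integrable lebesgue (\<lambda>x. indicator S x * (w x :: real)\<^sup>2)"
  using assms by (auto simp: Lp_loc_2_iff set_integrable_def)

lemma smooth_Lp_loc_2:
  fixes f :: "real ^ 'n \<Rightarrow> real"
  assumes "smooth f" shows "Lp_loc 2 UNIV f"
  unfolding Lp_loc_2_iff set_integrable_def
proof (intro conjI allI impI)
  show "f \<in> borel_measurable lebesgue" by (rule smooth_measurable(2)[OF assms])
  fix K :: "(real ^ 'n) set" assume K: "compact K"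
  have [measurable]: "f \<in> borel_measurable borel" "K \<in> sets borel"
    by (rule smooth_measurable(1)[OF assms], rule borel_compact[OF K])
  have "integrable lborel (\<lambda>x. indicator K x *\<^sub>R (norm (f x))\<^sup>2)"
    by (intro borel_integrable_compact K continuous_intros smooth_continuous[OF assms])
  then show "integrable lebesgue (\<lambda>x. indicator K x *\<^sub>R (norm (f x))\<^sup>2)"
    by (subst integrable_completion) measurable
qed

lemma conv_L2:
  fixes w :: "real ^ 'n \<Rightarrow> real"
  assumes \<rho>: "mollifier \<epsilon> \<rho>" and w: "Lp_loc 2 UNIV w"
    and S: "compact S" "compact S'"
    and SS': "\<And>x y. x \<in> S \<Longrightarrow> norm (x - y) \<le> \<epsilon> \<Longrightarrow> y \<in> S'"
  shows "(LINT x|lebesgue. indicator S x * (conv \<rho> w x)\<^sup>2) \<le> (LINT y|lebesgue. indicator S' y * (w y)\<^sup>2)"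
proof -
  have c: "Lp_loc 2 UNIV (conv \<rho> w)"
    by (intro smooth_Lp_loc_2 smooth_conv mollifierD(1)[OF \<rho>] Lp_loc_2_imp_1 w)
  have "ennreal (LINT x|lebesgue. indicator S x * (conv \<rho> w x)\<^sup>2) \<le> ennreal (LINT y|lebesgue. indicator S' y * (w y)\<^sup>2)"
    using conv_L2_nn[OF \<rho> w borel_compact[OF S(1)] borel_compact[OF S(2)] SS']
    by (subst (asm) (1 2) nn_integral_eq_integral) (auto intro!: integrable_indicator_Lp_loc_2 c w S)
  then show ?thesis by (subst (asm) ennreal_le_iff) (auto intro!: integral_nonneg_AE)
qed

lemma conv_close:
  assumes \<rho>: "mollifier \<epsilon> \<rho>" and u: "\<And>y. norm (x - y) \<le> \<epsilon> \<Longrightarrow> \<bar>u y - u x\<bar> \<le> \<omega>" and w: "Lp_loc 1 UNIV u"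
  shows "\<bar>conv \<rho> u x - u x\<bar> \<le> \<omega>"
proof -
  have "conv \<rho> u x - u x = (LINT y|lebesgue. \<rho> (x - y) * u y) - (LINT y|lebesgue. \<rho> (x - y) * u x)"
    using mollifierD(6)[OF \<rho>] by (simp add: conv_def)
  also have "\<dots> = (LINT y|lebesgue. \<rho> (x - y) * u y - \<rho> (x - y) * u x)"
    by (intro Bochner_Integration.integral_diff[symmetric] conv_integrable w mollifierD(1)[OF \<rho>] Lp_loc_1_const)
  finally have "\<bar>conv \<rho> u x - u x\<bar> = norm (LINT y|lebesgue. \<rho> (x - y) * u y - \<rho> (x - y) * u x)" by simp
  also have "\<dots> \<le> (LINT y|lebesgue. \<omega> * \<rho> (x - y))"
  proof (rule Bochner_Integration.integral_norm_bound_integral)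
    show "integrable lebesgue (\<lambda>y. \<rho> (x - y) * u y - \<rho> (x - y) * u x)"
      by (intro Bochner_Integration.integrable_diff conv_integrable w mollifierD(1)[OF \<rho>] Lp_loc_1_const)
    show "integrable lebesgue (\<lambda>y. \<omega> * \<rho> (x - y))" using mollifierD(8)[OF \<rho>] by simp
    fix y
    show "norm (\<rho> (x - y) * u y - \<rho> (x - y) * u x) \<le> \<omega> * \<rho> (x - y)"
    proof (cases "norm (x - y) \<le> \<epsilon>")
      case True
      have "norm (\<rho> (x - y) * u y - \<rho> (x - y) * u x) = \<rho> (x - y) * \<bar>u y - u x\<bar>"
        using mollifierD(2)[OF \<rho>, of "x - y"] by (simp add: right_diff_distrib[symmetric] abs_mult)
      also have "\<dots> \<le> \<rho> (x - y) * \<omega>" using u[OF True] mollifierD(2)[OF \<rho>] by (intro mult_left_mono) auto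
      finally show ?thesis by (simp add: mult.commute)
    qed (use mollifierD(3)[OF \<rho>, of "x - y"] in auto)
  qed
  also have "\<dots> = \<omega>" using mollifierD(6)[OF \<rho>] by simp
  finally show ?thesis .
qed

text \<open>
  The cutoff is the mollified indicator of a cube halfway between the two given ones; the width
  \<open>(1 - r) / 8\<close> of the mollifier leaves room on both sides.
\<close>
lemma cutoff_unit:
  assumes r: "0 < r" "r < 1"
  obtains \<theta> :: "real ^ 'n \<Rightarrow> real" where "test_function (interior (cube 1)) \<theta>" "\<And>x. 0 \<le> \<theta> x \<and> \<theta> x \<le> 1"
    "\<And>x. x \<in> cube r \<Longrightarrow> \<theta> x = 1"
proof -
  define \<epsilon> where "\<epsilon> = (1 - r) / 8"
  have \<epsilon>: "\<epsilon> > 0" using r by (simp add: \<epsilon>_def)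
  obtain \<rho> :: "real ^ 'n \<Rightarrow> real" where \<rho>: "mollifier \<epsilon> \<rho>" using mollifier_ex[OF \<epsilon>] by blast
  define S :: "(real ^ 'n) set" where "S = cube ((1 + r) / 2)"
  have S: "compact S" "S \<in> sets lebesgue" by (auto simp: S_def compact_cube)
  define w where "w = indicat_real S"
  have w: "Lp_loc 1 UNIV w"
  proof -
    have "w \<in> borel_measurable lebesgue" using S by (simp add: w_def)
    moreover have "set_integrable lebesgue K w" if "compact K" for K
    proof -
      have "(\<lambda>x. indicator K x *\<^sub>R w x) = indicat_real (K \<inter> S)" by (auto simp: w_def indicator_def)
      then show ?thesis using integrable_indicator_compact[of "K \<inter> S"] that S by (simp add: set_integrable_def compact_Int)
    qed
    ultimately show ?thesis by (simp add: Lp_loc_1_iff)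
  qed
  show ?thesis
  proof (rule that)
    show "test_function (interior (cube 1)) (conv \<rho> w)"
    proof (rule test_functionI)
      show "smooth (conv \<rho> w)" by (rule smooth_conv[OF mollifierD(1)[OF \<rho>] w])
      show "compact (cube ((1 + r) / 2 + 2 * \<epsilon>) :: (real ^ 'n) set)" by (rule compact_cube)
      show "(cube ((1 + r) / 2 + 2 * \<epsilon>) :: (real ^ 'n) set) \<subseteq> interior (cube 1)"
        unfolding subset_iff mem_cube mem_interior_cube
      proof (intro allI impI)
        fix t :: "real ^ 'n" and i assume "\<forall>i. \<bar>t $ i\<bar> \<le> ((1 + r) / 2 + 2 * \<epsilon>) / 2"
        then have "\<bar>t $ i\<bar> \<le> ((1 + r) / 2 + 2 * \<epsilon>) / 2" by blast
        then show "\<bar>t $ i\<bar> < 1 / 2" using r by (simp add: \<epsilon>_def field_simps)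
      qed
      fix x :: "real ^ 'n" assume x: "x \<notin> cube ((1 + r) / 2 + 2 * \<epsilon>)"
      have "\<rho> (x - y) * w y = 0" for y
        using x cube_add[of y "(1+r)/2" x \<epsilon>] mollifierD(3)[OF \<rho>, of "x - y"]
        by (cases "norm (x - y) \<le> \<epsilon>") (auto simp: w_def S_def norm_minus_commute indicator_def)
      then have "(\<lambda>y. \<rho> (x - y) * w y) = (\<lambda>y. 0)" by blast
      then show "conv \<rho> w x = 0" unfolding conv_def by simp
    qed
    show "0 \<le> conv \<rho> w x \<and> conv \<rho> w x \<le> 1" for x
    proof
      show "0 \<le> conv \<rho> w x" unfolding conv_def
        using mollifierD(2)[OF \<rho>] by (intro integral_nonneg_AE AE_I2) (auto simp: w_def)
      have "conv \<rho> w x \<le> (LINT y|lebesgue. \<rho> (x - y))" unfolding conv_def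
        using mollifierD(2)[OF \<rho>] by (intro integral_mono mollifierD(8)[OF \<rho>] conv_integrable mollifierD(1)[OF \<rho>] w)
          (auto simp: w_def indicator_def)
      then show "conv \<rho> w x \<le> 1" using mollifierD(6)[OF \<rho>] by simp
    qed
    fix x :: "real ^ 'n" assume x: "x \<in> cube r"
    have s: "cube (r + 2 * \<epsilon>) \<subseteq> S" unfolding S_def by (rule cube_mono) (use r in \<open>simp add: \<epsilon>_def field_simps\<close>)
    have "\<bar>conv \<rho> w x - w x\<bar> \<le> 0"
    proof (rule conv_close[OF \<rho> _ w])
      fix y assume "norm (x - y) \<le> \<epsilon>"
      then have "y \<in> S" "x \<in> S" using s cube_add[OF x, of y \<epsilon>] cube_add[OF x, of x \<epsilon>] \<epsilon> by auto
      then show "\<bar>w y - w x\<bar> \<le> 0" by (simp add: w_def)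
    qed
    moreover have "x \<in> S" using s cube_add[OF x, of x \<epsilon>] \<epsilon> by auto
    ultimately show "conv \<rho> w x = 1" by (simp add: w_def)
  qed
qed

text \<open>
  Rescaling one cutoff for the unit cube keeps the proportion \<open>r\<close> and divides the gradient by \<open>T\<close>.
\<close>
lemma cutoffs:
  assumes r: "0 < r" "r < 1"
  obtains \<theta> :: "real \<Rightarrow> real ^ 'n \<Rightarrow> real" and L where "L > 0"
    "\<And>T. T > 0 \<Longrightarrow> test_function (interior (cube T)) (\<theta> T)" "\<And>T x. 0 \<le> \<theta> T x \<and> \<theta> T x \<le> 1"
    "\<And>T x. T > 0 \<Longrightarrow> x \<in> cube (r * T) \<Longrightarrow> \<theta> T x = 1" "\<And>T x. T > 0 \<Longrightarrow> norm (grad (\<theta> T) x) \<le> L / T"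
proof -
  obtain \<theta> :: "real ^ 'n \<Rightarrow> real" where t: "test_function (interior (cube 1)) \<theta>" and b: "\<And>x. 0 \<le> \<theta> x \<and> \<theta> x \<le> 1"
    and 1: "\<And>x. x \<in> cube r \<Longrightarrow> \<theta> x = 1" using cutoff_unit[OF r] by blast
  have "\<exists>B>0. \<forall>x. \<bar>partial i \<theta> x\<bar> \<le> B" for i
    using test_function_bounded[OF test_functionD(6)[OF t, of i]] by metis
  then obtain B where B: "\<And>i. B i > 0" "\<And>i x. \<bar>partial i \<theta> x\<bar> \<le> B i" by metis
  have Bs: "(\<Sum>i\<in>UNIV. B i) > 0" by (rule sum_pos) (auto simp: B)
  show ?thesis
  proof (rule that[of "\<Sum>i\<in>UNIV. B i" "\<lambda>T x. 1 * \<theta> (inverse T *\<^sub>R x + 0)"])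
    show "(\<Sum>i\<in>UNIV. B i) > 0" by fact
    show "test_function (interior (cube T)) (\<lambda>x. 1 * \<theta> (inverse T *\<^sub>R x + 0))" if "T > 0" for T
      by (rule test_function_affine[OF t]) (use that interior_cube_scale[OF that, of _ 1] in auto)
    show "0 \<le> 1 * \<theta> (inverse T *\<^sub>R x + 0) \<and> 1 * \<theta> (inverse T *\<^sub>R x + 0) \<le> 1" for T x using b by simp
    show "1 * \<theta> (inverse T *\<^sub>R x + 0) = 1" if "T > 0" "x \<in> cube (r * T)" for T x
      using 1 cube_scale[OF that(1), of x r] that(2) by simp
    show "norm (grad (\<lambda>x. 1 * \<theta> (inverse T *\<^sub>R x + 0)) x) \<le> (\<Sum>i\<in>UNIV. B i) / T" if "T > 0" for T x
    proof -
      have "norm (grad (\<lambda>x. 1 * \<theta> (inverse T *\<^sub>R x + 0)) x) \<le> (\<Sum>i\<in>UNIV. \<bar>grad (\<lambda>x. 1 * \<theta> (inverse T *\<^sub>R x + 0)) x $ i\<bar>)"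
        by (rule norm_le_l1_cart)
      also have "\<dots> \<le> (\<Sum>i\<in>UNIV. B i / T)"
      proof (rule sum_mono)
        fix i
        show "\<bar>grad (\<lambda>x. 1 * \<theta> (inverse T *\<^sub>R x + 0)) x $ i\<bar> \<le> B i / T"
          using B(2)[of i "inverse T *\<^sub>R x + 0"] that
          unfolding grad_def vec_lambda_beta partial_affine(1)[OF test_functionD(1)[OF t]]
          by (simp add: abs_mult field_simps)
      qed
      finally show ?thesis by (simp add: sum_divide_distrib)
    qed
  qed
qed

section \<open>Square integrable functions\<close>

definition L2 :: "'a measure \<Rightarrow> ('a \<Rightarrow> 'b::euclidean_space) \<Rightarrow> bool" where
  "L2 M f \<longleftrightarrow> f \<in> borel_measurable M \<and> integrable M (\<lambda>x. (norm (f x))\<^sup>2)"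

lemma L2_measurable[measurable_dest]: "L2 M f \<Longrightarrow> f \<in> borel_measurable M" by (simp add: L2_def)
lemma L2_integrable: "L2 M f \<Longrightarrow> integrable M (\<lambda>x. (norm (f x))\<^sup>2)" by (simp add: L2_def)
lemma L2_integrable_real: "L2 M f \<Longrightarrow> integrable M (\<lambda>x. (f x :: real)\<^sup>2)" by (simp add: L2_def)

lemma L2_bounded:
  assumes "L2 M f" "g \<in> borel_measurable M" "AE x in M. norm (g x) \<le> c * norm (f x)"
  shows "L2 M g"
  unfolding L2_def
proof (intro conjI assms(2))
  have "integrable M (\<lambda>x. c\<^sup>2 * (norm (f x))\<^sup>2)" using assms(1) by (simp add: L2_def)
  then show "integrable M (\<lambda>x. (norm (g x))\<^sup>2)"
  proof (rule Bochner_Integration.integrable_bound)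
    show "(\<lambda>x. (norm (g x))\<^sup>2) \<in> borel_measurable M" using assms(2) by measurable
    show "AE x in M. norm ((norm (g x))\<^sup>2) \<le> norm (c\<^sup>2 * (norm (f x))\<^sup>2)"
      using assms(3)
    proof eventually_elim
      case (elim x)
      then have "(norm (g x))\<^sup>2 \<le> (c * norm (f x))\<^sup>2" by (intro power_mono) auto
      then show ?case by (simp add: power_mult_distrib)
    qed
  qed
qed

lemma norm_sum_sq: "(norm (a + b))\<^sup>2 \<le> 2 * (norm a)\<^sup>2 + 2 * (norm (b :: 'a :: real_inner))\<^sup>2"
proof -
  have "0 \<le> (norm (a - b))\<^sup>2" by simp
  then show ?thesis by (simp add: power2_norm_eq_inner inner_add_left inner_add_right inner_diff_left inner_diff_right inner_commute)
qed

lemma L2_add: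
  assumes "L2 M f" "L2 M g" shows "L2 M (\<lambda>x. f x + g x)"
  unfolding L2_def
proof
  note [measurable] = L2_measurable[OF assms(1)] L2_measurable[OF assms(2)]
  show "(\<lambda>x. f x + g x) \<in> borel_measurable M" by measurable
  have "integrable M (\<lambda>x. 2 * (norm (f x))\<^sup>2 + 2 * (norm (g x))\<^sup>2)"
    using assms by (simp add: L2_def)
  then show "integrable M (\<lambda>x. (norm (f x + g x))\<^sup>2)"
    by (rule Bochner_Integration.integrable_bound) (use norm_sum_sq in \<open>auto intro!: AE_I2\<close>)
qed

lemma L2_scaleR: "L2 M f \<Longrightarrow> L2 M (\<lambda>x. c *\<^sub>R f x)"
  by (rule L2_bounded[of M f _ "\<bar>c\<bar>"]) (auto intro: L2_measurable)

lemma L2_diff: "L2 M f \<Longrightarrow> L2 M g \<Longrightarrow> L2 M (\<lambda>x. f x - g x)"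
  using L2_add[OF _ L2_scaleR[of M g "-1"]] by simp

text \<open>
  Young's inequality, used throughout in place of the Cauchy-Schwarz inequality for integrals: the free
  parameter turns one small and one bounded mean square into a small product.
\<close>
lemma L2_Young:
  assumes f: "L2 M f" and g: "L2 M g"
  shows "integrable M (\<lambda>x. f x \<bullet> g x)"
    "\<eta> > 0 \<Longrightarrow> \<bar>LINT x|M. f x \<bullet> g x\<bar> \<le> \<eta> / 2 * (LINT x|M. (norm (f x))\<^sup>2) + (LINT x|M. (norm (g x))\<^sup>2) / (2 * \<eta>)"
proof -
  note [measurable] = L2_measurable[OF assms(1)] L2_measurable[OF assms(2)]
  have pt: "\<bar>a \<bullet> b\<bar> \<le> \<eta> / 2 * (norm a)\<^sup>2 + (norm b)\<^sup>2 / (2 * \<eta>)" if "\<eta> > 0" for a b :: 'b and \<eta> :: real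
  proof -
    have "\<bar>a \<bullet> b\<bar> \<le> norm a * norm b" by (rule Cauchy_Schwarz_ineq2)
    moreover have "0 \<le> (\<eta> * norm a - norm b)\<^sup>2 / (2 * \<eta>)" using that by simp
    moreover have "(\<eta> * norm a - norm b)\<^sup>2 / (2 * \<eta>) = \<eta> / 2 * (norm a)\<^sup>2 + (norm b)\<^sup>2 / (2 * \<eta>) - norm a * norm b"
      using that by (simp add: power2_eq_square field_simps)
    ultimately show ?thesis by linarith
  qed
  have int: "integrable M (\<lambda>x. \<eta> / 2 * (norm (f x))\<^sup>2 + (norm (g x))\<^sup>2 / (2 * \<eta>))" for \<eta> :: real
    using assms by (intro Bochner_Integration.integrable_add integrable_mult_right integrable_divide) (auto simp: L2_def)
  show i: "integrable M (\<lambda>x. f x \<bullet> g x)"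
    by (rule Bochner_Integration.integrable_bound[OF int[of 1]]) (use pt[of 1] in \<open>auto intro!: AE_I2 intro: order_trans[OF _ abs_ge_self]\<close>)
  assume \<eta>: "\<eta> > 0"
  have "norm (LINT x|M. f x \<bullet> g x) \<le> (LINT x|M. \<eta> / 2 * (norm (f x))\<^sup>2 + (norm (g x))\<^sup>2 / (2 * \<eta>))"
    by (rule order_trans[OF integral_norm_bound integral_mono]) (use i int pt[OF \<eta>] in auto)
  also have "\<dots> = \<eta> / 2 * (LINT x|M. (norm (f x))\<^sup>2) + (LINT x|M. (norm (g x))\<^sup>2) / (2 * \<eta>)"
    using assms by (subst Bochner_Integration.integral_add) (auto simp: L2_def)
  finally show "\<bar>LINT x|M. f x \<bullet> g x\<bar> \<le> \<eta> / 2 * (LINT x|M. (norm (f x))\<^sup>2) + (LINT x|M. (norm (g x))\<^sup>2) / (2 * \<eta>)" by simp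
qed

lemma L2_integral_add_le:
  assumes "L2 M f" "L2 M g"
  shows "(LINT x|M. (norm (f x + g x))\<^sup>2) \<le> 2 * (LINT x|M. (norm (f x))\<^sup>2) + 2 * (LINT x|M. (norm (g x))\<^sup>2)"
proof -
  have "(LINT x|M. (norm (f x + g x))\<^sup>2) \<le> (LINT x|M. 2 * (norm (f x))\<^sup>2 + 2 * (norm (g x))\<^sup>2)"
    using assms L2_add[OF assms] by (intro integral_mono norm_sum_sq) (auto simp: L2_def)
  then show ?thesis using assms by (simp add: L2_def)
qed

lemma norm_vec_sq: "(norm (v :: real ^ 'n))\<^sup>2 = (\<Sum>i\<in>UNIV. (v $ i)\<^sup>2)"
  unfolding power2_norm_eq_inner by (simp add: inner_vec_def power2_eq_square)

lemma L2_vec: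
  fixes f :: "'a \<Rightarrow> real ^ 'n"
  assumes "\<And>i. L2 M (\<lambda>x. f x $ i)" shows "L2 M f"
  unfolding L2_def
proof
  show "f \<in> borel_measurable M"
    by (subst borel_measurable_euclidean_space) (use assms in \<open>auto simp: L2_def Basis_vec_def inner_axis\<close>)
  have "integrable M (\<lambda>x. \<Sum>i\<in>UNIV. (f x $ i)\<^sup>2)" using assms by (simp add: L2_def)
  then show "integrable M (\<lambda>x. (norm (f x))\<^sup>2)" unfolding norm_vec_sq .
qed

lemma L2_vec_integral:
  fixes f :: "'a \<Rightarrow> real ^ 'n"
  assumes "\<And>i. L2 M (\<lambda>x. f x $ i)"
  shows "(LINT x|M. (norm (f x))\<^sup>2) = (\<Sum>i\<in>UNIV. (LINT x|M. (f x $ i)\<^sup>2))"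
proof -
  have "(LINT x|M. (norm (f x))\<^sup>2) = (LINT x|M. (\<Sum>i\<in>UNIV. (f x $ i)\<^sup>2))"
    unfolding norm_vec_sq ..
  also have "\<dots> = (\<Sum>i\<in>UNIV. (LINT x|M. (f x $ i)\<^sup>2))"
    using assms by (subst Bochner_Integration.integral_sum) (auto simp: L2_def)
  finally show ?thesis .
qed

lemma L2_component:
  fixes f :: "'a \<Rightarrow> real ^ 'n"
  assumes f: "L2 M f" shows "L2 M (\<lambda>x. f x $ i)"
proof (rule L2_bounded[OF f, of _ 1])
  show "(\<lambda>x. f x $ i) \<in> borel_measurable M"
    using borel_measurable_euclidean_space[THEN iffD1, OF L2_measurable[OF f]]
    by (auto simp: Basis_vec_def inner_axis)
qed (use component_le_norm_cart in auto)

lemma restrict_integrable_iff: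
  fixes f :: "real ^ 'n \<Rightarrow> 'b::euclidean_space"
  assumes "S \<in> sets lebesgue"
  shows "integrable (lebesgue_on S) f \<longleftrightarrow> set_integrable lebesgue S f"
    "(LINT x|lebesgue_on S. f x) = (LINT x:S|lebesgue. f x)"
  using assms by (simp_all add: integrable_restrict_space integral_restrict_space set_integrable_def set_lebesgue_integral_def)

lemma Lp_loc_2_L2:
  fixes u :: "real ^ 'n \<Rightarrow> 'b::euclidean_space"
  assumes u: "Lp_loc 2 UNIV u" and S: "S \<in> sets lebesgue" "bounded S"
  shows "L2 (lebesgue_on S) u"
  unfolding L2_def
proof
  show "u \<in> borel_measurable (lebesgue_on S)"
    by (rule measurable_restrict_space1[OF Lp_loc_measurable[OF u]])
  have "set_integrable lebesgue (closure S) (\<lambda>x. (norm (u x))\<^sup>2)"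
    using u S by (auto simp: Lp_loc_2_iff compact_closure)
  then have "set_integrable lebesgue S (\<lambda>x. (norm (u x))\<^sup>2)"
    by (rule set_integrable_subset) (use S closure_subset in auto)
  then show "integrable (lebesgue_on S) (\<lambda>x. (norm (u x))\<^sup>2)" using S by (simp add: restrict_integrable_iff)
qed

lemma integral_sq_subset:
  fixes u :: "real ^ 'n \<Rightarrow> 'b::euclidean_space"
  assumes u: "Lp_loc 2 UNIV u" and S: "S \<in> sets lebesgue" "S' \<in> sets lebesgue" "bounded S'" "S \<subseteq> S'"
  shows "(LINT x|lebesgue_on S. (norm (u x))\<^sup>2) \<le> (LINT x|lebesgue_on S'. (norm (u x))\<^sup>2)"
proof -
  have "bounded S" using S bounded_subset by blast
  then have i: "set_integrable lebesgue S (\<lambda>x. (norm (u x))\<^sup>2)" "set_integrable lebesgue S' (\<lambda>x. (norm (u x))\<^sup>2)"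
    using Lp_loc_2_L2[OF u] S by (auto simp: L2_def restrict_integrable_iff)
  have "(LINT x:S|lebesgue. (norm (u x))\<^sup>2) \<le> (LINT x:S'|lebesgue. (norm (u x))\<^sup>2)"
    unfolding set_lebesgue_integral_def
    using i S(4) by (intro integral_mono) (auto simp: set_integrable_def indicator_def)
  then show ?thesis using S by (simp add: restrict_integrable_iff)
qed

lemma Lp_loc_2I:
  fixes u :: "real ^ 'n \<Rightarrow> 'b::euclidean_space"
  assumes "u \<in> borel_measurable lebesgue" "\<And>K. compact K \<Longrightarrow> L2 (lebesgue_on K) u"
  shows "Lp_loc 2 UNIV u"
  unfolding Lp_loc_2_iff
  using assms by (auto simp: L2_def restrict_integrable_iff[OF fmeasurableD[OF lmeasurable_compact]])

lemma Lp_loc_2_compact_L2: "Lp_loc 2 UNIV u \<Longrightarrow> compact K \<Longrightarrow> L2 (lebesgue_on K) u"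
  by (rule Lp_loc_2_L2) (auto simp: compact_imp_bounded fmeasurableD lmeasurable_compact)

lemma Lp_loc_2_add:
  fixes u :: "real ^ 'n \<Rightarrow> 'b::euclidean_space"
  shows "Lp_loc 2 UNIV u \<Longrightarrow> Lp_loc 2 UNIV v \<Longrightarrow> Lp_loc 2 UNIV (\<lambda>x. u x + v x)"
proof (rule Lp_loc_2I)
  assume u: "Lp_loc 2 UNIV u" and v: "Lp_loc 2 UNIV v"
  show "(\<lambda>x. u x + v x) \<in> borel_measurable lebesgue"
    by (rule borel_measurable_add[OF Lp_loc_measurable[OF u] Lp_loc_measurable[OF v]])
  show "L2 (lebesgue_on K) (\<lambda>x. u x + v x)" if "compact K" for K
    by (rule L2_add[OF Lp_loc_2_compact_L2[OF u that] Lp_loc_2_compact_L2[OF v that]])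
qed

lemma Lp_loc_2_diff:
  fixes u :: "real ^ 'n \<Rightarrow> 'b::euclidean_space"
  shows "Lp_loc 2 UNIV u \<Longrightarrow> Lp_loc 2 UNIV v \<Longrightarrow> Lp_loc 2 UNIV (\<lambda>x. u x - v x)"
proof (rule Lp_loc_2I)
  assume u: "Lp_loc 2 UNIV u" and v: "Lp_loc 2 UNIV v"
  show "(\<lambda>x. u x - v x) \<in> borel_measurable lebesgue"
    by (rule borel_measurable_diff[OF Lp_loc_measurable[OF u] Lp_loc_measurable[OF v]])
  show "L2 (lebesgue_on K) (\<lambda>x. u x - v x)" if "compact K" for K
    by (rule L2_diff[OF Lp_loc_2_compact_L2[OF u that] Lp_loc_2_compact_L2[OF v that]])
qed

lemma Lp_loc_2_bounded:
  fixes u :: "real ^ 'n \<Rightarrow> 'b::euclidean_space" and g :: "real ^ 'n \<Rightarrow> 'c::euclidean_space"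
  assumes "Lp_loc 2 UNIV u" "g \<in> borel_measurable lebesgue" "AE x in lebesgue. norm (g x) \<le> c * norm (u x)"
  shows "Lp_loc 2 UNIV g"
proof (rule Lp_loc_2I[OF assms(2)])
  fix K :: "(real ^ 'n) set" assume K: "compact K"
  show "L2 (lebesgue_on K) g"
    by (rule L2_bounded[OF Lp_loc_2_compact_L2[OF assms(1) K], of _ c])
      (use assms(2,3) K in \<open>auto intro: measurable_restrict_space1 AE_restrict_space_iff[THEN iffD2] simp: fmeasurableD lmeasurable_compact AE_restrict_space_iff\<close>)
qed

lemma Lp_loc_2_const: "Lp_loc 2 UNIV (\<lambda>x :: real ^ 'n. c :: 'b :: euclidean_space)"
  using Lp_loc_1_const[of "(norm c)\<^sup>2"] unfolding Lp_loc_2_iff Lp_loc_1_iff by simp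

section \<open>Mean squares over large balls and Besicovitch spaces\<close>

text \<open>
  A bound on the limit superior that defines the seminorm, as a predicate: it does not depend on the
  value that is assigned to an infinite limit superior, and sums and bounded multiples
  are handled without subadditivity of the seminorm.
\<close>
definition mean_sq_le :: "(real ^ 'n \<Rightarrow> real) \<Rightarrow> real \<Rightarrow> bool" where
  "mean_sq_le u c \<longleftrightarrow> (\<forall>\<^sub>F R in at_top. (LINT x|lebesgue_on (ball 0 R). (u x)\<^sup>2) \<le> c * measure lebesgue (ball (0 :: real ^ 'n) R))"

lemma mean_sq_le_mono: "mean_sq_le u c \<Longrightarrow> c \<le> c' \<Longrightarrow> mean_sq_le u c'"
  unfolding mean_sq_le_def by (erule eventually_mono) (meson measure_nonneg mult_right_mono order_trans)

lemma mean_sq_le_add: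
  assumes u: "Lp_loc 2 UNIV u" and v: "Lp_loc 2 UNIV v" and "mean_sq_le u a" "mean_sq_le v b"
  shows "mean_sq_le (\<lambda>x. u x + v x) (2 * a + 2 * b)"
  using assms(3,4) unfolding mean_sq_le_def
proof eventually_elim
  case (elim R)
  have "L2 (lebesgue_on (ball 0 R)) u" "L2 (lebesgue_on (ball 0 R)) v"
    by (auto intro!: Lp_loc_2_L2 u v)
  from L2_integral_add_le[OF this] elim show ?case by (simp add: algebra_simps)
qed

lemma mean_sq_le_bounded:
  assumes u: "Lp_loc 2 UNIV u" and g: "g \<in> borel_measurable lebesgue" "AE x in lebesgue. \<bar>g x\<bar> \<le> c * \<bar>u x\<bar>" and a: "mean_sq_le u a"
  shows "mean_sq_le g (c\<^sup>2 * a)"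
  using a unfolding mean_sq_le_def
proof eventually_elim
  case (elim R)
  have u2: "L2 (lebesgue_on (ball 0 R)) u" by (auto intro!: Lp_loc_2_L2 u)
  have ae: "AE x in lebesgue_on (ball 0 R). \<bar>g x\<bar> \<le> c * \<bar>u x\<bar>"
    using g(2) by (auto simp: AE_restrict_space_iff)
  have g2: "L2 (lebesgue_on (ball 0 R)) g"
    by (rule L2_bounded[OF u2, of _ c]) (use ae g in \<open>auto intro: measurable_restrict_space1\<close>)
  have "(LINT x|lebesgue_on (ball 0 R). (g x)\<^sup>2) \<le> (LINT x|lebesgue_on (ball 0 R). c\<^sup>2 * (u x)\<^sup>2)"
  proof (rule integral_mono_AE)
    show "AE x in lebesgue_on (ball 0 R). (g x)\<^sup>2 \<le> c\<^sup>2 * (u x)\<^sup>2" using ae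
    proof eventually_elim
      case (elim x)
      then have "\<bar>g x\<bar>\<^sup>2 \<le> (c * \<bar>u x\<bar>)\<^sup>2" by (intro power_mono) auto
      then show ?case by (simp add: power_mult_distrib)
    qed
  qed (use L2_integrable_real[OF u2] L2_integrable_real[OF g2] in auto)
  also have "\<dots> = c\<^sup>2 * (LINT x|lebesgue_on (ball 0 R). (u x)\<^sup>2)" by simp
  also have "\<dots> \<le> c\<^sup>2 * (a * measure lebesgue (ball (0 :: real ^ 'a) R))" using elim by (intro mult_left_mono) auto
  finally show ?case by (simp add: mult.assoc)
qed

lemma mean_sq_le_const: "mean_sq_le (\<lambda>x :: real ^ 'n. c) (c\<^sup>2)"
  unfolding mean_sq_le_def
  by (rule always_eventually) (simp add: measure_restrict_space)

lemma limsup_mean_eq: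
  "limsup_mean 2 (u :: real ^ 'n \<Rightarrow> real) = Limsup at_top (\<lambda>R. ereal ((LINT x|lebesgue_on (ball 0 R). (u x)\<^sup>2) / measure lebesgue (ball (0 :: real ^ 'n) R)))"
proof -
  have "\<bar>u x\<bar> powr 2 = (u x)\<^sup>2" for x by (cases "u x = 0") auto
  then show ?thesis unfolding limsup_mean_def by (simp add: restrict_integrable_iff)
qed

lemma content_ball_lebesgue_pos: "R > 0 \<Longrightarrow> measure lebesgue (ball (0 :: real ^ 'n) R) > 0"
  by (subst measure_completion) (auto simp: content_ball_pos)

lemma mean_sq_le_limsup:
  assumes "mean_sq_le u c" shows "limsup_mean 2 u \<le> ereal c"
  unfolding limsup_mean_eq
proof (rule Limsup_bounded)
  show "\<forall>\<^sub>F R in at_top. ereal ((LINT x|lebesgue_on (ball 0 R). (u x)\<^sup>2) / measure lebesgue (ball (0 :: real ^ 'a) R)) \<le> ereal c"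
    using assms eventually_gt_at_top[of 0] unfolding mean_sq_le_def
    by eventually_elim (use content_ball_lebesgue_pos in \<open>auto simp: field_simps\<close>)
qed

lemma limsup_mean_sq_le:
  assumes "limsup_mean 2 u < ereal c" shows "mean_sq_le u c"
  using Limsup_lessD[OF assms[unfolded limsup_mean_eq]] eventually_gt_at_top[of 0] unfolding mean_sq_le_def
  by eventually_elim (use content_ball_lebesgue_pos[where 'n = 'a] in \<open>auto simp: field_simps\<close>)

lemma limsup_mean_nonneg: "limsup_mean 2 u \<ge> 0"
  unfolding limsup_mean_eq by (rule le_Limsup) (auto intro!: always_eventually divide_nonneg_nonneg)

lemma seminorm_le:
  assumes "mean_sq_le u c" shows "besicovitch_seminorm 2 u \<le> sqrt c"
proof -
  obtain r where r: "limsup_mean 2 u = ereal r" "0 \<le> r" "r \<le> c"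
    using mean_sq_le_limsup[OF assms] limsup_mean_nonneg[of u] by (cases "limsup_mean 2 u") auto
  then show ?thesis by (simp add: besicovitch_seminorm_def powr_half_sqrt)
qed

lemma seminorm_less:
  assumes "mean_sq_le u c" "besicovitch_seminorm 2 u < e" shows "mean_sq_le u (e\<^sup>2)"
proof -
  obtain r where r: "limsup_mean 2 u = ereal r" "0 \<le> r"
    using mean_sq_le_limsup[OF assms(1)] limsup_mean_nonneg[of u] by (cases "limsup_mean 2 u") auto
  then have "sqrt r < e" using assms(2) by (simp add: besicovitch_seminorm_def powr_half_sqrt)
  then have "r < e\<^sup>2" using r by (metis real_sqrt_ge_zero real_sqrt_pow2 power_strict_mono pos2)
  then show ?thesis using r by (intro limsup_mean_sq_le) simp
qed

lemma algebra_mv_D: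
  assumes "algebra_with_mean_value \<A>"
  shows "u \<in> \<A> \<Longrightarrow> \<exists>B>0. \<forall>x. \<bar>u x\<bar> \<le> B" "u \<in> \<A> \<Longrightarrow> uniformly_continuous_on UNIV u"
    "(\<lambda>x. c) \<in> \<A>" "u \<in> \<A> \<Longrightarrow> v \<in> \<A> \<Longrightarrow> (\<lambda>x. u x + v x) \<in> \<A>" "u \<in> \<A> \<Longrightarrow> v \<in> \<A> \<Longrightarrow> (\<lambda>x. u x * v x) \<in> \<A>"
    "u \<in> \<A> \<Longrightarrow> \<exists>c. has_mean_value u c"
proof -
  note a = assms[unfolded algebra_with_mean_value_def]
  show "u \<in> \<A> \<Longrightarrow> \<exists>B>0. \<forall>x. \<bar>u x\<bar> \<le> B" using a by (auto simp: bounded_pos)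
qed (use assms[unfolded algebra_with_mean_value_def] in auto)

lemma algebra_mv_borel:
  assumes "algebra_with_mean_value \<A>" "u \<in> \<A>"
  shows "u \<in> borel_measurable borel" "u \<in> borel_measurable lebesgue" "Lp_loc 2 UNIV u"
proof -
  show b: "u \<in> borel_measurable borel"
    using algebra_mv_D(2)[OF assms] by (intro borel_measurable_continuous_onI uniformly_continuous_imp_continuous)
  then show m: "u \<in> borel_measurable lebesgue" by (simp add: measurable_completion)
  obtain B where "\<And>x. \<bar>u x\<bar> \<le> B" using algebra_mv_D(1)[OF assms] by blast
  then show "Lp_loc 2 UNIV u"
    by (intro Lp_loc_2_bounded[OF Lp_loc_2_const[of "1::real"] m, of B]) auto
qed

lemma algebra_mv_mean_sq_le:
  assumes "algebra_with_mean_value \<A>" "u \<in> \<A>" shows "\<exists>c. mean_sq_le u c"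
proof -
  obtain B where "\<And>x. \<bar>u x\<bar> \<le> B" using algebra_mv_D(1)[OF assms] by blast
  then have "mean_sq_le u (B\<^sup>2 * 1\<^sup>2)"
    by (intro mean_sq_le_bounded[OF Lp_loc_2_const algebra_mv_borel(2)[OF assms] _ mean_sq_le_const]) auto
  then show ?thesis by blast
qed

lemma besicovitch_bound:
  assumes "u \<in> besicovitch 2 \<A>" shows "\<exists>c. mean_sq_le u c"
proof -
  have f: "limsup_mean 2 u < \<infinity>" using assms by (auto simp: besicovitch_def finite_seminorm_space_def)
  then show ?thesis
    using limsup_mean_nonneg[of u] by (cases "limsup_mean 2 u") (auto intro!: limsup_mean_sq_le exI[of _ "real_of_ereal (limsup_mean 2 u) + 1"])
qed

text \<open>
  Elements of the algebra are bounded, so an approximation in mean square already forces the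
  limit superior of the function itself to be finite.
\<close>
lemma besicovitch_2_iff:
  assumes A: "algebra_with_mean_value \<A>"
  shows "u \<in> besicovitch 2 \<A> \<longleftrightarrow> Lp_loc 2 UNIV u \<and> (\<forall>\<epsilon>>0. \<exists>v\<in>\<A>. mean_sq_le (\<lambda>x. u x - v x) \<epsilon>)"
proof
  assume u: "u \<in> besicovitch 2 \<A>"
  then have L: "Lp_loc 2 UNIV u" by (simp add: besicovitch_def finite_seminorm_space_def)
  obtain c where c: "mean_sq_le u c" using besicovitch_bound[OF u] by blast
  have "\<exists>v\<in>\<A>. mean_sq_le (\<lambda>x. u x - v x) \<epsilon>" if eps: "\<epsilon> > 0" for \<epsilon>
  proof -
    obtain v where v: "v \<in> \<A>" "besicovitch_seminorm 2 (\<lambda>x. u x - v x) < sqrt \<epsilon>"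
    proof -
      have "sqrt \<epsilon> > 0" using eps by simp
      then show ?thesis using u that unfolding besicovitch_def by blast
    qed
    obtain b where b: "mean_sq_le (\<lambda>x. v x) b" using algebra_mv_mean_sq_le[OF A v(1)] by blast
    have "mean_sq_le (\<lambda>x. - v x) (1\<^sup>2 * b)"
      using algebra_mv_borel[OF A v(1)] by (intro mean_sq_le_bounded[OF _ _ _ b]) auto
    then have "mean_sq_le (\<lambda>x. u x + - v x) (2 * c + 2 * (1\<^sup>2 * b))"
      using algebra_mv_borel[OF A v(1)] by (intro mean_sq_le_add L c) (auto intro!: Lp_loc_2_bounded[OF algebra_mv_borel(3)[OF A v(1)], of _ 1])
    then have "mean_sq_le (\<lambda>x. u x - v x) (2 * c + 2 * (1\<^sup>2 * b))" by simp
    from seminorm_less[OF this v(2)] show ?thesis using v(1) eps by auto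
  qed
  with L show "Lp_loc 2 UNIV u \<and> (\<forall>\<epsilon>>0. \<exists>v\<in>\<A>. mean_sq_le (\<lambda>x. u x - v x) \<epsilon>)" by blast
next
  assume *: "Lp_loc 2 UNIV u \<and> (\<forall>\<epsilon>>0. \<exists>v\<in>\<A>. mean_sq_le (\<lambda>x. u x - v x) \<epsilon>)"
  then obtain v where v: "v \<in> \<A>" "mean_sq_le (\<lambda>x. u x - v x) 1" by (metis zero_less_one)
  obtain b where b: "mean_sq_le (\<lambda>x. v x) b" using algebra_mv_mean_sq_le[OF A v(1)] by blast
  have "mean_sq_le (\<lambda>x. (u x - v x) + v x) (2 * 1 + 2 * b)"
    using * algebra_mv_borel[OF A v(1)] by (intro mean_sq_le_add v b Lp_loc_2_diff) auto
  then have "limsup_mean 2 u \<le> ereal (2 * 1 + 2 * b)" using mean_sq_le_limsup[of u] by simp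
  then have "limsup_mean 2 u < \<infinity>" by (cases "limsup_mean 2 u") auto
  moreover have "\<exists>v\<in>\<A>. besicovitch_seminorm 2 (\<lambda>x. u x - v x) < \<epsilon>" if eps: "\<epsilon> > 0" for \<epsilon>
  proof -
    obtain v where v: "v \<in> \<A>" "mean_sq_le (\<lambda>x. u x - v x) ((\<epsilon> / 2)\<^sup>2)"
    proof -
      have "(\<epsilon> / 2)\<^sup>2 > 0" using eps by simp
      then show ?thesis using * that by blast
    qed
    have "besicovitch_seminorm 2 (\<lambda>x. u x - v x) \<le> sqrt ((\<epsilon> / 2)\<^sup>2)" by (rule seminorm_le[OF v(2)])
    also have "\<dots> < \<epsilon>" using eps by simp
    finally show ?thesis using v(1) by blast
  qed
  ultimately show "u \<in> besicovitch 2 \<A>" using * by (auto simp: besicovitch_def finite_seminorm_space_def)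
qed

lemma besicovitch_approx:
  assumes "algebra_with_mean_value \<A>" "u \<in> besicovitch 2 \<A>" "\<epsilon> > 0"
  obtains v where "v \<in> \<A>" "mean_sq_le (\<lambda>x. u x - v x) \<epsilon>"
  using assms(2,3) unfolding besicovitch_2_iff[OF assms(1)] by blast

lemma besicovitch_add:
  assumes A: "algebra_with_mean_value \<A>" and "u \<in> besicovitch 2 \<A>" "w \<in> besicovitch 2 \<A>"
  shows "(\<lambda>x. u x + w x) \<in> besicovitch 2 \<A>"
  unfolding besicovitch_2_iff[OF A]
proof (intro conjI allI impI)
  have u: "Lp_loc 2 UNIV u" and w: "Lp_loc 2 UNIV w" using assms by (auto simp: besicovitch_2_iff)
  then show "Lp_loc 2 UNIV (\<lambda>x. u x + w x)" by (rule Lp_loc_2_add)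
  fix \<epsilon> :: real assume "\<epsilon> > 0"
  then have e: "\<epsilon> / 4 > 0" by simp
  obtain u' where u': "u' \<in> \<A>" "mean_sq_le (\<lambda>x. u x - u' x) (\<epsilon> / 4)" by (rule besicovitch_approx[OF A assms(2) e])
  obtain w' where w': "w' \<in> \<A>" "mean_sq_le (\<lambda>x. w x - w' x) (\<epsilon> / 4)" by (rule besicovitch_approx[OF A assms(3) e])
  have "mean_sq_le (\<lambda>x. (u x - u' x) + (w x - w' x)) (2 * (\<epsilon> / 4) + 2 * (\<epsilon> / 4))"
    by (intro mean_sq_le_add Lp_loc_2_diff u w u' w' algebra_mv_borel(3)[OF A])
  moreover have "(\<lambda>x. (u x - u' x) + (w x - w' x)) = (\<lambda>x. (u x + w x) - (u' x + w' x))" by auto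
  ultimately have "mean_sq_le (\<lambda>x. (u x + w x) - (u' x + w' x)) \<epsilon>" by simp
  then show "\<exists>v\<in>\<A>. mean_sq_le (\<lambda>x. u x + w x - v x) \<epsilon>"
    using algebra_mv_D(4)[OF A u'(1) w'(1)] by (rule bexI[where x = "\<lambda>x. u' x + w' x"])
qed

lemma besicovitch_const:
  assumes A: "algebra_with_mean_value \<A>" shows "(\<lambda>x. c) \<in> besicovitch 2 \<A>"
proof -
  have "\<exists>v\<in>\<A>. mean_sq_le (\<lambda>x. c - v x) \<epsilon>" if "\<epsilon> > 0" for \<epsilon>
    using mean_sq_le_mono[OF mean_sq_le_const[of 0], of \<epsilon>] that by (intro bexI[OF _ algebra_mv_D(3)[OF A, of c]]) auto
  then show ?thesis by (simp add: besicovitch_2_iff[OF A] Lp_loc_2_const)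
qed

text \<open>
  Split \<open>a g - b v = a (g - v) + (a - b) v\<close>. The approximation \<open>v\<close> of \<open>g\<close> is chosen before the
  approximation \<open>b\<close> of \<open>a\<close>, because the accuracy of the latter depends on the sup bound \<open>B\<close> of \<open>v\<close>.
\<close>
lemma besicovitch_mult_bounded:
  assumes A: "algebra_with_mean_value \<A>" and a: "a \<in> besicovitch 2 \<A>" "AE x in lebesgue. \<bar>a x\<bar> \<le> c"
    and g: "g \<in> besicovitch 2 \<A>"
  shows "(\<lambda>x. a x * g x) \<in> besicovitch 2 \<A>"
  unfolding besicovitch_2_iff[OF A]
proof (intro conjI allI impI)
  have La: "Lp_loc 2 UNIV a" and Lg: "Lp_loc 2 UNIV g" using a g by (auto simp: besicovitch_2_iff[OF A])
  note [measurable] = Lp_loc_measurable[OF La] Lp_loc_measurable[OF Lg]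
  have mb: "AE x in lebesgue. \<bar>a x * h x\<bar> \<le> c * \<bar>h x\<bar>" for h
    using a(2) by eventually_elim (auto simp: abs_mult mult_right_mono)
  show "Lp_loc 2 UNIV (\<lambda>x. a x * g x)"
    using mb[of g] by (intro Lp_loc_2_bounded[OF Lg, of _ c]) auto
  fix \<epsilon> :: real assume \<epsilon>: "\<epsilon> > 0"
  have e1: "\<epsilon> / (4 * (c\<^sup>2 + 1)) > 0" using \<epsilon> by (simp add: add_nonneg_pos)
  obtain v where v: "v \<in> \<A>" "mean_sq_le (\<lambda>x. g x - v x) (\<epsilon> / (4 * (c\<^sup>2 + 1)))"
    by (rule besicovitch_approx[OF A g e1])
  obtain B where B: "B > 0" "\<And>x. \<bar>v x\<bar> \<le> B" using algebra_mv_D(1)[OF A v(1)] by blast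
  have e2: "\<epsilon> / (4 * B\<^sup>2) > 0" using \<epsilon> B(1) by simp
  obtain b where b: "b \<in> \<A>" "mean_sq_le (\<lambda>x. a x - b x) (\<epsilon> / (4 * B\<^sup>2))"
    by (rule besicovitch_approx[OF A a(1) e2])
  note [measurable] = algebra_mv_borel(2)[OF A v(1)] algebra_mv_borel(2)[OF A b(1)]
  have L1: "Lp_loc 2 UNIV (\<lambda>x. g x - v x)" by (intro Lp_loc_2_diff Lg algebra_mv_borel(3)[OF A v(1)])
  have L2: "Lp_loc 2 UNIV (\<lambda>x. a x - b x)" by (intro Lp_loc_2_diff La algebra_mv_borel(3)[OF A b(1)])
  have mb2: "AE x in lebesgue. \<bar>(a x - b x) * v x\<bar> \<le> B * \<bar>a x - b x\<bar>"
    using B by (auto simp: abs_mult mult.commute intro!: AE_I2 mult_right_mono)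
  have "mean_sq_le (\<lambda>x. a x * (g x - v x) + (a x - b x) * v x) (2 * (c\<^sup>2 * (\<epsilon> / (4 * (c\<^sup>2 + 1)))) + 2 * (B\<^sup>2 * (\<epsilon> / (4 * B\<^sup>2))))"
  proof (rule mean_sq_le_add)
    show "mean_sq_le (\<lambda>x. a x * (g x - v x)) (c\<^sup>2 * (\<epsilon> / (4 * (c\<^sup>2 + 1))))"
      by (rule mean_sq_le_bounded[OF L1 _ mb v(2)]) measurable
    show "mean_sq_le (\<lambda>x. (a x - b x) * v x) (B\<^sup>2 * (\<epsilon> / (4 * B\<^sup>2)))"
      by (rule mean_sq_le_bounded[OF L2 _ mb2 b(2)]) measurable
    show "Lp_loc 2 UNIV (\<lambda>x. a x * (g x - v x))"
      by (rule Lp_loc_2_bounded[OF L1, of _ c]) (use mb in auto)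
    show "Lp_loc 2 UNIV (\<lambda>x. (a x - b x) * v x)"
      by (rule Lp_loc_2_bounded[OF L2, of _ B]) (use mb2 in auto)
  qed
  then have "mean_sq_le (\<lambda>x. a x * (g x - v x) + (a x - b x) * v x) \<epsilon>"
  proof (rule mean_sq_le_mono)
    have "c\<^sup>2 * (\<epsilon> / (4 * (c\<^sup>2 + 1))) \<le> \<epsilon> / 4"
      using \<epsilon> sum_power2_ge_zero[of c 1] by (simp add: field_simps add_pos_nonneg)
    moreover have "B\<^sup>2 * (\<epsilon> / (4 * B\<^sup>2)) = \<epsilon> / 4" using B by simp
    ultimately show "2 * (c\<^sup>2 * (\<epsilon> / (4 * (c\<^sup>2 + 1)))) + 2 * (B\<^sup>2 * (\<epsilon> / (4 * B\<^sup>2))) \<le> \<epsilon>" by linarith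
  qed
  moreover have "(\<lambda>x. a x * (g x - v x) + (a x - b x) * v x) = (\<lambda>x. a x * g x - b x * v x)"
    by (auto simp: algebra_simps)
  ultimately have "mean_sq_le (\<lambda>x. a x * g x - b x * v x) \<epsilon>" by simp
  then show "\<exists>w\<in>\<A>. mean_sq_le (\<lambda>x. a x * g x - w x) \<epsilon>"
    using algebra_mv_D(5)[OF A b(1) v(1)] by (rule bexI[where x = "\<lambda>x. b x * v x"])
qed

lemma besicovitch_sum:
  assumes A: "algebra_with_mean_value \<A>" and "finite I" "\<And>i. i \<in> I \<Longrightarrow> u i \<in> besicovitch 2 \<A>"
  shows "(\<lambda>x. \<Sum>i\<in>I. u i x) \<in> besicovitch 2 \<A>"
  using assms(2,3) by (induction I rule: finite_induct) (auto intro!: besicovitch_add[OF A] besicovitch_const[OF A, of 0, simplified])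

section \<open>Averages over large cubes\<close>

abbreviation L2_cube :: "real \<Rightarrow> (real ^ 'n \<Rightarrow> 'b::euclidean_space) \<Rightarrow> bool" where
  "L2_cube T f \<equiv> L2 (lebesgue_on (cube T)) f"

definition avg :: "real \<Rightarrow> (real ^ 'n \<Rightarrow> real) \<Rightarrow> real" where
  "avg T f = (LINT x|lebesgue_on (cube T). f x) / T ^ CARD('n)"

lemma cube_bounded: "bounded (cube T)"
  by (simp add: cube_def)

lemma Lp_loc_2_cube: "Lp_loc 2 UNIV u \<Longrightarrow> L2_cube T u"
  by (rule Lp_loc_2_L2) (auto simp: cube_bounded)

lemma L2_cube_const: "L2_cube T (\<lambda>x :: real ^ 'n. c)"
  by (rule Lp_loc_2_cube[OF Lp_loc_2_const])

lemma content_cube: "T \<ge> 0 \<Longrightarrow> measure lborel (cube T :: (real ^ 'n) set) = T ^ CARD('n)"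
  using measure_cube[of T, where 'n = 'n] by (simp add: measure_completion)

lemma avg_const: "T > 0 \<Longrightarrow> avg T (\<lambda>x :: real ^ 'n. c) = c"
  by (simp add: avg_def measure_restrict_space content_cube)

lemma avg_add:
  assumes "integrable (lebesgue_on (cube T)) f" "integrable (lebesgue_on (cube T)) g"
  shows "avg T (\<lambda>x. f x + g x) = avg T f + avg T g"
  using assms by (simp add: avg_def add_divide_distrib)

lemma avg_diff:
  assumes "integrable (lebesgue_on (cube T)) f" "integrable (lebesgue_on (cube T)) g"
  shows "avg T (\<lambda>x. f x - g x) = avg T f - avg T g"
  using assms by (simp add: avg_def diff_divide_distrib)

lemma avg_cmult: "avg T (\<lambda>x. c * f x) = c * avg T f"
  by (simp add: avg_def)

lemma avg_mono_AE:
  assumes "integrable (lebesgue_on (cube T)) f" "integrable (lebesgue_on (cube T)) g" "T > 0"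
    "AE x in lebesgue_on (cube T). f x \<le> g x"
  shows "avg T f \<le> avg T g"
  unfolding avg_def using assms by (intro divide_right_mono integral_mono_AE) auto

lemma avg_mono:
  assumes "integrable (lebesgue_on (cube T)) f" "integrable (lebesgue_on (cube T)) g" "T > 0"
    "\<And>x. x \<in> cube T \<Longrightarrow> f x \<le> g x"
  shows "avg T f \<le> avg T g"
  unfolding avg_def using assms by (intro divide_right_mono integral_mono) auto

lemma avg_nonneg: "T > 0 \<Longrightarrow> (\<And>x. f x \<ge> 0) \<Longrightarrow> avg T f \<ge> 0"
  unfolding avg_def by (intro divide_nonneg_nonneg integral_nonneg_AE) auto

lemma avg_Young:
  assumes "L2_cube T f" "L2_cube T g" "T > 0" "\<eta> > 0"
  shows "\<bar>avg T (\<lambda>x. f x \<bullet> g x)\<bar> \<le> \<eta> / 2 * avg T (\<lambda>x. (norm (f x))\<^sup>2) + avg T (\<lambda>x. (norm (g x))\<^sup>2) / (2 * \<eta>)"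
proof -
  let ?V = "T ^ CARD('a)"
  have V: "?V > 0" using assms by simp
  have "\<bar>avg T (\<lambda>x. f x \<bullet> g x)\<bar> = \<bar>LINT x|lebesgue_on (cube T). f x \<bullet> g x\<bar> / ?V"
    using V by (simp add: avg_def)
  also have "\<dots> \<le> (\<eta> / 2 * (LINT x|lebesgue_on (cube T). (norm (f x))\<^sup>2) + (LINT x|lebesgue_on (cube T). (norm (g x))\<^sup>2) / (2 * \<eta>)) / ?V"
    using V by (intro divide_right_mono L2_Young(2) assms) auto
  also have "\<dots> = \<eta> / 2 * avg T (\<lambda>x. (norm (f x))\<^sup>2) + avg T (\<lambda>x. (norm (g x))\<^sup>2) / (2 * \<eta>)"
    by (simp add: avg_def add_divide_distrib mult.commute)
  finally show ?thesis .
qed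

lemma avg_inner_small:
  assumes "L2_cube T f" "L2_cube T g" "T > 0" "\<eta> > 0"
    "avg T (\<lambda>x. (norm (f x))\<^sup>2) \<le> C" "avg T (\<lambda>x. (norm (g x))\<^sup>2) \<le> \<eta>\<^sup>2"
  shows "\<bar>avg T (\<lambda>x. f x \<bullet> g x)\<bar> \<le> \<eta> * (C + 1)"
proof -
  have "\<bar>avg T (\<lambda>x. f x \<bullet> g x)\<bar> \<le> \<eta> / 2 * avg T (\<lambda>x. (norm (f x))\<^sup>2) + avg T (\<lambda>x. (norm (g x))\<^sup>2) / (2 * \<eta>)"
    by (rule avg_Young) (use assms in auto)
  also have "\<dots> \<le> \<eta> / 2 * C + \<eta>\<^sup>2 / (2 * \<eta>)"
    using assms by (intro add_mono mult_left_mono divide_right_mono) auto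
  also have "\<dots> = \<eta> / 2 * (C + 1)" using assms by (simp add: power2_eq_square field_simps)
  also have "\<dots> \<le> \<eta> * (C + 1)"
  proof -
    have "0 \<le> avg T (\<lambda>x. (norm (f x))\<^sup>2)" by (rule avg_nonneg) (use assms in auto)
    then show ?thesis using assms by (intro mult_right_mono) auto
  qed
  finally show "\<bar>avg T (\<lambda>x. f x \<bullet> g x)\<bar> \<le> \<eta> * (C + 1)" .
qed

lemma avg_add_sq:
  assumes "L2_cube T f" "L2_cube T g" "T > 0"
  shows "avg T (\<lambda>x. (norm (f x + g x))\<^sup>2) \<le> 2 * avg T (\<lambda>x. (norm (f x))\<^sup>2) + 2 * avg T (\<lambda>x. (norm (g x))\<^sup>2)"
  using divide_right_mono[OF L2_integral_add_le[OF assms(1,2)], of "T ^ CARD('a)"] assms(3)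
  by (simp add: avg_def add_divide_distrib)

lemma avg_abs_le:
  assumes u: "L2_cube T u" and "T > 0" "s > 0" "avg T (\<lambda>x. (u x)\<^sup>2) \<le> s\<^sup>2"
  shows "\<bar>avg T u\<bar> \<le> s"
proof -
  have "\<bar>avg T (\<lambda>x. 1 \<bullet> u x)\<bar> \<le> s / 2 * avg T (\<lambda>x :: real ^ 'a. (norm (1::real))\<^sup>2) + avg T (\<lambda>x. (norm (u x))\<^sup>2) / (2 * s)"
    by (rule avg_Young[OF L2_cube_const u assms(2,3)])
  also have "\<dots> \<le> s / 2 + s\<^sup>2 / (2 * s)"
    using assms by (intro add_mono divide_right_mono) (auto simp: avg_const)
  also have "\<dots> = s" using assms by (simp add: power2_eq_square)
  finally show ?thesis by simp
qed

lemma cube_subset_ball: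
  fixes T :: real
  assumes T: "T > 0" shows "(cube T :: (real ^ 'n) set) \<subseteq> ball 0 (real CARD('n) * T)"
proof
  fix x :: "real ^ 'n" assume x: "x \<in> cube T"
  have "norm x \<le> (\<Sum>i\<in>UNIV. \<bar>x $ i\<bar>)" by (rule norm_le_l1_cart)
  also have "\<dots> < (\<Sum>i\<in>(UNIV :: 'n set). T)"
  proof (rule sum_strict_mono)
    fix i
    have "\<bar>x $ i\<bar> \<le> T / 2" using x by (simp add: mem_cube)
    then show "\<bar>x $ i\<bar> < T" using T by linarith
  qed auto
  finally show "x \<in> ball 0 (real CARD('n) * T)" by simp
qed

text \<open>
  The seminorm is defined by balls, the approximate matrix by cubes. A cube lies in a ball of
  comparable volume, and \<open>K\<close> is the ratio of the two volumes.
\<close>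
lemma mean_sq_le_avg:
  obtains K where "K > 0" "\<And>(u :: real ^ 'n \<Rightarrow> real) c. Lp_loc 2 UNIV u \<Longrightarrow> mean_sq_le u c \<Longrightarrow> \<forall>\<^sub>F T in at_top. avg T (\<lambda>x. (u x)\<^sup>2) \<le> K * c"
proof -
  let ?d = "real CARD('n)"
  define K where "K = ?d ^ CARD('n) * measure lebesgue (ball (0 :: real ^ 'n) 1)"
  have K: "K > 0" unfolding K_def by (intro mult_pos_pos content_ball_lebesgue_pos) auto
  show ?thesis
  proof (rule that[OF K])
    fix u :: "real ^ 'n \<Rightarrow> real" and c assume u: "Lp_loc 2 UNIV u" and "mean_sq_le u c"
    have "filterlim (\<lambda>T. ?d * T) at_top at_top"
      by (rule filterlim_tendsto_pos_mult_at_top[OF tendsto_const]) (auto intro: filterlim_ident)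
    then have "\<forall>\<^sub>F T in at_top. (LINT x|lebesgue_on (ball 0 (?d * T)). (u x)\<^sup>2) \<le> c * measure lebesgue (ball (0 :: real ^ 'n) (?d * T))"
      using \<open>mean_sq_le u c\<close> unfolding mean_sq_le_def by (rule eventually_compose_filterlim[rotated])
    then show "\<forall>\<^sub>F T in at_top. avg T (\<lambda>x. (u x)\<^sup>2) \<le> K * c"
      using eventually_gt_at_top[of 0]
    proof eventually_elim
      case (elim T)
      have "(LINT x|lebesgue_on (cube T). (u x)\<^sup>2) \<le> (LINT x|lebesgue_on (ball 0 (?d * T)). (u x)\<^sup>2)"
        using integral_sq_subset[OF u, of "cube T" "ball 0 (?d * T)"] cube_subset_ball[OF elim(2), where 'n = 'n] by simp
      also have "\<dots> \<le> c * measure lebesgue (ball (0 :: real ^ 'n) (?d * T))" by (rule elim)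
      also have "measure lebesgue (ball (0 :: real ^ 'n) (?d * T)) = (?d * T) ^ CARD('n) * measure lebesgue (ball (0 :: real ^ 'n) 1)"
        using content_ball_conv_unit_ball[of "?d * T" "0 :: real ^ 'n"] elim(2) by (simp add: measure_completion)
      also have "c * \<dots> = (K * c) * T ^ CARD('n)" by (simp add: K_def power_mult_distrib)
      finally show ?case using elim(2) by (simp add: avg_def divide_le_eq)
    qed
  qed
qed

text \<open>
  Test the weak-star convergence against the indicator of the unit cube and rescale.
\<close>
lemma avg_mean_value:
  fixes v :: "real ^ 'n \<Rightarrow> real"
  assumes m: "has_mean_value v c" and [measurable]: "v \<in> borel_measurable borel"
  shows "((\<lambda>T. avg T v) \<longlongrightarrow> c) at_top"
proof -
  let ?f = "indicat_real (cube 1 :: (real ^ 'n) set)"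
  have "integrable lebesgue ?f" by (rule integrable_indicator_compact[OF compact_cube])
  then have "((\<lambda>\<epsilon>. LINT x|lebesgue. v (x /\<^sub>R \<epsilon>) * ?f x) \<longlongrightarrow> c * (LINT x|lebesgue. ?f x)) (at_right 0)"
    using m unfolding has_mean_value_def by blast
  then have "((\<lambda>T. LINT x|lebesgue. v (x /\<^sub>R inverse T) * ?f x) \<longlongrightarrow> c * (LINT x|lebesgue. ?f x)) at_top"
    by (rule filterlim_compose[OF _ filterlim_inverse_at_right_top])
  moreover have "(LINT x|lebesgue. ?f x) = 1" by (simp add: content_cube)
  moreover have "\<forall>\<^sub>F T in at_top. (LINT x|lebesgue. v (x /\<^sub>R inverse T) * ?f x) = avg T v"
    using eventually_gt_at_top[of 0]
  proof eventually_elim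
    case (elim T)
    have "(LINT x|lebesgue. indicator (cube T) x * v x) = \<bar>T\<bar> ^ CARD('n) * (LINT x|lebesgue. indicator (cube T) (0 + T *\<^sub>R x) * v (0 + T *\<^sub>R x))"
      by (rule lebesgue_integral_affine) (use elim in auto)
    also have "\<dots> = T ^ CARD('n) * (LINT x|lebesgue. v (x /\<^sub>R inverse T) * ?f x)"
      using elim by (auto simp: indicator_def mem_cube abs_mult intro!: Bochner_Integration.integral_cong)
    finally show ?case using elim by (simp add: avg_def restrict_integrable_iff set_lebesgue_integral_def)
  qed
  ultimately show ?thesis by (simp add: tendsto_cong)
qed

lemma mean_value_avg:
  fixes v :: "real ^ 'n \<Rightarrow> real"
  assumes A: "algebra_with_mean_value \<A>" "v \<in> \<A>"
  shows "((\<lambda>T. avg T v) \<longlongrightarrow> mean_value v) at_top"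
proof -
  obtain c where c: "has_mean_value v c" using algebra_mv_D(6)[OF A] by blast
  have "mean_value v = c" unfolding mean_value_def
  proof (rule the_equality)
    fix c' assume "has_mean_value v c'"
    then show "c' = c"
      using tendsto_unique[OF _ avg_mean_value[OF _ algebra_mv_borel(1)[OF A]] avg_mean_value[OF c algebra_mv_borel(1)[OF A]]] by simp
  qed (rule c)
  with avg_mean_value[OF c algebra_mv_borel(1)[OF A]] show ?thesis by simp
qed

lemma besicovitch_of_algebra:
  assumes A: "algebra_with_mean_value \<A>" and v: "v \<in> \<A>"
  shows "v \<in> besicovitch 2 \<A>"
  unfolding besicovitch_2_iff[OF A]
proof (intro conjI allI impI algebra_mv_borel(3)[OF A v] bexI[OF _ v])
  fix \<epsilon> :: real assume "\<epsilon> > 0"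
  then have "mean_sq_le (\<lambda>x. 0) \<epsilon>" by (intro mean_sq_le_mono[OF mean_sq_le_const[of 0]]) simp
  then show "mean_sq_le (\<lambda>x. v x - v x) \<epsilon>" by simp
qed

text \<open>
  The abstract extension of the mean value by continuity is the limit of the averages over cubes.
  Averages are continuous for the seminorm, uniformly for large cubes, so the mean values of any
  approximating sequence in the algebra converge to that limit; this also shows that the definite
  description in the definition is well defined.
\<close>
lemma avg_besicovitch_mean:
  fixes u :: "real ^ 'n \<Rightarrow> real"
  assumes A: "algebra_with_mean_value \<A>" and u: "u \<in> besicovitch 2 \<A>"
  shows "((\<lambda>T. avg T u) \<longlongrightarrow> besicovitch_mean 2 \<A> u) at_top"
proof -
  obtain K where K: "K > 0" "\<And>(u :: real ^ 'n \<Rightarrow> real) c. Lp_loc 2 UNIV u \<Longrightarrow> mean_sq_le u c \<Longrightarrow> \<forall>\<^sub>F T in at_top. avg T (\<lambda>x. (u x)\<^sup>2) \<le> K * c"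
    by (rule mean_sq_le_avg) blast
  have Lu: "Lp_loc 2 UNIV u" using u by (simp add: besicovitch_2_iff[OF A])
  have close: "\<forall>\<^sub>F T in at_top. \<bar>avg T u - avg T v\<bar> \<le> s" if v: "v \<in> \<A>" and s: "s > 0" and ms: "mean_sq_le (\<lambda>x. u x - v x) (s\<^sup>2 / K)" for v s
  proof -
    have L: "Lp_loc 2 UNIV (\<lambda>x. u x - v x)" by (intro Lp_loc_2_diff Lu algebra_mv_borel(3)[OF A v])
    from K(2)[OF L ms] eventually_gt_at_top[of 0] show ?thesis
    proof eventually_elim
      case (elim T)
      have i: "integrable (lebesgue_on (cube T)) w" if "Lp_loc 2 UNIV w" for w :: "real ^ 'n \<Rightarrow> real"
        using L2_Young(1)[OF L2_cube_const[of T "1::real"] Lp_loc_2_cube[OF that]] by simp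
      have "\<bar>avg T (\<lambda>x. u x - v x)\<bar> \<le> s"
        by (rule avg_abs_le[OF Lp_loc_2_cube[OF L]]) (use elim K s in auto)
      then show ?case by (simp add: avg_diff i Lu algebra_mv_borel(3)[OF A v])
    qed
  qed
  have mclose: "\<bar>m - mean_value v\<bar> \<le> s" if v: "v \<in> \<A>" "s > 0" "mean_sq_le (\<lambda>x. u x - v x) (s\<^sup>2 / K)" and m: "((\<lambda>T. avg T u) \<longlongrightarrow> m) at_top" for v s m
  proof (rule tendsto_upperbound)
    show "((\<lambda>T. \<bar>avg T u - avg T v\<bar>) \<longlongrightarrow> \<bar>m - mean_value v\<bar>) at_top"
      by (intro tendsto_intros m mean_value_avg[OF A v(1)])
  qed (use close[OF v] in auto)
  \<comment> \<open>an approximating sequence with an explicit rate, whose mean values form a Cauchy sequence\<close>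
  define e where "e n = inverse (real (Suc n))" for n
  have e: "e n > 0" for n by (simp add: e_def)
  have e0: "e \<longlonglongrightarrow> 0" unfolding e_def by (rule LIMSEQ_inverse_real_of_nat)
  have "\<exists>v\<in>\<A>. mean_sq_le (\<lambda>x. u x - v x) ((e n)\<^sup>2 / K)" for n
    using besicovitch_approx[OF A u, of "(e n)\<^sup>2 / K"] e[of n] K(1) by (metis divide_pos_pos zero_less_power)
  then obtain f where f: "\<And>n. f n \<in> \<A>" "\<And>n. mean_sq_le (\<lambda>x. u x - f n x) ((e n)\<^sup>2 / K)" by metis
  have mm: "\<bar>mean_value (f n) - mean_value (f k)\<bar> \<le> e n + e k" for n k
  proof (rule tendsto_upperbound)
    show "((\<lambda>T. \<bar>avg T (f n) - avg T (f k)\<bar>) \<longlongrightarrow> \<bar>mean_value (f n) - mean_value (f k)\<bar>) at_top"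
      by (intro tendsto_intros mean_value_avg[OF A f(1)])
    show "\<forall>\<^sub>F T in at_top. \<bar>avg T (f n) - avg T (f k)\<bar> \<le> e n + e k"
      using close[OF f(1) e f(2), of n] close[OF f(1) e f(2), of k] by eventually_elim linarith
  qed simp
  have "Cauchy (\<lambda>n. mean_value (f n))"
  proof (rule metric_CauchyI)
    fix r :: real assume "r > 0"
    then obtain N where N: "\<And>n. n \<ge> N \<Longrightarrow> e n < r / 2"
      using order_tendstoD(2)[OF e0, of "r/2"] by (auto simp: eventually_sequentially)
    show "\<exists>N. \<forall>m\<ge>N. \<forall>n\<ge>N. dist (mean_value (f m)) (mean_value (f n)) < r"
    proof (intro exI[of _ N] allI impI)
      fix i j assume "i \<ge> N" "j \<ge> N"
      then show "dist (mean_value (f i)) (mean_value (f j)) < r"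
        using mm[of i j] N[of i] N[of j] by (simp add: dist_real_def)
    qed
  qed
  then obtain m where m: "(\<lambda>n. mean_value (f n)) \<longlonglongrightarrow> m" using real_Cauchy_convergent convergent_def by blast
  have mu: "((\<lambda>T. avg T u) \<longlongrightarrow> m) at_top"
  proof (rule tendstoI)
    fix r :: real assume r: "r > 0"
    have "\<forall>\<^sub>F n in sequentially. e n < r / 3 \<and> dist (mean_value (f n)) m < r / 3"
      using order_tendstoD(2)[OF e0, of "r/3"] tendstoD[OF m, of "r/3"] r by (intro eventually_conj) auto
    then obtain n where n: "e n < r / 3" "dist (mean_value (f n)) m < r / 3"
      using eventually_happens by force
    have "\<forall>\<^sub>F T in at_top. dist (avg T (f n)) (mean_value (f n)) < r / 3"
      using tendstoD[OF mean_value_avg[OF A f(1)], of "r/3" n] r by auto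
    with close[OF f(1) e f(2), of n] show "\<forall>\<^sub>F T in at_top. dist (avg T u) m < r"
      by eventually_elim (use n in \<open>unfold dist_real_def, linarith\<close>)
  qed
  have "besicovitch_mean 2 \<A> u = m" unfolding besicovitch_mean_def
  proof (rule the_equality)
    show "\<forall>f. (\<forall>n::nat. f n \<in> \<A>) \<and> (\<lambda>n. besicovitch_seminorm 2 (\<lambda>x. u x - f n x)) \<longlonglongrightarrow> 0 \<longrightarrow> (\<lambda>n. mean_value (f n)) \<longlonglongrightarrow> m"
    proof (intro allI impI, elim conjE)
      fix g assume g: "\<forall>n::nat. g n \<in> \<A>" "(\<lambda>n. besicovitch_seminorm 2 (\<lambda>x. u x - g n x)) \<longlonglongrightarrow> 0"
      show "(\<lambda>n. mean_value (g n)) \<longlonglongrightarrow> m"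
      proof (rule tendstoI)
        fix r :: real assume r: "r > 0"
        have "\<forall>\<^sub>F n in sequentially. besicovitch_seminorm 2 (\<lambda>x. u x - g n x) < (r / 2) / sqrt K"
          using r K(1) by (intro order_tendstoD(2)[OF g(2)]) auto
        then show "\<forall>\<^sub>F n in sequentially. dist (mean_value (g n)) m < r"
        proof eventually_elim
          case (elim n)
          have gn: "g n \<in> \<A>" using g by blast
          have "(\<lambda>x. u x + (-1) * g n x) \<in> besicovitch 2 \<A>"
          proof -
            have "g n \<in> besicovitch 2 \<A>" by (rule besicovitch_of_algebra[OF A gn])
            then show ?thesis
              by (intro besicovitch_add[OF A u] besicovitch_mult_bounded[OF A besicovitch_const[OF A, of "-1"], of 1]) auto
          qed
          then obtain c where "mean_sq_le (\<lambda>x. u x - g n x) c" using besicovitch_bound by fastforce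
          from seminorm_less[OF this elim] have "mean_sq_le (\<lambda>x. u x - g n x) ((r / 2)\<^sup>2 / K)"
            using K(1) by (simp add: power_divide)
          from mclose[OF gn _ this mu] r show ?case by (simp add: dist_real_def abs_minus_commute)
        qed
      qed
    qed
    fix m' assume "\<forall>f. (\<forall>n::nat. f n \<in> \<A>) \<and> (\<lambda>n. besicovitch_seminorm 2 (\<lambda>x. u x - f n x)) \<longlonglongrightarrow> 0 \<longrightarrow> (\<lambda>n. mean_value (f n)) \<longlonglongrightarrow> m'"
    moreover have "(\<lambda>n. besicovitch_seminorm 2 (\<lambda>x. u x - f n x)) \<longlonglongrightarrow> 0"
    proof (rule tendsto_sandwich[OF _ _ tendsto_const])
      show "(\<lambda>n. e n / sqrt K) \<longlonglongrightarrow> 0" using tendsto_divide[OF e0 tendsto_const[of "sqrt K"]] K(1) by simp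
      show "\<forall>\<^sub>F n in sequentially. 0 \<le> besicovitch_seminorm 2 (\<lambda>x. u x - f n x)"
        by (simp add: besicovitch_seminorm_def)
      show "\<forall>\<^sub>F n in sequentially. besicovitch_seminorm 2 (\<lambda>x. u x - f n x) \<le> e n / sqrt K"
        using seminorm_le[OF f(2)] e K(1) by (auto simp: real_sqrt_divide intro!: always_eventually) (metis abs_of_pos)
    qed
    ultimately show "m' = m" using f(1) m LIMSEQ_unique by blast
  qed
  with mu show ?thesis by simp
qed

section \<open>Mollification and boundary layers in mean square\<close>

lemma conv_diff:
  assumes "test_function UNIV \<rho>" "Lp_loc 1 UNIV u" "Lp_loc 1 UNIV v"
  shows "conv \<rho> (\<lambda>y. u y - v y) x = conv \<rho> u x - conv \<rho> v x"
  unfolding conv_def right_diff_distrib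
  by (intro Bochner_Integration.integral_diff conv_integrable assms)

lemma Lp_loc_2_conv: "mollifier \<epsilon> \<rho> \<Longrightarrow> Lp_loc 2 UNIV u \<Longrightarrow> Lp_loc 2 UNIV (conv \<rho> u)"
  by (rule smooth_Lp_loc_2[OF smooth_conv[OF mollifierD(1) Lp_loc_2_imp_1]])

lemma avg_conv_le:
  fixes f :: "real ^ 'n \<Rightarrow> real"
  assumes \<rho>: "mollifier \<epsilon> \<rho>" and f: "Lp_loc 2 UNIV f" and T: "T > 0" "2 * \<epsilon> \<le> T"
  shows "avg T (\<lambda>x. (conv \<rho> f x)\<^sup>2) \<le> 2 ^ CARD('n) * avg (2 * T) (\<lambda>x. (f x)\<^sup>2)"
proof -
  have "(LINT x|lebesgue. indicator (cube T) x * (conv \<rho> f x)\<^sup>2) \<le> (LINT y|lebesgue. indicator (cube (2 * T)) y * (f y)\<^sup>2)"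
  proof (rule conv_L2[OF \<rho> f compact_cube compact_cube])
    fix x y :: "real ^ 'n" assume "x \<in> cube T" "norm (x - y) \<le> \<epsilon>"
    then have "y \<in> cube (T + 2 * \<epsilon>)" by (rule cube_add)
    then show "y \<in> cube (2 * T)" using cube_mono[of "T + 2 * \<epsilon>" "2 * T"] T(2) by auto
  qed
  then show ?thesis
    using T by (simp add: avg_def restrict_integrable_iff set_lebesgue_integral_def power_mult_distrib divide_right_mono)
qed

lemma besicovitch_avg_bound:
  fixes u :: "real ^ 'n \<Rightarrow> real"
  assumes A: "algebra_with_mean_value \<A>" and u: "u \<in> besicovitch 2 \<A>"
  obtains C where "C > 0" "\<forall>\<^sub>F T in at_top. avg T (\<lambda>x. (u x)\<^sup>2) \<le> C"
proof -
  obtain K where K: "K > 0" "\<And>(u :: real ^ 'n \<Rightarrow> real) c. Lp_loc 2 UNIV u \<Longrightarrow> mean_sq_le u c \<Longrightarrow> \<forall>\<^sub>F T in at_top. avg T (\<lambda>x. (u x)\<^sup>2) \<le> K * c"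
    by (rule mean_sq_le_avg) blast
  obtain c where "mean_sq_le u c" using besicovitch_bound[OF u] by blast
  then have "mean_sq_le u (max c 1)" by (rule mean_sq_le_mono) simp
  then show ?thesis using u K by (intro that[of "K * max c 1"]) (auto simp: besicovitch_2_iff[OF A])
qed

lemma eventually_double:
  assumes "\<forall>\<^sub>F T in at_top. P (T :: real)" shows "\<forall>\<^sub>F T in at_top. P (2 * T)"
proof -
  have "filterlim (\<lambda>T :: real. 2 * T) at_top at_top"
    by (rule filterlim_tendsto_pos_mult_at_top[OF tendsto_const]) (auto intro: filterlim_ident)
  from eventually_compose_filterlim[OF assms this] show ?thesis .
qed

text \<open>
  A uniformly continuous \<open>v\<close> in the algebra is uniformly close to \<open>\<rho> * v\<close>, and convolution with \<open>\<rho>\<close> does not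
  increase the mean square of the remainder \<open>f = u - v\<close>, except that it enlarges the cube.
\<close>
lemma besicovitch_mollify:
  fixes u :: "real ^ 'n \<Rightarrow> real"
  assumes A: "algebra_with_mean_value \<A>" and u: "u \<in> besicovitch 2 \<A>" and \<eta>: "\<eta> > 0"
  shows "\<forall>\<^sub>F \<epsilon> in at_right 0. \<forall>\<rho>. mollifier \<epsilon> \<rho> \<longrightarrow> (\<forall>\<^sub>F T in at_top. avg T (\<lambda>x. (u x - conv \<rho> u x)\<^sup>2) \<le> \<eta>)"
proof -
  obtain K where K: "K > 0" "\<And>(u :: real ^ 'n \<Rightarrow> real) c. Lp_loc 2 UNIV u \<Longrightarrow> mean_sq_le u c \<Longrightarrow> \<forall>\<^sub>F T in at_top. avg T (\<lambda>x. (u x)\<^sup>2) \<le> K * c"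
    by (rule mean_sq_le_avg) blast
  have Lu: "Lp_loc 2 UNIV u" using u by (simp add: besicovitch_2_iff[OF A])
  \<comment> \<open>factor of the mean square of \<open>f\<close> in the final estimate; the power of \<open>2\<close> comes from passing to the cube of side \<open>2 T\<close>\<close>
  define D :: real where "D = 2 + 4 * 2 ^ CARD('n)"
  have D: "D > 0" by (simp add: D_def add_pos_pos)
  define c where "c = \<eta> / (2 * K * D)"
  have c: "c > 0" using \<eta> K D by (simp add: c_def)
  obtain v where v: "v \<in> \<A>" "mean_sq_le (\<lambda>x. u x - v x) c" by (rule besicovitch_approx[OF A u c])
  note Lv = algebra_mv_borel(3)[OF A v(1)]
  define f where "f = (\<lambda>x. u x - v x)"
  have Lf: "Lp_loc 2 UNIV f" unfolding f_def by (rule Lp_loc_2_diff[OF Lu Lv])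
  define \<omega> where "\<omega> = sqrt (\<eta> / 8)"
  have \<omega>: "\<omega> > 0" "\<omega>\<^sup>2 = \<eta> / 8" using \<eta> by (auto simp: \<omega>_def)
  obtain d where d: "d > 0" "\<And>x y. dist y x < d \<Longrightarrow> dist (v y) (v x) < \<omega>"
    using algebra_mv_D(2)[OF A v(1)] \<omega>(1) unfolding uniformly_continuous_on_def by (metis UNIV_I)
  have "\<forall>\<^sub>F \<epsilon> in at_right 0. 0 < \<epsilon> \<and> \<epsilon> < d"
    using d(1) eventually_at_right[of 0 d] by (intro eventually_conj) (auto simp: eventually_at_right_less intro!: eventually_at_rightI[of 0 d])
  then show ?thesis
  proof (eventually_elim, intro allI impI)
    fix \<epsilon> :: real and \<rho> :: "real ^ 'n \<Rightarrow> real" assume \<epsilon>: "0 < \<epsilon> \<and> \<epsilon> < d" and \<rho>: "mollifier \<epsilon> \<rho>"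
    have e1: "\<forall>\<^sub>F T in at_top. avg T (\<lambda>x. (f x)\<^sup>2) \<le> K * c" using K(2)[OF Lf] v(2) by (simp add: f_def)
    from e1 eventually_double[OF e1] eventually_gt_at_top[of 0] eventually_ge_at_top[of "2 * \<epsilon>"]
    show "\<forall>\<^sub>F T in at_top. avg T (\<lambda>x. (u x - conv \<rho> u x)\<^sup>2) \<le> \<eta>"
    proof eventually_elim
      case (elim T)
      have vc: "\<bar>v x - conv \<rho> v x\<bar> \<le> \<omega>" for x
      proof -
        have "\<bar>conv \<rho> v x - v x\<bar> \<le> \<omega>"
        proof (rule conv_close[OF \<rho> _ Lp_loc_2_imp_1[OF Lv]])
          fix y assume "norm (x - y) \<le> \<epsilon>"
          then show "\<bar>v y - v x\<bar> \<le> \<omega>" using d(2)[of y x] \<epsilon> by (simp add: dist_norm norm_minus_commute)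
        qed
        then show ?thesis by (simp add: abs_minus_commute)
      qed
      have L1: "L2_cube T (\<lambda>x. v x - conv \<rho> v x)"
        by (intro Lp_loc_2_cube Lp_loc_2_diff Lv Lp_loc_2_conv[OF \<rho>])
      have L2': "L2_cube T (\<lambda>x. - conv \<rho> f x)"
        using L2_scaleR[OF Lp_loc_2_cube[OF Lp_loc_2_conv[OF \<rho> Lf]], of T "-1"] by simp
      have Lf': "L2_cube T f" by (rule Lp_loc_2_cube[OF Lf])
      have eq: "u x - conv \<rho> u x = f x + ((v x - conv \<rho> v x) + (- conv \<rho> f x))" for x
        unfolding f_def conv_diff[OF mollifierD(1)[OF \<rho>] Lp_loc_2_imp_1[OF Lu] Lp_loc_2_imp_1[OF Lv]] by simp
      have a1: "avg T (\<lambda>x. (v x - conv \<rho> v x)\<^sup>2) \<le> \<omega>\<^sup>2"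
      proof -
        have "avg T (\<lambda>x. (v x - conv \<rho> v x)\<^sup>2) \<le> avg T (\<lambda>x :: real ^ 'n. \<omega>\<^sup>2)"
        proof (rule avg_mono)
          show "integrable (lebesgue_on (cube T)) (\<lambda>x. (v x - conv \<rho> v x)\<^sup>2)" using L2_integrable_real[OF L1] .
          show "integrable (lebesgue_on (cube T)) (\<lambda>x :: real ^ 'n. \<omega>\<^sup>2)" using L2_integrable_real[OF L2_cube_const] .
          show "(v x - conv \<rho> v x)\<^sup>2 \<le> \<omega>\<^sup>2" for x using power_mono[OF vc[of x], of 2] by simp
        qed (use elim in auto)
        then show ?thesis using elim by (simp add: avg_const)
      qed
      have a2: "avg T (\<lambda>x. (conv \<rho> f x)\<^sup>2) \<le> 2 ^ CARD('n) * (K * c)"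
        using avg_conv_le[OF \<rho> Lf elim(3,4)] elim(2) by (meson mult_left_mono order_trans zero_le_numeral zero_le_power)
      have "avg T (\<lambda>x. (u x - conv \<rho> u x)\<^sup>2) \<le> 2 * avg T (\<lambda>x. (f x)\<^sup>2) + 2 * avg T (\<lambda>x. ((v x - conv \<rho> v x) + (- conv \<rho> f x))\<^sup>2)"
        unfolding eq using avg_add_sq[OF Lf' L2_add[OF L1 L2'] elim(3)] by simp
      also have "\<dots> \<le> 2 * (K * c) + 2 * (2 * \<omega>\<^sup>2 + 2 * (2 ^ CARD('n) * (K * c)))"
        using avg_add_sq[OF L1 L2' elim(3)] a1 a2 elim(1) by (intro add_mono mult_left_mono) auto
      also have "\<dots> = D * K * c + \<eta> / 2" unfolding \<omega>(2) by (simp add: D_def algebra_simps)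
      also have "D * K * c = \<eta> / 2" using D K by (simp add: c_def)
      finally show ?case by simp
    qed
  qed
qed

text \<open>
  The bounded part \<open>v\<close> contributes at most its sup norm squared times the relative volume
  \<open>1 - r ^ d\<close> of the layer.
\<close>
lemma besicovitch_layer:
  fixes u :: "real ^ 'n \<Rightarrow> real"
  assumes A: "algebra_with_mean_value \<A>" and u: "u \<in> besicovitch 2 \<A>" and \<eta>: "\<eta> > 0"
  shows "\<forall>\<^sub>F r in at_left 1. \<forall>\<^sub>F T in at_top. avg T (\<lambda>x. indicator (- cube (r * T)) x * (u x)\<^sup>2) \<le> \<eta>"
proof -
  obtain K where K: "K > 0" "\<And>(u :: real ^ 'n \<Rightarrow> real) c. Lp_loc 2 UNIV u \<Longrightarrow> mean_sq_le u c \<Longrightarrow> \<forall>\<^sub>F T in at_top. avg T (\<lambda>x. (u x)\<^sup>2) \<le> K * c"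
    by (rule mean_sq_le_avg) blast
  have Lu: "Lp_loc 2 UNIV u" using u by (simp add: besicovitch_2_iff[OF A])
  have c: "\<eta> / (4 * K) > 0" using \<eta> K by simp
  obtain v where v: "v \<in> \<A>" "mean_sq_le (\<lambda>x. u x - v x) (\<eta> / (4 * K))" by (rule besicovitch_approx[OF A u c])
  note Lv = algebra_mv_borel(3)[OF A v(1)]
  have Lf: "Lp_loc 2 UNIV (\<lambda>x. u x - v x)" by (rule Lp_loc_2_diff[OF Lu Lv])
  obtain B where B: "B > 0" "\<And>x. \<bar>v x\<bar> \<le> B" using algebra_mv_D(1)[OF A v(1)] by blast
  have "((\<lambda>r. 2 * B\<^sup>2 * (1 - r ^ CARD('n))) \<longlongrightarrow> 2 * B\<^sup>2 * (1 - 1 ^ CARD('n))) (at_left (1::real))"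
    by (intro tendsto_intros)
  then have "\<forall>\<^sub>F r in at_left 1. 2 * B\<^sup>2 * (1 - r ^ CARD('n)) < \<eta> / 2"
    by (rule order_tendstoD(2)) (use \<eta> in simp)
  moreover have "\<forall>\<^sub>F r in at_left (1::real). 0 < r \<and> r < 1"
    by (rule eventually_at_leftI[of 0]) auto
  ultimately show ?thesis
  proof eventually_elim
    case (elim r)
    from K(2)[OF Lf v(2)] eventually_gt_at_top[of 0] show ?case
    proof eventually_elim
      case (elim T)
      let ?M = "lebesgue_on (cube T :: (real ^ 'n) set)"
      have rT: "r * T \<le> T" "0 \<le> r * T" using elim(2) \<open>0 < r \<and> r < 1\<close> by auto
      have iu: "integrable ?M (\<lambda>x. (u x)\<^sup>2)" by (rule L2_integrable_real[OF Lp_loc_2_cube[OF Lu]])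
      have if': "integrable ?M (\<lambda>x. (u x - v x)\<^sup>2)" by (rule L2_integrable_real[OF Lp_loc_2_cube[OF Lf]])
      have mi: "indicat_real (- cube (r * T)) \<in> borel_measurable ?M"
      proof (rule measurable_restrict_space1)
        have "- cube (r * T) \<in> sets lebesgue" using cube_lebesgue Compl_in_sets_lebesgue by blast
        then show "indicat_real (- cube (r * T)) \<in> borel_measurable lebesgue" by (rule borel_measurable_indicator)
      qed
      have ii: "integrable ?M (indicat_real (- cube (r * T)))"
        by (rule Bochner_Integration.integrable_bound[OF L2_integrable_real[OF L2_cube_const[of T 1]] mi]) (auto simp: indicator_def)
      have il: "integrable ?M (\<lambda>x. indicator (- cube (r * T)) x * (u x)\<^sup>2)"
      proof (rule Bochner_Integration.integrable_bound[OF iu])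
        show "(\<lambda>x. indicator (- cube (r * T)) x * (u x)\<^sup>2) \<in> borel_measurable ?M"
          using mi L2_measurable[OF Lp_loc_2_cube[OF Lu, of T]] by (intro borel_measurable_times borel_measurable_power)
      qed (auto simp: indicator_def)
      have avi: "avg T (indicat_real (- cube (r * T) :: (real ^ 'n) set)) = 1 - r ^ CARD('n)"
      proof -
        have "(LINT x|?M. indicat_real (- cube (r * T)) x) = (LINT x|lebesgue. indicat_real (cube T :: (real ^ 'n) set) x - indicat_real (cube (r * T)) x)"
        proof -
          have "(\<lambda>x. indicat_real (cube T) x *\<^sub>R indicat_real (- cube (r * T)) x) = (\<lambda>x :: real ^ 'n. indicat_real (cube T) x - indicat_real (cube (r * T)) x)"
            using cube_mono[OF rT(1), where 'a = 'n] by (intro ext) (auto simp: indicator_def)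
          then show ?thesis by (simp only: restrict_integrable_iff(2)[OF cube_lebesgue] set_lebesgue_integral_def)
        qed
        also have "\<dots> = T ^ CARD('n) - (r * T) ^ CARD('n)"
          using elim(2) rT(2) by (subst Bochner_Integration.integral_diff) (auto intro!: integrable_indicator_compact[OF compact_cube] simp: content_cube)
        finally show ?thesis using elim(2) by (simp add: avg_def diff_divide_distrib power_mult_distrib)
      qed
      have "avg T (\<lambda>x. indicator (- cube (r * T)) x * (u x)\<^sup>2) \<le> avg T (\<lambda>x. 2 * (u x - v x)\<^sup>2 + (2 * B\<^sup>2) * indicator (- cube (r * T)) x)"
      proof (rule avg_mono[OF il _ elim(2)])
        show "integrable ?M (\<lambda>x. 2 * (u x - v x)\<^sup>2 + (2 * B\<^sup>2) * indicator (- cube (r * T)) x)" using if' ii by simp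
        fix x
        have "(u x)\<^sup>2 \<le> 2 * (u x - v x)\<^sup>2 + 2 * (v x)\<^sup>2" using norm_sum_sq[of "u x - v x" "v x"] by simp
        moreover have "(v x)\<^sup>2 \<le> B\<^sup>2" using power_mono[OF B(2)[of x], of 2] by simp
        ultimately show "indicator (- cube (r * T)) x * (u x)\<^sup>2 \<le> 2 * (u x - v x)\<^sup>2 + (2 * B\<^sup>2) * indicator (- cube (r * T)) x"
          by (auto simp: indicator_def)
      qed
      also have "\<dots> = 2 * avg T (\<lambda>x. (u x - v x)\<^sup>2) + (2 * B\<^sup>2) * (1 - r ^ CARD('n))"
        using if' ii by (subst avg_add) (auto simp: avg_cmult avi)
      also have "\<dots> \<le> 2 * (K * (\<eta> / (4 * K))) + \<eta> / 2"
        using elim(1) \<open>2 * B\<^sup>2 * (1 - r ^ CARD('n)) < \<eta> / 2\<close> by (intro add_mono) auto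
      also have "\<dots> = \<eta>" using K by simp
      finally show ?case .
    qed
  qed
qed

lemma avg_vec_sq:
  fixes f :: "real ^ 'n \<Rightarrow> real ^ 'm"
  assumes "\<And>i. L2_cube T (\<lambda>x. f x $ i)"
  shows "avg T (\<lambda>x. (norm (f x))\<^sup>2) = (\<Sum>i\<in>UNIV. avg T (\<lambda>x. (f x $ i)\<^sup>2))"
  using L2_vec_integral[OF assms] by (simp add: avg_def sum_divide_distrib)

lemma avg_sq_mono:
  assumes f: "L2_cube T f" and g: "g \<in> borel_measurable (lebesgue_on (cube T))"
    and T: "T > 0" and le: "AE x in lebesgue_on (cube T). norm (g x) \<le> c * norm (f x)"
  shows "L2_cube T g" "avg T (\<lambda>x. (norm (g x))\<^sup>2) \<le> c\<^sup>2 * avg T (\<lambda>x. (norm (f x))\<^sup>2)"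
proof -
  show L: "L2_cube T g" by (rule L2_bounded[OF f g le])
  have "avg T (\<lambda>x. (norm (g x))\<^sup>2) \<le> avg T (\<lambda>x. c\<^sup>2 * (norm (f x))\<^sup>2)"
  proof (rule avg_mono_AE[OF _ _ T])
    show "AE x in lebesgue_on (cube T). (norm (g x))\<^sup>2 \<le> c\<^sup>2 * (norm (f x))\<^sup>2" using le
    proof eventually_elim
      case (elim x)
      then have "(norm (g x))\<^sup>2 \<le> (c * norm (f x))\<^sup>2" by (intro power_mono) auto
      then show ?case by (simp add: power_mult_distrib)
    qed
  qed (use L2_integrable[OF f] L2_integrable[OF L] in auto)
  then show "avg T (\<lambda>x. (norm (g x))\<^sup>2) \<le> c\<^sup>2 * avg T (\<lambda>x. (norm (f x))\<^sup>2)" by (simp add: avg_cmult)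
qed

section \<open>Almost orthogonality of balanced fluxes and gradients\<close>

text \<open>
  The last clause says \<open>div F = s\<close> in the weak sense. The scaling \<open>T * s\<close> is the one for which the
  zeroth order term of the regularized equation is controlled by its energy.
\<close>
definition balanced_flux :: "real \<Rightarrow> real \<Rightarrow> (real ^ 'n \<Rightarrow> real ^ 'n) \<Rightarrow> (real ^ 'n \<Rightarrow> real) \<Rightarrow> bool" where
  "balanced_flux C T F s \<longleftrightarrow> L2_cube T F \<and> L2_cube T s \<and>
     avg T (\<lambda>x. (norm (F x))\<^sup>2) \<le> C \<and> avg T (\<lambda>x. (T * s x)\<^sup>2) \<le> C \<and>
     (\<forall>\<phi>. test_function (interior (cube T)) \<phi> \<longrightarrow>
        avg T (\<lambda>x. F x \<bullet> grad \<phi> x) + avg T (\<lambda>x. s x * \<phi> x) = 0)"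

text \<open>
  With \<open>X = \<rho> * u\<close>, \<open>G = \<nabla>X = \<rho> * g\<close> and \<open>\<phi> = \<theta> X\<close> one has
  \<open>g = (1 - \<theta>) g + \<theta> (g - G) + (\<nabla>\<phi> - X \<nabla>\<theta>)\<close>. The field \<open>F\<close> is bounded in mean square, and the first,
  second and last parts are small in mean square: by the choice of the layer, by the choice of the
  mollifier, and by \<open>\<bar>\<nabla>\<theta>\<bar> \<le> L / T\<close>. Finally \<open>F \<bullet> \<nabla>\<phi>\<close> has the same average as
  \<open>- s \<phi> = - (T s) (\<phi> / T)\<close>, which is of order \<open>1 / T\<close>.
\<close>
lemma duality_small:
  fixes u :: "real ^ 'n \<Rightarrow> real" and g :: "real ^ 'n \<Rightarrow> real ^ 'n"
  assumes A: "algebra_with_mean_value \<A>" and wg: "weak_gradient UNIV u g"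
    and u: "u \<in> besicovitch 2 \<A>" and g: "\<And>i. (\<lambda>x. g x $ i) \<in> besicovitch 2 \<A>"
    and \<eta>: "\<eta> > 0" and C: "C > 0"
  shows "\<forall>\<^sub>F T in at_top. \<forall>F s. balanced_flux C T F s \<longrightarrow> \<bar>avg T (\<lambda>x. F x \<bullet> g x)\<bar> \<le> \<eta>"
proof -
  define \<kappa> where "\<kappa> = \<eta> / (4 * (C + 1))"
  have \<kappa>: "\<kappa> > 0" "4 * (\<kappa> * (C + 1)) = \<eta>" using \<eta> C by (auto simp: \<kappa>_def add_pos_pos) (simp add: field_simps)
  define d where "d = real CARD('n)"
  have d: "d > 0" by (simp add: d_def)
  have \<eta>': "\<kappa>\<^sup>2 / d > 0" using \<kappa> d by simp
  have Lu: "Lp_loc 2 UNIV u" and Lg: "\<And>i. Lp_loc 2 UNIV (\<lambda>x. g x $ i)"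
    using u g by (auto simp: besicovitch_2_iff[OF A])
  \<comment> \<open>\<open>r\<close> and \<open>\<epsilon>\<close> are fixed before \<open>T\<close>: only then are the constants \<open>L\<close> and \<open>C2\<close> independent of \<open>T\<close>\<close>
  have "\<forall>\<^sub>F r in at_left 1. \<forall>i. \<forall>\<^sub>F T in at_top. avg T (\<lambda>x. indicator (- cube (r * T)) x * (g x $ i)\<^sup>2) \<le> \<kappa>\<^sup>2 / d"
    by (intro eventually_all_finite besicovitch_layer[OF A g \<eta>'])
  moreover have "\<forall>\<^sub>F r in at_left (1::real). 0 < r \<and> r < 1"
    by (rule eventually_at_leftI[of 0]) auto
  ultimately have "\<forall>\<^sub>F r in at_left (1::real). (0 < r \<and> r < 1) \<and> (\<forall>i. \<forall>\<^sub>F T in at_top. avg T (\<lambda>x. indicator (- cube (r * T)) x * (g x $ i)\<^sup>2) \<le> \<kappa>\<^sup>2 / d)"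
    by eventually_elim blast
  then obtain r where r: "0 < r" "r < 1" and lay: "\<And>i. \<forall>\<^sub>F T in at_top. avg T (\<lambda>x. indicator (- cube (r * T)) x * (g x $ i)\<^sup>2) \<le> \<kappa>\<^sup>2 / d"
    by (rule exE[OF eventually_happens'[OF trivial_limit_at_left_real]]) blast
  have "\<forall>\<^sub>F \<epsilon> in at_right 0. \<forall>i. \<forall>\<rho>. mollifier \<epsilon> \<rho> \<longrightarrow> (\<forall>\<^sub>F T in at_top. avg T (\<lambda>x. (g x $ i - conv \<rho> (\<lambda>x. g x $ i) x)\<^sup>2) \<le> \<kappa>\<^sup>2 / d)"
    by (intro eventually_all_finite besicovitch_mollify[OF A g \<eta>'])
  moreover have "\<forall>\<^sub>F \<epsilon> in at_right (0::real). 0 < \<epsilon>"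
    by (rule eventually_at_right_less)
  ultimately have "\<forall>\<^sub>F \<epsilon> in at_right (0::real). 0 < \<epsilon> \<and> (\<forall>i. \<forall>\<rho>. mollifier \<epsilon> \<rho> \<longrightarrow> (\<forall>\<^sub>F T in at_top. avg T (\<lambda>x. (g x $ i - conv \<rho> (\<lambda>x. g x $ i) x)\<^sup>2) \<le> \<kappa>\<^sup>2 / d))"
    by eventually_elim blast
  then obtain \<epsilon> where \<epsilon>: "\<epsilon> > 0" and mo: "\<And>i \<rho>. mollifier \<epsilon> \<rho> \<Longrightarrow> \<forall>\<^sub>F T in at_top. avg T (\<lambda>x. (g x $ i - conv \<rho> (\<lambda>x. g x $ i) x)\<^sup>2) \<le> \<kappa>\<^sup>2 / d"
    by (rule exE[OF eventually_happens'[OF trivial_limit_at_right_real]]) blast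
  obtain \<rho> :: "real ^ 'n \<Rightarrow> real" where \<rho>: "mollifier \<epsilon> \<rho>" using mollifier_ex[OF \<epsilon>] by blast
  obtain \<theta> :: "real \<Rightarrow> real ^ 'n \<Rightarrow> real" and L where L: "L > 0"
    and th: "\<And>T. T > 0 \<Longrightarrow> test_function (interior (cube T)) (\<theta> T)" "\<And>T x. 0 \<le> \<theta> T x \<and> \<theta> T x \<le> 1"
    "\<And>T x. T > 0 \<Longrightarrow> x \<in> cube (r * T) \<Longrightarrow> \<theta> T x = 1" "\<And>T x. T > 0 \<Longrightarrow> norm (grad (\<theta> T) x) \<le> L / T"
    by (rule cutoffs[OF r], rule that; assumption)
  obtain C1 where C1: "C1 > 0" "\<forall>\<^sub>F T in at_top. avg T (\<lambda>x. (u x)\<^sup>2) \<le> C1" by (rule besicovitch_avg_bound[OF A u])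
  define C2 where "C2 = 2 ^ CARD('n) * C1"
  define X where "X = conv \<rho> u"
  define G where "G = grad X"
  note t\<rho> = mollifierD(1)[OF \<rho>]
  have sX: "smooth X" unfolding X_def by (rule smooth_conv[OF t\<rho> Lp_loc_2_imp_1[OF Lu]])
  have LX: "Lp_loc 2 UNIV X" by (rule smooth_Lp_loc_2[OF sX])
  have Gi: "G x $ i = conv \<rho> (\<lambda>x. g x $ i) x" for x i
    by (simp add: G_def grad_def X_def conv_weak_gradient[OF t\<rho> wg])
  have LG: "Lp_loc 2 UNIV (\<lambda>x. G x $ i)" for i unfolding Gi by (rule Lp_loc_2_conv[OF \<rho> Lg])
  have lim: "((\<lambda>T. c / T\<^sup>2) \<longlongrightarrow> 0) at_top" for c :: real
    by (intro tendsto_divide_0[OF tendsto_const] filterlim_at_top_imp_at_infinity filterlim_pow_at_top filterlim_ident) auto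
  have ev1: "\<forall>\<^sub>F T in at_top. \<forall>i. avg T (\<lambda>x. indicator (- cube (r * T)) x * (g x $ i)\<^sup>2) \<le> \<kappa>\<^sup>2 / d"
    by (intro eventually_all_finite lay)
  have ev2: "\<forall>\<^sub>F T in at_top. \<forall>i. avg T (\<lambda>x. (g x $ i - conv \<rho> (\<lambda>x. g x $ i) x)\<^sup>2) \<le> \<kappa>\<^sup>2 / d"
    by (intro eventually_all_finite mo \<rho>)
  have ev3: "\<forall>\<^sub>F T in at_top. (C2 / T\<^sup>2 < \<kappa>\<^sup>2) \<and> (L\<^sup>2 * C2 / T\<^sup>2 < \<kappa>\<^sup>2)"
    using \<kappa>(1) by (intro eventually_conj order_tendstoD(2)[OF lim]) auto
  from ev1 ev2 ev3 eventually_double[OF C1(2)] eventually_gt_at_top[of 0] eventually_ge_at_top[of "2 * \<epsilon>"]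
  show ?thesis
  proof (eventually_elim, intro allI impI)
    fix T :: real and F :: "real ^ 'n \<Rightarrow> real ^ 'n" and s :: "real ^ 'n \<Rightarrow> real"
    let ?M = "lebesgue_on (cube T :: (real ^ 'n) set)"
    assume e1: "\<forall>i. avg T (\<lambda>x. indicator (- cube (r * T)) x * (g x $ i)\<^sup>2) \<le> \<kappa>\<^sup>2 / d"
      and e2: "\<forall>i. avg T (\<lambda>x. (g x $ i - conv \<rho> (\<lambda>x. g x $ i) x)\<^sup>2) \<le> \<kappa>\<^sup>2 / d"
      and e3: "(C2 / T\<^sup>2 < \<kappa>\<^sup>2) \<and> (L\<^sup>2 * C2 / T\<^sup>2 < \<kappa>\<^sup>2)"
      and e4: "avg (2 * T) (\<lambda>x. (u x)\<^sup>2) \<le> C1" and T: "0 < T" and T\<epsilon>: "2 * \<epsilon> \<le> T"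
      and bf: "balanced_flux C T F s"
    have F: "L2 ?M F" and s: "L2 ?M s" and FC: "avg T (\<lambda>x. (norm (F x))\<^sup>2) \<le> C" and sC: "avg T (\<lambda>x. (T * s x)\<^sup>2) \<le> C"
      and eq: "\<forall>\<phi>. test_function (interior (cube T)) \<phi> \<longrightarrow> avg T (\<lambda>x. F x \<bullet> grad \<phi> x) + avg T (\<lambda>x. s x * \<phi> x) = 0"
      using bf by (simp_all add: balanced_flux_def)
    let ?\<theta> = "\<theta> T"
    have s\<theta>: "smooth ?\<theta>" by (rule test_functionD(1)[OF th(1)[OF T]])
    have mM: "f \<in> borel_measurable lebesgue \<Longrightarrow> f \<in> borel_measurable ?M" for f :: "real ^ 'n \<Rightarrow> real"
      by (rule measurable_restrict_space1)
    have m\<theta>[measurable]: "?\<theta> \<in> borel_measurable ?M" by (rule mM[OF smooth_measurable(2)[OF s\<theta>]])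
    have gM: "L2 ?M g" by (rule L2_vec) (rule Lp_loc_2_cube[OF Lg])
    have GM: "L2 ?M G" by (rule L2_vec) (rule Lp_loc_2_cube[OF LG])
    have XM: "L2 ?M X" by (rule Lp_loc_2_cube[OF LX])
    have gGM: "L2 ?M (\<lambda>x. g x - G x)" by (rule L2_diff[OF gM GM])
    note [measurable] = L2_measurable[OF gM] L2_measurable[OF GM] L2_measurable[OF XM] L2_measurable[OF F] L2_measurable[OF s]
    have mg\<theta>i: "(\<lambda>x. grad ?\<theta> x $ i) \<in> borel_measurable ?M" for i
      unfolding grad_def vec_lambda_beta by (rule mM[OF smooth_measurable(2)[OF smooth_partial[OF s\<theta>]]])
    have mg\<theta>[measurable]: "grad ?\<theta> \<in> borel_measurable ?M"
      by (subst borel_measurable_euclidean_space) (use mg\<theta>i in \<open>auto simp: Basis_vec_def inner_axis\<close>)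
    have aX: "avg T (\<lambda>x. (norm (X x))\<^sup>2) \<le> C2"
    proof -
      have "avg T (\<lambda>x. (norm (X x))\<^sup>2) \<le> 2 ^ CARD('n) * avg (2 * T) (\<lambda>x. (u x)\<^sup>2)"
        using avg_conv_le[OF \<rho> Lu T T\<epsilon>] by (simp add: X_def)
      also have "\<dots> \<le> C2" unfolding C2_def by (rule mult_left_mono[OF e4]) simp
      finally show ?thesis .
    qed
    define f1 where "f1 = (\<lambda>x. (1 - ?\<theta> x) *\<^sub>R g x)"
    define f2 where "f2 = (\<lambda>x. ?\<theta> x *\<^sub>R (g x - G x))"
    define f3 where "f3 = (\<lambda>x. X x *\<^sub>R grad ?\<theta> x)"
    define \<phi> where "\<phi> = (\<lambda>x. ?\<theta> x * X x)"
    have t\<phi>: "test_function (interior (cube T)) \<phi>"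
      unfolding \<phi>_def by (rule test_function_mult[OF th(1)[OF T] sX])
    have g\<phi>: "grad \<phi> x = ?\<theta> x *\<^sub>R G x + f3 x" for x
      unfolding \<phi>_def f3_def G_def by (rule grad_mult[OF s\<theta> sX])
    have f1M: "L2 ?M f1" unfolding f1_def
      by (rule L2_bounded[OF gM, of _ 1]) (use th(2)[of T] in \<open>auto simp: mult_left_le_one_le\<close>)
    have f2: "f2 \<in> borel_measurable ?M" "AE x in ?M. norm (f2 x) \<le> 1 * norm (g x - G x)"
      unfolding f2_def using th(2)[of T] by (measurable, auto simp: mult_left_le_one_le)
    note f2M = avg_sq_mono(1)[OF gGM f2(1) T f2(2)] and f2a = avg_sq_mono(2)[OF gGM f2(1) T f2(2)]
    have f3: "f3 \<in> borel_measurable ?M" "AE x in ?M. norm (f3 x) \<le> (L / T) * norm (X x)"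
      unfolding f3_def using mult_right_mono[OF th(4)[OF T] abs_ge_zero] by (measurable, auto simp: mult.commute)
    note f3M = avg_sq_mono(1)[OF XM f3(1) T f3(2)] and f3a = avg_sq_mono(2)[OF XM f3(1) T f3(2)]
    have \<phi>': "(\<lambda>x. \<phi> x / T) \<in> borel_measurable ?M" "AE x in ?M. norm (\<phi> x / T) \<le> (1 / T) * norm (X x)"
    proof -
      show "(\<lambda>x. \<phi> x / T) \<in> borel_measurable ?M" unfolding \<phi>_def by measurable
      have "\<bar>?\<theta> x * X x\<bar> \<le> \<bar>X x\<bar>" for x using th(2)[of T x] by (simp add: abs_mult mult_left_le_one_le)
      then show "AE x in ?M. norm (\<phi> x / T) \<le> (1 / T) * norm (X x)"
        using T by (auto simp: \<phi>_def divide_right_mono)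
    qed
    note \<phi>M = avg_sq_mono(1)[OF XM \<phi>'(1) T \<phi>'(2)] and \<phi>a = avg_sq_mono(2)[OF XM \<phi>'(1) T \<phi>'(2)]
    have sq: "(\<Sum>i\<in>(UNIV :: 'n set). \<kappa>\<^sup>2 / d) = \<kappa>\<^sup>2" by (simp add: d_def)
    have a1: "avg T (\<lambda>x. (norm (f1 x))\<^sup>2) \<le> \<kappa>\<^sup>2"
    proof -
      have "avg T (\<lambda>x. (norm (f1 x))\<^sup>2) = (\<Sum>i\<in>UNIV. avg T (\<lambda>x. (f1 x $ i)\<^sup>2))"
        by (rule avg_vec_sq[OF L2_component[OF f1M]])
      also have "\<dots> \<le> (\<Sum>i\<in>(UNIV :: 'n set). \<kappa>\<^sup>2 / d)"
      proof (rule sum_mono)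
        fix i
        have gi: "L2 ?M (\<lambda>x. g x $ i)" by (rule L2_component[OF gM])
        have "avg T (\<lambda>x. (f1 x $ i)\<^sup>2) \<le> avg T (\<lambda>x. indicator (- cube (r * T)) x * (g x $ i)\<^sup>2)"
        proof (rule avg_mono[OF _ _ T])
          show "integrable ?M (\<lambda>x. (f1 x $ i)\<^sup>2)" by (rule L2_integrable_real[OF L2_component[OF f1M]])
          have "- cube (r * T) \<in> sets lebesgue" using cube_lebesgue Compl_in_sets_lebesgue by blast
          then have [measurable]: "indicat_real (- cube (r * T)) \<in> borel_measurable ?M" by (intro mM borel_measurable_indicator)
          show "integrable ?M (\<lambda>x. indicator (- cube (r * T)) x * (g x $ i)\<^sup>2)"
          proof (rule Bochner_Integration.integrable_bound[OF L2_integrable_real[OF gi]])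
            show "(\<lambda>x. indicator (- cube (r * T)) x * (g x $ i)\<^sup>2) \<in> borel_measurable ?M"
              using L2_measurable[OF gi] by (intro borel_measurable_times borel_measurable_power) measurable
          qed (auto simp: indicator_def)
          fix x
          show "(f1 x $ i)\<^sup>2 \<le> indicator (- cube (r * T)) x * (g x $ i)\<^sup>2"
          proof (cases "x \<in> cube (r * T)")
            case True
            then show ?thesis using th(3)[OF T] by (simp add: f1_def)
          next
            case False
            have "(1 - ?\<theta> x)\<^sup>2 \<le> 1" using th(2)[of T x] by (simp add: power_le_one)
            then show ?thesis using False by (simp add: f1_def power_mult_distrib mult_left_le_one_le)
          qed
        qed
        then show "avg T (\<lambda>x. (f1 x $ i)\<^sup>2) \<le> \<kappa>\<^sup>2 / d" using e1 by (meson order_trans)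
      qed
      finally show ?thesis by (simp only: sq)
    qed
    have a2: "avg T (\<lambda>x. (norm (f2 x))\<^sup>2) \<le> \<kappa>\<^sup>2"
    proof -
      have "avg T (\<lambda>x. (norm (g x - G x))\<^sup>2) = (\<Sum>i\<in>UNIV. avg T (\<lambda>x. ((g x - G x) $ i)\<^sup>2))"
        by (rule avg_vec_sq[OF L2_component[OF gGM]])
      also have "\<dots> \<le> (\<Sum>i\<in>(UNIV :: 'n set). \<kappa>\<^sup>2 / d)"
        using e2 by (intro sum_mono) (simp add: Gi)
      finally show ?thesis using f2a unfolding sq by simp
    qed
    have a3: "avg T (\<lambda>x. (norm (f3 x))\<^sup>2) \<le> \<kappa>\<^sup>2"
    proof -
      have "(L / T)\<^sup>2 * avg T (\<lambda>x. (norm (X x))\<^sup>2) \<le> (L / T)\<^sup>2 * C2" using aX by (intro mult_left_mono) auto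
      then show ?thesis using f3a e3 by (simp add: power_divide)
    qed
    have a4: "avg T (\<lambda>x. (norm (\<phi> x / T))\<^sup>2) \<le> \<kappa>\<^sup>2"
    proof -
      have "(1 / T)\<^sup>2 * avg T (\<lambda>x. (norm (X x))\<^sup>2) \<le> (1 / T)\<^sup>2 * C2" using aX by (intro mult_left_mono) auto
      then show ?thesis using \<phi>a e3 by (simp add: power_divide)
    qed
    have b1: "\<bar>avg T (\<lambda>x. F x \<bullet> f1 x)\<bar> \<le> \<kappa> * (C + 1)" by (rule avg_inner_small[OF F f1M T \<kappa>(1) FC a1])
    have b2: "\<bar>avg T (\<lambda>x. F x \<bullet> f2 x)\<bar> \<le> \<kappa> * (C + 1)" by (rule avg_inner_small[OF F f2M T \<kappa>(1) FC a2])
    have b3: "\<bar>avg T (\<lambda>x. F x \<bullet> f3 x)\<bar> \<le> \<kappa> * (C + 1)" by (rule avg_inner_small[OF F f3M T \<kappa>(1) FC a3])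
    have Ts: "L2 ?M (\<lambda>x. T * s x)" using L2_scaleR[OF s, of T] by simp
    have "\<bar>avg T (\<lambda>x. (T * s x) \<bullet> (\<phi> x / T))\<bar> \<le> \<kappa> * (C + 1)"
      by (rule avg_inner_small[OF Ts \<phi>M T \<kappa>(1) _ a4]) (use sC in simp)
    then have b4: "\<bar>avg T (\<lambda>x. s x * \<phi> x)\<bar> \<le> \<kappa> * (C + 1)" using T by simp
    have e: "avg T (\<lambda>x. F x \<bullet> grad \<phi> x) = - avg T (\<lambda>x. s x * \<phi> x)" using eq t\<phi> by (simp add: eq_neg_iff_add_eq_0)
    have g\<phi>M: "L2 ?M (grad \<phi>)"
    proof -
      have "L2 ?M (\<lambda>x. ?\<theta> x *\<^sub>R G x)"
        by (rule L2_bounded[OF GM, of _ 1]) (use th(2)[of T] in \<open>auto simp: mult_left_le_one_le\<close>)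
      from L2_add[OF this f3M] show ?thesis unfolding g\<phi>[symmetric] .
    qed
    have "avg T (\<lambda>x. F x \<bullet> g x) = avg T (\<lambda>x. (F x \<bullet> f1 x + F x \<bullet> f2 x) + (F x \<bullet> grad \<phi> x - F x \<bullet> f3 x))"
      unfolding g\<phi> by (simp add: f1_def f2_def inner_add_right inner_diff_right algebra_simps)
    also have "\<dots> = avg T (\<lambda>x. F x \<bullet> f1 x) + avg T (\<lambda>x. F x \<bullet> f2 x) + (avg T (\<lambda>x. F x \<bullet> grad \<phi> x) - avg T (\<lambda>x. F x \<bullet> f3 x))"
      by (simp add: avg_add avg_diff L2_Young(1) F f1M f2M f3M g\<phi>M)
    finally show "\<bar>avg T (\<lambda>x. F x \<bullet> g x)\<bar> \<le> \<eta>"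
      using b1 b2 b3 b4 e \<kappa>(2) by linarith
  qed
qed

section \<open>Fluxes and the energy space on a cube\<close>

lemma borel_measurable_vec_component:
  fixes f :: "'a \<Rightarrow> 'b::euclidean_space ^ 'n"
  assumes "f \<in> borel_measurable M" shows "(\<lambda>x. f x $ i) \<in> borel_measurable M"
  by (rule measurable_compose[OF assms borel_measurable_continuous_onI])
    (intro continuous_intros)

lemma measurable_vecI:
  fixes f :: "'a \<Rightarrow> real ^ 'n"
  assumes "\<And>i. (\<lambda>x. f x $ i) \<in> borel_measurable M" shows "f \<in> borel_measurable M"
  by (subst borel_measurable_euclidean_space) (use assms in \<open>auto simp: Basis_vec_def inner_axis\<close>)

lemma measurable_matrix_vector_mult:
  fixes A :: "'a \<Rightarrow> real ^ 'n ^ 'm" and f :: "'a \<Rightarrow> real ^ 'n"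
  assumes "A \<in> borel_measurable M" "f \<in> borel_measurable M"
  shows "(\<lambda>x. A x *v f x) \<in> borel_measurable M"
  by (rule measurable_vecI)
    (auto simp: matrix_vector_mult_def intro!: borel_measurable_sum borel_measurable_times borel_measurable_vec_component assms)

lemma norm_matrix_vector_le:
  fixes A :: "real ^ 'n ^ 'm"
  shows "norm (A *v x) \<le> norm A * norm x"
proof (rule power2_le_imp_le)
  have "(norm (A *v x))\<^sup>2 = (\<Sum>i\<in>UNIV. (A $ i \<bullet> x)\<^sup>2)"
    unfolding norm_vec_sq by (simp add: matrix_vector_mul_component)
  also have "\<dots> \<le> (\<Sum>i\<in>UNIV. (norm (A $ i))\<^sup>2 * (norm x)\<^sup>2)"
  proof (rule sum_mono)
    fix i
    have "\<bar>A $ i \<bullet> x\<bar>\<^sup>2 \<le> (norm (A $ i) * norm x)\<^sup>2" by (intro power_mono Cauchy_Schwarz_ineq2) auto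
    then show "(A $ i \<bullet> x)\<^sup>2 \<le> (norm (A $ i))\<^sup>2 * (norm x)\<^sup>2" by (simp add: power_mult_distrib)
  qed
  also have "\<dots> = (norm A * norm x)\<^sup>2"
    by (simp add: sum_distrib_right[symmetric] power_mult_distrib norm_vec_def L2_set_def sum_nonneg)
  finally show "(norm (A *v x))\<^sup>2 \<le> (norm A * norm x)\<^sup>2" .
qed simp

lemma matrix_mult_column:
  fixes A :: "real ^ 'n ^ 'n"
  shows "(A ** (mat 1 + column_matrix G y)) $ k $ j = (A *v (axis j 1 + G j y)) $ k"
  by (simp add: matrix_matrix_mult_def matrix_vector_mult_def column_matrix_def mat_def axis_def eq_commute)

text \<open>
  The Sobolev space lives on the open cube, the integrals on the closed one. On the boundary the
  function is arbitrary, but the boundary is a null set and Lebesgue measure is complete.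
\<close>
lemma measurable_cube_interior:
  fixes f :: "real ^ 'n \<Rightarrow> 'b::euclidean_space"
  assumes "set_borel_measurable lebesgue (interior (cube T)) f"
  shows "f \<in> borel_measurable (lebesgue_on (cube T))"
proof -
  let ?N = "cube T - interior (cube T) :: (real ^ 'n) set"
  have N: "?N \<in> null_sets lebesgue"
  proof -
    have "negligible (frontier (cube T :: (real ^ 'n) set))"
      unfolding cube_def by (rule negligible_convex_frontier) simp
    then have "negligible ?N" by (rule negligible_subset) (auto simp: frontier_def closure_subset[THEN subsetD])
    then show ?thesis by (simp add: negligible_iff_null_sets)
  qed
  have sub: "S \<in> sets lebesgue" if "S \<subseteq> ?N" for S
    using N that null_sets_completion_subset[of S ?N] by (auto simp: null_sets_def)
  have m: "(\<lambda>x. indicator ?N x *\<^sub>R f x) \<in> borel_measurable lebesgue"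
  proof (rule measurableI)
    fix B :: "'b set" assume "B \<in> sets borel"
    show "(\<lambda>x. indicator ?N x *\<^sub>R f x) -` B \<inter> space lebesgue \<in> sets lebesgue"
    proof (cases "0 \<in> B")
      case True
      then have "(\<lambda>x. indicator ?N x *\<^sub>R f x) -` B \<inter> space lebesgue = (- ?N) \<union> (?N \<inter> f -` B)"
        by (auto simp: indicator_def)
      moreover have "?N \<inter> f -` B \<in> sets lebesgue" by (rule sub) auto
      moreover have "- ?N \<in> sets lebesgue" using N Compl_in_sets_lebesgue by blast
      ultimately show ?thesis by auto
    next
      case False
      then have "(\<lambda>x. indicator ?N x *\<^sub>R f x) -` B \<inter> space lebesgue = ?N \<inter> f -` B"
      proof (intro set_eqI)
        fix x
        show "x \<in> (\<lambda>x. indicator ?N x *\<^sub>R f x) -` B \<inter> space lebesgue \<longleftrightarrow> x \<in> ?N \<inter> f -` B"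
          using False by (cases "x \<in> ?N") (auto simp: indicator_def)
      qed
      then show ?thesis using sub[of "?N \<inter> f -` B"] by auto
    qed
  qed simp
  have "(\<lambda>x. indicator (interior (cube T)) x *\<^sub>R f x + indicator ?N x *\<^sub>R f x) \<in> borel_measurable lebesgue"
    using assms m unfolding set_borel_measurable_def by (rule borel_measurable_add)
  moreover have "(\<lambda>x. indicator (interior (cube T)) x *\<^sub>R f x + indicator ?N x *\<^sub>R f x) = (\<lambda>x. indicator (cube T) x *\<^sub>R f x)"
    using interior_subset[of "cube T :: (real ^ 'n) set"] by (intro ext) (auto simp: indicator_def)
  ultimately show ?thesis by (simp add: borel_measurable_restrict_space_iff)
qed

lemma AE_interior_cube: "AE x in lebesgue_on (cube T). x \<in> interior (cube T :: (real ^ 'n) set)"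
proof -
  have "negligible (frontier (cube T :: (real ^ 'n) set))"
    unfolding cube_def by (rule negligible_convex_frontier) simp
  then have "AE x in lebesgue. x \<notin> frontier (cube T :: (real ^ 'n) set)"
    by (simp add: negligible_iff_null_sets AE_not_in)
  then have "AE x in lebesgue. x \<in> cube T \<longrightarrow> x \<in> interior (cube T :: (real ^ 'n) set)"
    by eventually_elim (use closure_subset in \<open>auto simp: frontier_def\<close>)
  then show ?thesis by (simp add: AE_restrict_space_iff)
qed

lemma interior_cube_integral:
  fixes f :: "real ^ 'n \<Rightarrow> real"
  assumes f: "f \<in> borel_measurable (lebesgue_on (cube T))"
  shows "(LINT x:interior (cube T)|lebesgue. f x) = (LINT x|lebesgue_on (cube T). f x)"
    and "set_integrable lebesgue (interior (cube T)) f \<Longrightarrow> integrable (lebesgue_on (cube T)) f"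
proof -
  let ?g = "\<lambda>x. indicator (interior (cube T)) x * f x"
  have eq: "indicator (cube T) x * ?g x = indicator (interior (cube T)) x * f x" for x
    using interior_subset[of "cube T :: (real ^ 'n) set"] by (auto simp: indicator_def)
  have i[measurable]: "indicat_real (interior (cube T) :: (real ^ 'n) set) \<in> borel_measurable (lebesgue_on (cube T))"
    by (rule measurable_restrict_space1) (auto intro!: borel_measurable_indicator)
  have g: "?g \<in> borel_measurable (lebesgue_on (cube T))"
    using i f by (rule borel_measurable_times)
  have ae: "AE x in lebesgue_on (cube T). ?g x = f x"
    using AE_interior_cube[of T] by eventually_elim simp
  have "(LINT x:interior (cube T)|lebesgue. f x) = (LINT x|lebesgue_on (cube T). ?g x)"
    by (simp add: restrict_integrable_iff(2) set_lebesgue_integral_def eq del: indicator_simps)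
  also have "\<dots> = (LINT x|lebesgue_on (cube T). f x)" by (rule integral_cong_AE[OF g f ae])
  finally show "(LINT x:interior (cube T)|lebesgue. f x) = (LINT x|lebesgue_on (cube T). f x)" .
  assume "set_integrable lebesgue (interior (cube T)) f"
  then have "integrable (lebesgue_on (cube T)) ?g"
    by (simp add: restrict_integrable_iff(1) set_integrable_def eq del: indicator_simps)
  then show "integrable (lebesgue_on (cube T)) f" by (subst (asm) integrable_cong_AE[OF g f ae])
qed

lemma Lp_on_2_interior_cube:
  fixes f :: "real ^ 'n \<Rightarrow> 'b::euclidean_space"
  assumes "Lp_on 2 (interior (cube T)) f"
  shows "L2_cube T f"
proof -
  have m: "f \<in> borel_measurable (lebesgue_on (cube T))"
    using assms measurable_cube_interior unfolding Lp_on_def by blast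
  have "(\<lambda>x. norm (f x) powr 2) = (\<lambda>x. (norm (f x))\<^sup>2)" by (rule ext) (case_tac "f x = 0"; simp)
  then have "set_integrable lebesgue (interior (cube T)) (\<lambda>x. (norm (f x))\<^sup>2)" using assms unfolding Lp_on_def by simp
  then show ?thesis unfolding L2_def using m by (intro conjI m interior_cube_integral(2)) measurable
qed

lemma L2_test_function:
  assumes "test_function U \<phi>"
  shows "L2_cube T \<phi>" "L2_cube T (grad \<phi>)"
proof -
  show "L2_cube T \<phi>" by (rule Lp_loc_2_cube[OF smooth_Lp_loc_2[OF test_functionD(1)[OF assms]]])
  show "L2_cube T (grad \<phi>)"
    by (rule L2_vec) (simp add: grad_def Lp_loc_2_cube[OF smooth_Lp_loc_2[OF test_functionD(1)[OF test_functionD(6)[OF assms]]]])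
qed

lemma avg_inner_tendsto_0:
  assumes F: "L2_cube T F" and h: "\<And>n. L2_cube T (h n)" and T: "T > 0"
    and 0: "(\<lambda>n. avg T (\<lambda>x. (norm (h n x))\<^sup>2)) \<longlonglongrightarrow> 0"
  shows "(\<lambda>n. avg T (\<lambda>x. F x \<bullet> h n x)) \<longlonglongrightarrow> 0"
proof (rule tendstoI)
  fix e :: real assume e: "e > 0"
  define C where "C = avg T (\<lambda>x. (norm (F x))\<^sup>2)"
  have C: "C \<ge> 0" unfolding C_def by (rule avg_nonneg[OF T]) simp
  define \<eta> where "\<eta> = e / (2 * (C + 1))"
  have "C + 1 > 0" using C by simp
  then have "\<eta> > 0" using e by (simp add: \<eta>_def)
  moreover have "\<eta> * (C + 1) = e / 2" using \<open>C + 1 > 0\<close> unfolding \<eta>_def by (simp add: field_simps)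
  ultimately have \<eta>: "\<eta> > 0" "\<eta> * (C + 1) < e" using e by simp_all
  have "\<forall>\<^sub>F n in sequentially. avg T (\<lambda>x. (norm (h n x))\<^sup>2) < \<eta>\<^sup>2"
    by (rule order_tendstoD(2)[OF 0]) (use \<eta> in simp)
  then show "\<forall>\<^sub>F n in sequentially. dist (avg T (\<lambda>x. F x \<bullet> h n x)) 0 < e"
  proof eventually_elim
    case (elim n)
    have "\<bar>avg T (\<lambda>x. F x \<bullet> h n x)\<bar> \<le> \<eta> * (C + 1)"
      by (rule avg_inner_small[OF F h T \<eta>(1)]) (use elim in \<open>auto simp: C_def\<close>)
    then show ?case using \<eta>(2) by simp
  qed
qed

text \<open>
  A weak identity for test functions extends to the energy space by density.
\<close>
lemma H1_0_test:
  fixes F :: "real ^ 'n \<Rightarrow> real ^ 'n"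
  assumes v: "H1_0 (interior (cube T)) v Dv" and T: "T > 0"
    and F: "L2_cube T F" and s: "L2_cube T s"
    and eq: "\<And>\<phi>. test_function (interior (cube T)) \<phi> \<Longrightarrow> avg T (\<lambda>x. F x \<bullet> grad \<phi> x) + avg T (\<lambda>x. s x * \<phi> x) = 0"
  shows "avg T (\<lambda>x. F x \<bullet> Dv x) + avg T (\<lambda>x. s x * v x) = 0"
proof -
  let ?M = "lebesgue_on (cube T :: (real ^ 'n) set)"
  have vM: "L2 ?M v" and DvM: "L2 ?M Dv"
    using v by (auto simp: H1_0_def H1_def intro: Lp_on_2_interior_cube)
  obtain \<phi> where t: "\<And>n::nat. test_function (interior (cube T)) (\<phi> n)"
    and l1: "(\<lambda>n. LINT x:interior (cube T)|lebesgue. (v x - \<phi> n x)\<^sup>2) \<longlonglongrightarrow> 0"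
    and l2: "(\<lambda>n. LINT x:interior (cube T)|lebesgue. (norm (Dv x - grad (\<phi> n) x))\<^sup>2) \<longlonglongrightarrow> 0"
    using v by (auto simp: H1_0_def)
  have d1: "L2 ?M (\<lambda>x. v x - \<phi> n x)" for n by (intro L2_diff vM L2_test_function[OF t])
  have d2: "L2 ?M (\<lambda>x. Dv x - grad (\<phi> n) x)" for n by (intro L2_diff DvM L2_test_function[OF t])
  have c1: "(\<lambda>n. avg T (\<lambda>x. (norm (v x - \<phi> n x))\<^sup>2)) \<longlonglongrightarrow> 0"
    using tendsto_divide[OF l1 tendsto_const[of "T ^ CARD('n)"]] T L2_integrable_real[OF d1]
    by (simp add: avg_def interior_cube_integral(1) borel_measurable_integrable)
  have c2: "(\<lambda>n. avg T (\<lambda>x. (norm (Dv x - grad (\<phi> n) x))\<^sup>2)) \<longlonglongrightarrow> 0"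
    using tendsto_divide[OF l2 tendsto_const[of "T ^ CARD('n)"]] T L2_integrable[OF d2]
    by (simp add: avg_def interior_cube_integral(1) borel_measurable_integrable)
  have e: "avg T (\<lambda>x. F x \<bullet> (Dv x - grad (\<phi> n) x)) + avg T (\<lambda>x. s x \<bullet> (v x - \<phi> n x)) = avg T (\<lambda>x. F x \<bullet> Dv x) + avg T (\<lambda>x. s x * v x)" for n
  proof -
    have "integrable ?M (\<lambda>x. s x * v x)" "integrable ?M (\<lambda>x. s x * \<phi> n x)"
      using L2_Young(1)[OF s vM] L2_Young(1)[OF s L2_test_function(1)[OF t]] by auto
    then have "avg T (\<lambda>x. F x \<bullet> (Dv x - grad (\<phi> n) x)) + avg T (\<lambda>x. s x \<bullet> (v x - \<phi> n x)) =
       (avg T (\<lambda>x. F x \<bullet> Dv x) - avg T (\<lambda>x. F x \<bullet> grad (\<phi> n) x)) + (avg T (\<lambda>x. s x * v x) - avg T (\<lambda>x. s x * \<phi> n x))"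
      unfolding inner_diff_right
      by (subst (1 2) avg_diff) (auto intro!: L2_Young(1) F DvM L2_test_function[OF t])
    then show ?thesis using eq[OF t, of n] by simp
  qed
  have "(\<lambda>n. avg T (\<lambda>x. F x \<bullet> (Dv x - grad (\<phi> n) x)) + avg T (\<lambda>x. s x \<bullet> (v x - \<phi> n x))) \<longlonglongrightarrow> 0 + 0"
    by (intro tendsto_add avg_inner_tendsto_0 F s d1 d2 T c1 c2)
  then show ?thesis unfolding e by (simp add: LIMSEQ_const_iff)
qed

definition flux :: "(real ^ 'n \<Rightarrow> real ^ 'n ^ 'n) \<Rightarrow> ('n \<Rightarrow> real ^ 'n \<Rightarrow> real ^ 'n) \<Rightarrow> 'n \<Rightarrow> real ^ 'n \<Rightarrow> real ^ 'n" where
  "flux A G j y = A y *v (axis j 1 + G j y)"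

lemma flux_L2:
  fixes A :: "real ^ 'n \<Rightarrow> real ^ 'n ^ 'n"
  assumes A: "A \<in> borel_measurable lebesgue" "AE y in lebesgue. norm (A y) \<le> c"
    and G: "L2_cube T (G j)" and T: "T > 0"
  shows "L2_cube T (flux A G j)"
    "avg T (\<lambda>x. (norm (flux A G j x))\<^sup>2) \<le> c\<^sup>2 * (2 + 2 * avg T (\<lambda>x. (norm (G j x))\<^sup>2))"
    "L2_cube T (\<lambda>x. axis j 1 + G j x)"
proof -
  let ?M = "lebesgue_on (cube T)"
  have c: "L2 ?M (\<lambda>x. axis j (1::real) :: real ^ 'n)" by (rule L2_cube_const)
  show 1: "L2 ?M (\<lambda>x. axis j 1 + G j x)" by (rule L2_add[OF c G])
  have m: "flux A G j \<in> borel_measurable ?M" unfolding flux_def[abs_def]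
    by (intro measurable_matrix_vector_mult measurable_restrict_space1[OF A(1)] L2_measurable[OF 1])
  have ae: "AE x in ?M. norm (flux A G j x) \<le> c * norm (axis j 1 + G j x)"
  proof -
    have "AE x in ?M. norm (A x) \<le> c" using A(2) by (auto simp: AE_restrict_space_iff)
    then show ?thesis
    proof eventually_elim
      case (elim x)
      have "norm (flux A G j x) \<le> norm (A x) * norm (axis j 1 + G j x)" unfolding flux_def by (rule norm_matrix_vector_le)
      also have "\<dots> \<le> c * norm (axis j 1 + G j x)" using elim by (rule mult_right_mono) simp
      finally show ?case .
    qed
  qed
  show "L2 ?M (flux A G j)" by (rule avg_sq_mono(1)[OF 1 m T ae])
  have "avg T (\<lambda>x. (norm (flux A G j x))\<^sup>2) \<le> c\<^sup>2 * avg T (\<lambda>x. (norm (axis j 1 + G j x))\<^sup>2)"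
    by (rule avg_sq_mono(2)[OF 1 m T ae])
  also have "\<dots> \<le> c\<^sup>2 * (2 * avg T (\<lambda>x :: real ^ 'n. (norm (axis j (1::real) :: real ^ 'n))\<^sup>2) + 2 * avg T (\<lambda>x. (norm (G j x))\<^sup>2))"
    by (rule mult_left_mono[OF avg_add_sq[OF c G T]]) simp
  finally show "avg T (\<lambda>x. (norm (flux A G j x))\<^sup>2) \<le> c\<^sup>2 * (2 + 2 * avg T (\<lambda>x. (norm (G j x))\<^sup>2))"
    using T by (simp add: avg_const)
qed

text \<open>
  Both sides are the average of \<open>A (e\<^sub>j + G\<^sub>j) \<bullet> (e\<^sub>k + H\<^sub>k)\<close>.
\<close>
lemma flux_symmetric:
  assumes A: "A \<in> borel_measurable lebesgue" "AE y in lebesgue. norm (A y) \<le> c" "AE y in lebesgue. transpose (A y) = A y"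
    and G: "L2_cube T (G j)" and H: "L2_cube T (H k)" and T: "T > 0"
  shows "avg T (\<lambda>y. flux A G j y $ k) + avg T (\<lambda>y. flux A G j y \<bullet> H k y)
    = avg T (\<lambda>y. flux A H k y $ j) + avg T (\<lambda>y. flux A H k y \<bullet> G j y)"
proof -
  let ?M = "lebesgue_on (cube T)"
  note fG = flux_L2(1)[where G = G and j = j, OF A(1,2) G T] and fH = flux_L2(1)[where G = H and j = k, OF A(1,2) H T]
  have int: "integrable ?M (\<lambda>y. f y $ i)" if "L2 ?M f" for f :: "real ^ 'a \<Rightarrow> real ^ 'a" and i
    using L2_Young(1)[OF L2_cube_const[of T "1::real"] L2_component[OF that, of i]] by simp
  have sum: "avg T (\<lambda>y. f y $ i) + avg T (\<lambda>y. f y \<bullet> g y) = avg T (\<lambda>y. f y \<bullet> (axis i 1 + g y))"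
    if "L2 ?M f" "L2 ?M g" for f g :: "real ^ 'a \<Rightarrow> real ^ 'a" and i
    using avg_add[OF int[OF that(1), of i] L2_Young(1)[OF that]] by (simp add: inner_add_right inner_axis)
  have AE: "AE x in ?M. flux A G j x \<bullet> (axis k 1 + H k x) = flux A H k x \<bullet> (axis j 1 + G j x)"
  proof -
    have "AE x in ?M. transpose (A x) = A x" using A(3) by (auto simp: AE_restrict_space_iff)
    then show ?thesis
    proof eventually_elim
      case (elim x)
      have "flux A G j x \<bullet> (axis k 1 + H k x) = (axis j 1 + G j x) \<bullet> (transpose (A x) *v (axis k 1 + H k x))"
        unfolding flux_def by (metis dot_lmul_matrix inner_commute transpose_matrix_vector transpose_transpose)
      then show ?case by (simp add: elim flux_def inner_commute)
    qed
  qed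
  have "avg T (\<lambda>x. flux A G j x \<bullet> (axis k 1 + H k x)) = avg T (\<lambda>x. flux A H k x \<bullet> (axis j 1 + G j x))"
    unfolding avg_def
    by (intro arg_cong2[of _ _ _ _ "(/)"] refl integral_cong_AE AE borel_measurable_integrable L2_Young(1) fG fH
        flux_L2(3)[where G = G and j = j, OF A(1,2) G T] flux_L2(3)[where G = H and j = k, OF A(1,2) H T])
  then show ?thesis by (simp only: sum[OF fG H] sum[OF fH G])
qed

section \<open>The homogenized matrix\<close>

lemma corrector_D:
  assumes A: "algebra_with_mean_value \<A>" and c: "corrector \<A> A X DX"
  shows "weak_gradient UNIV (X j) (DX j)" "(\<lambda>y. DX j y $ i) \<in> besicovitch 2 \<A>"
    "L2_cube T (DX j)"
    "test_function UNIV \<phi> \<Longrightarrow> (LINT y|lebesgue. flux A DX j y \<bullet> grad \<phi> y) = 0"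
proof -
  show "weak_gradient UNIV (X j) (DX j)" using c by (auto simp: corrector_def H1_loc_def)
  show b: "(\<lambda>y. DX j y $ i) \<in> besicovitch 2 \<A>" for i using c by (auto simp: corrector_def)
  show "L2_cube T (DX j)"
    by (rule L2_vec) (use b in \<open>auto simp: besicovitch_2_iff[OF A] intro: Lp_loc_2_cube\<close>)
  show "test_function UNIV \<phi> \<Longrightarrow> (LINT y|lebesgue. flux A DX j y \<bullet> grad \<phi> y) = 0"
    using c by (auto simp: corrector_def flux_def)
qed

lemma corrector_cube:
  assumes A: "algebra_with_mean_value \<A>" and c: "corrector \<A> A X DX" and t: "test_function (interior (cube T)) \<phi>"
  shows "avg T (\<lambda>y. flux A DX j y \<bullet> grad \<phi> y) = 0"
proof -
  have "test_function UNIV \<phi>" by (rule test_function_mono[OF t]) simp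
  from corrector_D(4)[OF A c this, of j]
  have 0: "(LINT y|lebesgue. flux A DX j y \<bullet> grad \<phi> y) = 0" .
  have "grad \<phi> y = 0" if "y \<notin> cube T" for y
    using test_functionD(5)[OF t, of y] that interior_subset by blast
  then have "(\<lambda>y. indicator (cube T) y *\<^sub>R (flux A DX j y \<bullet> grad \<phi> y)) = (\<lambda>y. flux A DX j y \<bullet> grad \<phi> y)"
    by (intro ext) (auto simp: indicator_def)
  then show ?thesis
    using 0 unfolding avg_def restrict_integrable_iff(2)[OF cube_lebesgue] set_lebesgue_integral_def by simp
qed

text \<open>
  The flux is a sum of products of bounded and general elements of the Besicovitch space, hence
  belongs to it.
\<close>
lemma corrector_flux_mean:
  fixes A :: "real ^ 'n \<Rightarrow> real ^ 'n ^ 'n"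
  assumes A: "algebra_with_mean_value \<A>" and c: "corrector \<A> A X DX"
    and Ab: "\<And>i j. (\<lambda>y. A y $ i $ j) \<in> besicovitch 2 \<A>" and Ac: "AE y in lebesgue. norm (A y) \<le> c0"
  shows "((\<lambda>T. avg T (\<lambda>y. flux A DX j y $ k)) \<longlongrightarrow> homogenized_matrix \<A> A DX $ k $ j) at_top"
proof -
  have bd: "AE y in lebesgue. \<bar>A y $ k $ l\<bar> \<le> c0" for l
    using Ac by eventually_elim (rule order_trans[OF component_le_norm_cart order_trans[OF Finite_Cartesian_Product.norm_nth_le]])
  have e: "(\<lambda>y. axis j 1 $ l + DX j y $ l) \<in> besicovitch 2 \<A>" for l
    by (rule besicovitch_add[OF A besicovitch_const[OF A] corrector_D(2)[OF A c]])
  have "(\<lambda>y. \<Sum>l\<in>UNIV. A y $ k $ l * (axis j 1 $ l + DX j y $ l)) \<in> besicovitch 2 \<A>"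
    by (intro besicovitch_sum[OF A] besicovitch_mult_bounded[OF A Ab bd e]) simp
  then have b: "(\<lambda>y. flux A DX j y $ k) \<in> besicovitch 2 \<A>"
    by (simp add: flux_def matrix_vector_mult_def)
  have "homogenized_matrix \<A> A DX $ k $ j = besicovitch_mean 2 \<A> (\<lambda>y. flux A DX j y $ k)"
    by (simp add: homogenized_matrix_def matrix_mult_column flux_def)
  with avg_besicovitch_mean[OF A b] show ?thesis by simp
qed

lemma vec_avg_bound:
  fixes g :: "real ^ 'n \<Rightarrow> real ^ 'n"
  assumes A: "algebra_with_mean_value \<A>" and g: "\<And>i. (\<lambda>x. g x $ i) \<in> besicovitch 2 \<A>"
  obtains C where "\<forall>\<^sub>F T in at_top. avg T (\<lambda>x. (norm (g x))\<^sup>2) \<le> C"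
proof -
  have "\<exists>C. \<forall>\<^sub>F T in at_top. avg T (\<lambda>x. (g x $ i)\<^sup>2) \<le> C" for i
    using besicovitch_avg_bound[OF A g[of i]] by metis
  then obtain C where C: "\<And>i. \<forall>\<^sub>F T in at_top. avg T (\<lambda>x. (g x $ i)\<^sup>2) \<le> C i" by metis
  have L: "L2_cube T (\<lambda>x. g x $ i)" for T i
    using g by (auto simp: besicovitch_2_iff[OF A] intro: Lp_loc_2_cube)
  have "\<forall>\<^sub>F T in at_top. \<forall>i. avg T (\<lambda>x. (g x $ i)\<^sup>2) \<le> C i" by (intro eventually_all_finite C)
  then have "\<forall>\<^sub>F T in at_top. avg T (\<lambda>x. (norm (g x))\<^sup>2) \<le> (\<Sum>i\<in>UNIV. C i)"
    by eventually_elim (auto simp: avg_vec_sq[OF L] intro: sum_mono)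
  then show ?thesis by (rule that)
qed

text \<open>
  A corrector flux is divergence free, hence balanced with \<open>s = 0\<close>. The two correctors may belong to
  different algebras: approximation by an algebra enters only through the gradient, and what is
  needed of the flux is a bounded mean square.
\<close>
lemma corrector_pair:
  fixes A :: "real ^ 'n \<Rightarrow> real ^ 'n ^ 'n"
  assumes Am: "A \<in> borel_measurable lebesgue" "AE y in lebesgue. norm (A y) \<le> c0"
    and A: "algebra_with_mean_value \<A>" and c: "corrector \<A> A X DX" and X: "\<And>j. X j \<in> besicovitch 2 \<A>"
    and A': "algebra_with_mean_value \<A>'" and c': "corrector \<A>' A X' DX'"
  shows "((\<lambda>T. avg T (\<lambda>y. flux A DX' j y \<bullet> DX k y)) \<longlongrightarrow> 0) at_top"
proof (rule tendstoI)
  fix e :: real assume e: "e > 0"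
  obtain C1 where C1: "\<forall>\<^sub>F T in at_top. avg T (\<lambda>x. (norm (DX' j x))\<^sup>2) \<le> C1"
    by (rule vec_avg_bound[OF A' corrector_D(2)[OF A' c']])
  define C where "C = c0\<^sup>2 * (2 + 2 * \<bar>C1\<bar>) + 1"
  have C: "C > 0" unfolding C_def by (intro add_nonneg_pos mult_nonneg_nonneg) auto
  have e2: "e / 2 > 0" using e by simp
  from duality_small[OF A corrector_D(1)[OF A c, of k] X corrector_D(2)[OF A c] e2 C] C1 eventually_gt_at_top[of 0]
  show "\<forall>\<^sub>F T in at_top. dist (avg T (\<lambda>y. flux A DX' j y \<bullet> DX k y)) 0 < e"
  proof eventually_elim
    case (elim T)
    note f = flux_L2[where G = DX' and j = j, OF Am corrector_D(3)[OF A' c'] elim(3)]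
    have "avg T (\<lambda>x. (norm (flux A DX' j x))\<^sup>2) \<le> c0\<^sup>2 * (2 + 2 * avg T (\<lambda>x. (norm (DX' j x))\<^sup>2))" by (rule f(2))
    also have "\<dots> \<le> C"
    proof -
      have "c0\<^sup>2 * (2 + 2 * avg T (\<lambda>x. (norm (DX' j x))\<^sup>2)) \<le> c0\<^sup>2 * (2 + 2 * \<bar>C1\<bar>)"
        using elim(2) by (intro mult_left_mono) auto
      then show ?thesis by (simp add: C_def)
    qed
    finally have "balanced_flux C T (flux A DX' j) (\<lambda>x. 0)"
      using f(1) L2_cube_const[of T "0::real"] corrector_cube[OF A' c'] C elim(3)
      by (simp add: balanced_flux_def avg_const)
    then have "\<bar>avg T (\<lambda>x. flux A DX' j x \<bullet> DX k x)\<bar> \<le> e / 2" using elim(1) by blast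
    then show ?case using e by simp
  qed
qed

text \<open>
  With equal data this is the symmetry of the homogenized matrix; combined with the symmetry, it
  says that the matrix depends only on \<open>A\<close>.
\<close>
lemma homogenized_matrix_swap:
  fixes A :: "real ^ 'n \<Rightarrow> real ^ 'n ^ 'n"
  assumes Am: "A \<in> borel_measurable lebesgue" "AE y in lebesgue. norm (A y) \<le> c0" "AE y in lebesgue. transpose (A y) = A y"
    and A: "algebra_with_mean_value \<A>" "\<And>i j. (\<lambda>y. A y $ i $ j) \<in> besicovitch 2 \<A>" "corrector \<A> A X DX" "\<And>j. X j \<in> besicovitch 2 \<A>"
    and A': "algebra_with_mean_value \<A>'" "\<And>i j. (\<lambda>y. A y $ i $ j) \<in> besicovitch 2 \<A>'" "corrector \<A>' A X' DX'" "\<And>j. X' j \<in> besicovitch 2 \<A>'"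
  shows "homogenized_matrix \<A>' A DX' $ k $ j = homogenized_matrix \<A> A DX $ j $ k"
proof -
  have 1: "((\<lambda>T. avg T (\<lambda>y. flux A DX' j y $ k) + avg T (\<lambda>y. flux A DX' j y \<bullet> DX k y)) \<longlongrightarrow> homogenized_matrix \<A>' A DX' $ k $ j + 0) at_top"
    by (intro tendsto_add corrector_flux_mean[OF A'(1,3,2) Am(2)] corrector_pair[OF Am(1,2) A(1,3,4) A'(1,3)])
  have 2: "((\<lambda>T. avg T (\<lambda>y. flux A DX k y $ j) + avg T (\<lambda>y. flux A DX k y \<bullet> DX' j y)) \<longlongrightarrow> homogenized_matrix \<A> A DX $ j $ k + 0) at_top"
    by (intro tendsto_add corrector_flux_mean[OF A(1,3,2) Am(2)] corrector_pair[OF Am(1,2) A'(1,3,4) A(1,3)])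
  have "\<forall>\<^sub>F T in at_top. avg T (\<lambda>y. flux A DX' j y $ k) + avg T (\<lambda>y. flux A DX' j y \<bullet> DX k y)
      = avg T (\<lambda>y. flux A DX k y $ j) + avg T (\<lambda>y. flux A DX k y \<bullet> DX' j y)"
    using eventually_gt_at_top[of 0]
    by eventually_elim (rule flux_symmetric[OF Am corrector_D(3)[OF A'(1,3)] corrector_D(3)[OF A(1,3)]])
  then have "((\<lambda>T. avg T (\<lambda>y. flux A DX k y $ j) + avg T (\<lambda>y. flux A DX k y \<bullet> DX' j y)) \<longlongrightarrow> homogenized_matrix \<A>' A DX' $ k $ j + 0) at_top"
    using 1 by (simp only: tendsto_cong)
  from tendsto_unique[OF _ this 2] show ?thesis by simp
qed

section \<open>The regularized corrector\<close>

lemma regularized_D: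
  assumes r: "regularized_corrector A T T XT DXT" and T: "T \<ge> 1"
  shows "H1_0 (interior (cube T)) (XT j) (DXT j)" "L2_cube T (XT j)" "L2_cube T (DXT j)"
    "L2_cube T (\<lambda>x. XT j x / T\<^sup>2)"
    "test_function (interior (cube T)) \<phi> \<Longrightarrow>
      avg T (\<lambda>y. flux A DXT j y \<bullet> grad \<phi> y) + avg T (\<lambda>y. XT j y / T\<^sup>2 * \<phi> y) = 0"
proof -
  show h: "H1_0 (interior (cube T)) (XT j) (DXT j)" using r by (simp add: regularized_corrector_def)
  then show l: "L2_cube T (XT j)" and "L2_cube T (DXT j)"
    by (auto simp: H1_0_def H1_def intro: Lp_on_2_interior_cube)
  show "L2_cube T (\<lambda>x. XT j x / T\<^sup>2)"
    using L2_scaleR[OF l, of "inverse (T\<^sup>2)"] by (simp add: divide_inverse mult.commute)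
  assume "test_function (interior (cube T)) \<phi>"
  then have "(LINT y:cube T|lebesgue. flux A DXT j y \<bullet> grad \<phi> y) + T powi (-2) * (LINT y:cube T|lebesgue. XT j y * \<phi> y) = 0"
    using r unfolding regularized_corrector_def flux_def by blast
  moreover have "T powi (-2) * (LINT y:cube T|lebesgue. XT j y * \<phi> y) = (LINT y|lebesgue_on (cube T). XT j y / T\<^sup>2 * \<phi> y)"
    using T by (simp add: restrict_integrable_iff(2) power_int_minus divide_inverse mult.assoc mult.commute[of _ "inverse _"] mult.left_commute[of _ "inverse _"])
  ultimately have "(LINT y|lebesgue_on (cube T). flux A DXT j y \<bullet> grad \<phi> y) + (LINT y|lebesgue_on (cube T). XT j y / T\<^sup>2 * \<phi> y) = 0"
    by (simp add: restrict_integrable_iff(2))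
  then show "avg T (\<lambda>y. flux A DXT j y \<bullet> grad \<phi> y) + avg T (\<lambda>y. XT j y / T\<^sup>2 * \<phi> y) = 0"
    unfolding avg_def add_divide_distrib[symmetric] by simp
qed

text \<open>
  Test the equation with its own solution and absorb the term \<open>A e\<^sub>j \<bullet> \<nabla>\<chi>\<^sub>T\<^sub>,\<^sub>j\<close> into half of the elliptic
  term. The second bound is the one on \<open>T\<^sup>-\<^sup>2\<close> times the mean square of the solution.
\<close>
lemma regularized_energy:
  fixes A :: "real ^ 'n \<Rightarrow> real ^ 'n ^ 'n"
  assumes Am: "A \<in> borel_measurable lebesgue" "AE y in lebesgue. norm (A y) \<le> c" and c: "c \<ge> 0"
    and \<alpha>: "\<alpha> > 0" "AE y in lebesgue. \<forall>l. \<alpha> * (norm l)\<^sup>2 \<le> (A y *v l) \<bullet> l"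
    and r: "regularized_corrector A T T XT DXT" and T: "T \<ge> 1"
  shows "avg T (\<lambda>x. (norm (DXT j x))\<^sup>2) \<le> c\<^sup>2 / \<alpha>\<^sup>2" "avg T (\<lambda>x. (T * (XT j x / T\<^sup>2))\<^sup>2) \<le> c\<^sup>2 / (2 * \<alpha>)"
proof -
  let ?M = "lebesgue_on (cube T :: (real ^ 'n) set)"
  have T0: "T > 0" using T by simp
  note d = regularized_D[OF r T]
  note f = flux_L2[where G = DXT and j = j, OF Am d(3) T0]
  have eq: "avg T (\<lambda>x. flux A DXT j x \<bullet> DXT j x) + avg T (\<lambda>x. XT j x / T\<^sup>2 * XT j x) = 0"
    by (rule H1_0_test[OF d(1) T0 f(1) d(4) d(5)])
  define a where "a = avg T (\<lambda>x. (norm (DXT j x))\<^sup>2)"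
  define b where "b = avg T (\<lambda>x. (T * (XT j x / T\<^sup>2))\<^sup>2)"
  have b: "avg T (\<lambda>x. XT j x / T\<^sup>2 * XT j x) = b"
    unfolding b_def using T0 by (simp add: power2_eq_square divide_simps)
  have a0: "a \<ge> 0" "b \<ge> 0" unfolding a_def b_def by (auto intro!: avg_nonneg T0)
  have i1: "integrable ?M (\<lambda>x. (norm (DXT j x))\<^sup>2)" using L2_integrable[OF d(3)] .
  have "avg T (\<lambda>x. \<alpha> / 2 * (norm (DXT j x))\<^sup>2 + (- (c\<^sup>2 / (2 * \<alpha>)))) \<le> avg T (\<lambda>x. flux A DXT j x \<bullet> DXT j x)"
  proof (rule avg_mono_AE[OF _ L2_Young(1)[OF f(1) d(3)] T0])
    show "integrable ?M (\<lambda>x. \<alpha> / 2 * (norm (DXT j x))\<^sup>2 + (- (c\<^sup>2 / (2 * \<alpha>))))"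
      using i1 L2_Young(1)[OF L2_cube_const[of T "1::real"] L2_cube_const[of T "- (c\<^sup>2 / (2 * \<alpha>))"]]
      by (intro Bochner_Integration.integrable_add integrable_mult_right) auto
    have "AE x in ?M. norm (A x) \<le> c \<and> (\<forall>l. \<alpha> * (norm l)\<^sup>2 \<le> (A x *v l) \<bullet> l)"
      using Am(2) \<alpha>(2) by (auto simp: AE_restrict_space_iff)
    then show "AE x in ?M. \<alpha> / 2 * (norm (DXT j x))\<^sup>2 + (- (c\<^sup>2 / (2 * \<alpha>))) \<le> flux A DXT j x \<bullet> DXT j x"
    proof eventually_elim
      case (elim x)
      let ?g = "DXT j x"
      have "\<bar>(A x *v axis j 1) \<bullet> ?g\<bar> \<le> norm (A x *v axis j 1) * norm ?g" by (rule Cauchy_Schwarz_ineq2)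
      also have "\<dots> \<le> c * norm ?g"
        using norm_matrix_vector_le[of "A x" "axis j 1"] elim by (intro mult_right_mono) auto
      finally have "- (c * norm ?g) \<le> (A x *v axis j 1) \<bullet> ?g" by linarith
      moreover have "\<alpha> * (norm ?g)\<^sup>2 \<le> (A x *v ?g) \<bullet> ?g" using elim by blast
      moreover have "c * norm ?g \<le> \<alpha> / 2 * (norm ?g)\<^sup>2 + c\<^sup>2 / (2 * \<alpha>)"
      proof -
        have "0 \<le> (\<alpha> * norm ?g - c)\<^sup>2 / (2 * \<alpha>)" using \<alpha>(1) by simp
        also have "\<dots> = \<alpha> / 2 * (norm ?g)\<^sup>2 + c\<^sup>2 / (2 * \<alpha>) - c * norm ?g"
          using \<alpha>(1) by (simp add: power2_eq_square field_simps)
        finally show ?thesis by simp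
      qed
      ultimately show ?case by (simp add: flux_def matrix_vector_right_distrib inner_add_left)
    qed
  qed
  moreover have "avg T (\<lambda>x. \<alpha> / 2 * (norm (DXT j x))\<^sup>2 + (- (c\<^sup>2 / (2 * \<alpha>)))) = \<alpha> / 2 * a - c\<^sup>2 / (2 * \<alpha>)"
  proof -
    have "avg T (\<lambda>x. \<alpha> / 2 * (norm (DXT j x))\<^sup>2 + (- (c\<^sup>2 / (2 * \<alpha>))))
      = avg T (\<lambda>x. \<alpha> / 2 * (norm (DXT j x))\<^sup>2) + avg T (\<lambda>x :: real ^ 'n. - (c\<^sup>2 / (2 * \<alpha>)))"
      using i1 L2_Young(1)[OF L2_cube_const[of T "1::real"] L2_cube_const[of T "- (c\<^sup>2 / (2 * \<alpha>))"]]
      by (intro avg_add) auto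
    then show ?thesis unfolding avg_cmult avg_const[OF T0] a_def by simp
  qed
  ultimately have main: "\<alpha> / 2 * a + b \<le> c\<^sup>2 / (2 * \<alpha>)" using eq b by linarith
  moreover have "\<alpha> / 2 * a \<ge> 0" using a0 \<alpha> by simp
  ultimately show "avg T (\<lambda>x. (T * (XT j x / T\<^sup>2))\<^sup>2) \<le> c\<^sup>2 / (2 * \<alpha>)" by (simp add: b_def)
  have "\<alpha> / 2 * a \<le> c\<^sup>2 / (2 * \<alpha>)" using main a0 by linarith
  then show "avg T (\<lambda>x. (norm (DXT j x))\<^sup>2) \<le> c\<^sup>2 / \<alpha>\<^sup>2"
    using \<alpha>(1) by (simp add: a_def power2_eq_square field_simps)
qed

lemma approx_entry:
  assumes A: "A \<in> borel_measurable lebesgue" "AE y in lebesgue. norm (A y) \<le> c"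
    and G: "\<And>j. L2_cube T (DXT j)" and T: "T > 0"
  shows "approx_homogenized_matrix A T DXT $ k $ j = avg T (\<lambda>y. flux A DXT j y $ k)"
proof -
  let ?M = "lebesgue_on (cube T)"
  let ?F = "\<lambda>y. A y ** (mat 1 + column_matrix DXT y)"
  have e: "?F y $ k $ j = flux A DXT j y $ k" for y k j by (simp add: matrix_mult_column flux_def)
  have int: "integrable ?M (\<lambda>y. flux A DXT j y $ k)" for j k
    using L2_Young(1)[OF L2_cube_const[of T "1::real"] L2_component[OF flux_L2(1)[where G = DXT and j = j, OF A G T], of k]] by simp
  have "integrable ?M (\<lambda>y. \<Sum>k\<in>UNIV. \<Sum>j\<in>UNIV. flux A DXT j y $ k *\<^sub>R axis k (axis j (1::real)))"
    by (intro Bochner_Integration.integrable_sum integrable_scaleR_left int)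
  moreover have "(\<Sum>k\<in>UNIV. \<Sum>j\<in>UNIV. flux A DXT j y $ k *\<^sub>R axis k (axis j (1::real))) = ?F y" for y
  proof -
    have sum_if: "(\<Sum>j\<in>UNIV. if b then g j else 0) = (if b then (\<Sum>j\<in>UNIV. g j) else 0)" for b and g :: "'a \<Rightarrow> real"
      by simp
    show ?thesis
      by (simp add: vec_eq_iff e axis_def if_distrib[where f = "\<lambda>x. x $ _"] if_distrib[where f = "\<lambda>x. _ * x"] sum_if cong: if_cong)
  qed
  ultimately have i: "integrable ?M ?F" by simp
  have "approx_homogenized_matrix A T DXT = (LINT y|?M. ?F y) /\<^sub>R T ^ CARD('a)"
    using T by (simp add: approx_homogenized_matrix_def restrict_integrable_iff(2) content_cube)
  moreover have "(LINT y|?M. ?F y) $ k $ j = (LINT y|?M. ?F y $ k $ j)"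
    using integral_bounded_linear[OF bounded_linear_compose[OF bounded_linear_vec_nth[of j] bounded_linear_vec_nth[of k]] i] by simp
  ultimately show ?thesis by (simp add: avg_def e divide_inverse)
qed

lemma norm_matrix_le_sum: "norm (B :: real ^ 'n ^ 'm) \<le> (\<Sum>k\<in>UNIV. \<Sum>j\<in>UNIV. \<bar>B $ k $ j\<bar>)"
proof -
  have "norm B \<le> (\<Sum>k\<in>UNIV. norm (B $ k))" unfolding norm_vec_def by (rule L2_set_le_sum) simp
  also have "\<dots> \<le> (\<Sum>k\<in>UNIV. \<Sum>j\<in>UNIV. \<bar>B $ k $ j\<bar>)" by (intro sum_mono norm_le_l1_cart)
  finally show ?thesis .
qed

section \<open>The rate of convergence\<close>

text \<open>
  Take \<open>\<eta> t = h t / t\<close> with \<open>h t\<close> the supremum of \<open>r * min t s\<close> over all values \<open>r\<close> at \<open>s\<close>. As a supremum of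
  functions with Lipschitz constant at most \<open>B\<close>, \<open>h\<close> is Lipschitz continuous; \<open>s = t\<close> gives the bound
  \<open>r \<le> \<eta> t\<close>; values at small \<open>s\<close> contribute \<open>O(1 / t)\<close>, and values at large \<open>s\<close> are small.
\<close>
lemma continuous_majorant:
  fixes P :: "real \<Rightarrow> real \<Rightarrow> bool"
  assumes B: "\<And>T r. T \<ge> 1 \<Longrightarrow> P T r \<Longrightarrow> 0 \<le> r \<and> r \<le> B"
    and lim: "\<And>\<epsilon>. \<epsilon> > 0 \<Longrightarrow> \<forall>\<^sub>F T in at_top. \<forall>r. P T r \<longrightarrow> r \<le> \<epsilon>"
  obtains \<eta> where "continuous_on {1..} \<eta>" "\<And>t. t \<ge> 1 \<Longrightarrow> \<eta> t \<ge> 0" "(\<eta> \<longlongrightarrow> 0) at_top"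
    "\<And>T r. T \<ge> 1 \<Longrightarrow> P T r \<Longrightarrow> r \<le> \<eta> T"
proof -
  define B' where "B' = max B 0"
  have B': "B' \<ge> 0" "\<And>T r. T \<ge> 1 \<Longrightarrow> P T r \<Longrightarrow> 0 \<le> r \<and> r \<le> B'" using B by (force simp: B'_def)+
  \<comment> \<open>the element \<open>0\<close> keeps the supremum meaningful when \<open>P\<close> has no values at all\<close>
  define S where "S t = insert 0 {r * min t s | r s. s \<ge> 1 \<and> P s r}" for t
  define h where "h t = Sup (S t)" for t
  have bd: "x \<le> B' * t" if "x \<in> S t" "t \<ge> 1" for x t
    using that B' by (auto simp: S_def intro!: mult_mono)
  have bdd: "bdd_above (S t)" if "t \<ge> 1" for t using bd[OF _ that] by (rule bdd_aboveI)
  have h0: "h t \<ge> 0" if "t \<ge> 1" for t unfolding h_def by (rule cSup_upper[OF _ bdd[OF that]]) (simp add: S_def)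
  have hle: "h t \<le> x" if "\<And>y. y \<in> S t \<Longrightarrow> y \<le> x" for t x
    unfolding h_def by (rule cSup_least) (use that in \<open>auto simp: S_def\<close>)
  have up: "r * min t s \<le> h t" if "t \<ge> 1" "s \<ge> 1" "P s r" for t s r
    unfolding h_def by (rule cSup_upper[OF _ bdd[OF that(1)]]) (use that in \<open>auto simp: S_def\<close>)
  have lip: "h t \<le> h t' + B' * \<bar>t - t'\<bar>" if "t \<ge> 1" "t' \<ge> 1" for t t'
  proof (rule hle)
    fix y assume "y \<in> S t"
    then consider "y = 0" | r s where "y = r * min t s" "s \<ge> 1" "P s r" by (auto simp: S_def)
    then show "y \<le> h t' + B' * \<bar>t - t'\<bar>"
    proof cases
      case 1
      then show ?thesis using h0[OF that(2)] B' by simp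
    next
      case 2
      have r: "0 \<le> r" "r \<le> B'" using B'(2)[OF 2(2,3)] by auto
      have "r * min t s \<le> r * (min t' s + \<bar>t - t'\<bar>)" using r by (intro mult_left_mono) auto
      also have "\<dots> \<le> h t' + B' * \<bar>t - t'\<bar>"
        using up[OF that(2) 2(2,3)] r mult_right_mono[OF r(2), of "\<bar>t - t'\<bar>"] by (simp add: distrib_left)
      finally show ?thesis using 2 by simp
    qed
  qed
  have cont: "continuous_on {1..} h"
  proof (rule lipschitz_on_continuous_on)
    show "B'-lipschitz_on {1..} h"
    proof (rule lipschitz_onI)
      fix x y :: real assume "x \<in> {1..}" "y \<in> {1..}"
      then show "dist (h x) (h y) \<le> B' * dist x y"
        using lip[of x y] lip[of y x] by (auto simp: dist_real_def abs_minus_commute abs_le_iff)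
    qed (rule B')
  qed
  show ?thesis
  proof (rule that[of "\<lambda>t. h t / t"])
    show "continuous_on {1..} (\<lambda>t. h t / t)" by (intro continuous_intros cont) auto
    show "0 \<le> h t / t" if "t \<ge> 1" for t using h0[OF that] that by simp
    show "r \<le> h T / T" if "T \<ge> 1" "P T r" for T r
      using up[OF that(1) that] that by (simp add: pos_le_divide_eq)
    show "((\<lambda>t. h t / t) \<longlongrightarrow> 0) at_top"
    proof (rule tendstoI)
      fix e :: real assume e: "e > 0"
      obtain N where N: "\<And>T r. T \<ge> N \<Longrightarrow> P T r \<Longrightarrow> r \<le> e / 2"
        using lim[of "e / 2"] e by (auto simp: eventually_at_top_linorder)
      define N' where "N' = max N 1"
      have "\<forall>\<^sub>F t in at_top. t \<ge> 1 \<and> t > 2 * (B' * N') / e"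
        using eventually_ge_at_top[of 1] eventually_gt_at_top[of "2 * (B' * N') / e"] by (rule eventually_conj)
      then show "\<forall>\<^sub>F t in at_top. dist (h t / t) 0 < e"
      proof eventually_elim
        case (elim t)
        have Bt: "B' * N' \<le> e / 2 * t" using elim e by (simp add: field_simps)
        have "h t \<le> e / 2 * t"
        proof (rule hle)
          fix y assume "y \<in> S t"
          then consider "y = 0" | r s where "y = r * min t s" "s \<ge> 1" "P s r" by (auto simp: S_def)
          then show "y \<le> e / 2 * t"
          proof cases
            case 1
            then show ?thesis using e elim by simp
          next
            case 2
            have r: "0 \<le> r" "r \<le> B'" using B'(2)[OF 2(2,3)] by auto
            show ?thesis
            proof (cases "s \<ge> N'")
              case True
              then have "r \<le> e / 2" using N[of s r] 2 by (simp add: N'_def)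
              then have "r * min t s \<le> e / 2 * t" using r e elim 2 by (intro mult_mono) auto
              then show ?thesis using 2 by simp
            next
              case False
              then have "r * min t s \<le> B' * N'" using r 2 elim B' by (intro mult_mono) auto
              then show ?thesis using 2 Bt by simp
            qed
          qed
        qed
        then have "h t / t \<le> e / 2" using elim by (simp add: divide_le_eq)
        then have "h t / t < e" using e by linarith
        moreover have "h t / t \<ge> 0" using h0[of t] elim by simp
        ultimately show ?case unfolding dist_real_def by linarith
      qed
    qed
  qed
qed

text \<open>
  The flux is balanced with \<open>s = T\<^sup>-\<^sup>2 \<chi>\<^sub>T\<^sub>,\<^sub>j\<close> by the energy bounds, with a constant \<open>C\<close> that does not depend on
  \<open>T\<close> or on the solution.
\<close>
lemma regularized_limit:
  fixes A :: "real ^ 'n \<Rightarrow> real ^ 'n ^ 'n"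
  assumes Am: "A \<in> borel_measurable lebesgue" "AE y in lebesgue. norm (A y) \<le> c" "AE y in lebesgue. transpose (A y) = A y" and c: "c \<ge> 0"
    and \<alpha>: "\<alpha> > 0" "AE y in lebesgue. \<forall>l. \<alpha> * (norm l)\<^sup>2 \<le> (A y *v l) \<bullet> l"
    and A: "algebra_with_mean_value \<A>" "\<And>i j. (\<lambda>y. A y $ i $ j) \<in> besicovitch 2 \<A>" "corrector \<A> A X DX" "\<And>j. X j \<in> besicovitch 2 \<A>"
    and e: "e > 0"
  shows "\<forall>\<^sub>F T in at_top. \<forall>XT DXT. regularized_corrector A T T XT DXT \<longrightarrow>
    \<bar>avg T (\<lambda>y. flux A DXT j y $ k) - homogenized_matrix \<A> A DX $ k $ j\<bar> \<le> e"
proof -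
  define C where "C = c\<^sup>2 * (2 + 2 * (c\<^sup>2 / \<alpha>\<^sup>2)) + c\<^sup>2 / (2 * \<alpha>) + 1"
  have C: "C > 0" unfolding C_def using \<alpha>(1) by (intro add_nonneg_pos add_nonneg_nonneg mult_nonneg_nonneg) auto
  have e2: "e / 2 > 0" using e by simp
  have sw: "homogenized_matrix \<A> A DX $ k $ j = homogenized_matrix \<A> A DX $ j $ k"
    by (rule homogenized_matrix_swap[OF Am A A])
  from duality_small[OF A(1) corrector_D(1)[OF A(1,3), of k] A(4) corrector_D(2)[OF A(1,3)] e2 C]
    tendstoD[OF corrector_flux_mean[OF A(1,3,2) Am(2), of k j] e2] eventually_ge_at_top[of 1]
  show ?thesis
  proof (eventually_elim, intro allI impI)
    fix T XT DXT
    assume dual: "\<forall>F s. balanced_flux C T F s \<longrightarrow> \<bar>avg T (\<lambda>x. F x \<bullet> DX k x)\<bar> \<le> e / 2"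
      and mean: "dist (avg T (\<lambda>y. flux A DX k y $ j)) (homogenized_matrix \<A> A DX $ j $ k) < e / 2"
      and T: "1 \<le> T" and r: "regularized_corrector A T T XT DXT"
    have T0: "T > 0" using T by simp
    note d = regularized_D[OF r T]
    note en = regularized_energy[OF Am(1,2) c \<alpha> r T]
    note f = flux_L2[where G = DXT and j = j, OF Am(1,2) d(3) T0]
    note fk = flux_L2[where G = DX and j = k, OF Am(1,2) corrector_D(3)[OF A(1,3)] T0]
    have nn: "c\<^sup>2 / (2 * \<alpha>) \<ge> 0" "c\<^sup>2 * (2 + 2 * (c\<^sup>2 / \<alpha>\<^sup>2)) \<ge> 0" using \<alpha>(1) by (auto intro!: mult_nonneg_nonneg)
    have "avg T (\<lambda>x. (norm (flux A DXT j x))\<^sup>2) \<le> c\<^sup>2 * (2 + 2 * avg T (\<lambda>x. (norm (DXT j x))\<^sup>2))" by (rule f(2))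
    also have "\<dots> \<le> c\<^sup>2 * (2 + 2 * (c\<^sup>2 / \<alpha>\<^sup>2))" using en(1) by (intro mult_left_mono add_left_mono) auto
    also have "\<dots> \<le> C" using nn by (simp add: C_def)
    finally have b1: "avg T (\<lambda>x. (norm (flux A DXT j x))\<^sup>2) \<le> C" .
    have b2: "avg T (\<lambda>x. (T * (XT j x / T\<^sup>2))\<^sup>2) \<le> C" using en(2)[of j] nn unfolding C_def by linarith
    have "balanced_flux C T (flux A DXT j) (\<lambda>x. XT j x / T\<^sup>2)"
      unfolding balanced_flux_def by (intro conjI allI impI f(1) d(4) b1 b2 d(5))
    then have small: "\<bar>avg T (\<lambda>x. flux A DXT j x \<bullet> DX k x)\<bar> \<le> e / 2" using dual by blast
    have "avg T (\<lambda>x. flux A DX k x \<bullet> DXT j x) + avg T (\<lambda>x. 0 * XT j x) = 0"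
    proof (rule H1_0_test[OF d(1) T0 fk(1) L2_cube_const])
      fix \<phi> :: "real ^ 'n \<Rightarrow> real" assume t: "test_function (interior (cube T)) \<phi>"
      show "avg T (\<lambda>x. flux A DX k x \<bullet> grad \<phi> x) + avg T (\<lambda>x. 0 * \<phi> x) = 0"
        unfolding corrector_cube[OF A(1,3) t] avg_cmult by simp
    qed
    then have z: "avg T (\<lambda>x. flux A DX k x \<bullet> DXT j x) = 0" unfolding avg_cmult by simp
    have "avg T (\<lambda>y. flux A DXT j y $ k) + avg T (\<lambda>y. flux A DXT j y \<bullet> DX k y)
      = avg T (\<lambda>y. flux A DX k y $ j) + avg T (\<lambda>y. flux A DX k y \<bullet> DXT j y)"
      by (rule flux_symmetric[OF Am d(3) corrector_D(3)[OF A(1,3)] T0])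
    then show "\<bar>avg T (\<lambda>y. flux A DXT j y $ k) - homogenized_matrix \<A> A DX $ k $ j\<bar> \<le> e"
      using small z mean sw unfolding dist_real_def by linarith
  qed
qed

theorem theorem3p2:
  fixes A :: "real ^ 'n \<Rightarrow> real ^ 'n ^ 'n" and \<alpha> \<beta> \<delta> :: real
  assumes "L_infty A"
    and "AE y in lebesgue. transpose (A y) = A y"
    and "\<alpha> > 0" and "\<beta> > 0"
    and "AE y in lebesgue. \<forall>l. \<alpha> * (norm l)\<^sup>2 \<le> (A y *v l) \<bullet> l \<and> (A y *v l) \<bullet> l \<le> \<beta> * (norm l)\<^sup>2"
    and "0 < \<delta>" and "\<delta> < 1"
  shows "\<exists>C \<eta>. C > 0 \<and> continuous_on {1..} \<eta> \<and> (\<forall>t\<ge>1. \<eta> t \<ge> 0) \<and> (\<eta> \<longlongrightarrow> (0::real)) at_top \<and>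
    (\<forall>\<A> X DX.
       algebra_with_mean_value \<A> \<and> ergodic \<A> \<and>
       (\<forall>i j. (\<lambda>y. A y $ i $ j) \<in> besicovitch 2 \<A>) \<and>
       corrector \<A> A X DX \<and> (\<forall>j. X j \<in> besicovitch 2 \<A>) \<longrightarrow>
       (\<forall>T\<ge>1. \<forall>XT DXT. regularized_corrector A T T XT DXT \<longrightarrow>
          norm (homogenized_matrix \<A> A DX - approx_homogenized_matrix A T DXT) \<le> C * \<eta> T))"
proof -
  define adm where "adm \<A> X DX \<longleftrightarrow> algebra_with_mean_value \<A> \<and>
    (\<forall>i j. (\<lambda>y. A y $ i $ j) \<in> besicovitch 2 \<A>) \<and> corrector \<A> A X DX \<and> (\<forall>j. X j \<in> besicovitch 2 \<A>)" for \<A> X DX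
  obtain c0 where Am: "A \<in> borel_measurable lebesgue" and c0: "AE y in lebesgue. norm (A y) \<le> c0"
    using assms(1) by (auto simp: L_infty_def)
  define c where "c = \<bar>c0\<bar>"
  have c: "c \<ge> 0" and Ac: "AE y in lebesgue. norm (A y) \<le> c"
    using c0 unfolding c_def by (auto elim: eventually_mono)
  have ell: "AE y in lebesgue. \<forall>l. \<alpha> * (norm l)\<^sup>2 \<le> (A y *v l) \<bullet> l"
    using assms(5) by (auto elim: eventually_mono)
  show ?thesis
  proof (cases "\<exists>\<A> X DX. adm \<A> X DX")
    case False
    then show ?thesis
    proof (intro exI[of _ 1] exI[of _ "\<lambda>_. 0"] conjI allI impI)
      fix \<A> X DX T XT DXT
      assume "algebra_with_mean_value \<A> \<and> ergodic \<A> \<and> (\<forall>i j. (\<lambda>y. A y $ i $ j) \<in> besicovitch 2 \<A>) \<and>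
         corrector \<A> A X DX \<and> (\<forall>j. X j \<in> besicovitch 2 \<A>)"
      then have "adm \<A> X DX" by (simp add: adm_def)
      with False show "norm (homogenized_matrix \<A> A DX - approx_homogenized_matrix A T DXT) \<le> 1 * 0" by blast
    qed auto
  next
    case True
    then obtain \<A> X DX where "adm \<A> X DX" by blast
    then have adm: "algebra_with_mean_value \<A>" "\<And>i j. (\<lambda>y. A y $ i $ j) \<in> besicovitch 2 \<A>"
      "corrector \<A> A X DX" "\<And>j. X j \<in> besicovitch 2 \<A>" by (auto simp: adm_def)
    define H where "H = homogenized_matrix \<A> A DX"
    have uniq: "homogenized_matrix \<A>' A DX' = H" if "adm \<A>' X' DX'" for \<A>' X' DX'
    proof -
      have adm': "algebra_with_mean_value \<A>'" "\<And>i j. (\<lambda>y. A y $ i $ j) \<in> besicovitch 2 \<A>'"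
        "corrector \<A>' A X' DX'" "\<And>j. X' j \<in> besicovitch 2 \<A>'" using that by (auto simp: adm_def)
      have "homogenized_matrix \<A>' A DX' $ k $ j = H $ k $ j" for k j
        using homogenized_matrix_swap[OF Am Ac assms(2) adm adm', of k j]
          homogenized_matrix_swap[OF Am Ac assms(2) adm adm, of k j] by (simp add: H_def)
      then show ?thesis by (simp add: vec_eq_iff)
    qed
    \<comment> \<open>the possible errors at \<open>T\<close>, over all representatives of the regularized correctors\<close>
    define P where "P T r \<longleftrightarrow> (\<exists>XT DXT. regularized_corrector A T T XT DXT \<and> r = norm (H - approx_homogenized_matrix A T DXT))" for T r
    have entry: "approx_homogenized_matrix A T DXT $ k $ j = avg T (\<lambda>y. flux A DXT j y $ k)"
      if "regularized_corrector A T T XT DXT" "T \<ge> 1" for T XT DXT k j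
      by (rule approx_entry[OF Am Ac regularized_D(3)[OF that]]) (use that in simp)
    let ?N = "real CARD('n)"
    \<comment> \<open>bound on the entries of the approximate matrices; the summand \<open>1\<close> makes it positive\<close>
    define s where "s = sqrt (c\<^sup>2 * (2 + 2 * (c\<^sup>2 / \<alpha>\<^sup>2)) + 1)"
    have s2: "c\<^sup>2 * (2 + 2 * (c\<^sup>2 / \<alpha>\<^sup>2)) \<ge> 0" by simp
    then have s: "s > 0" "s\<^sup>2 = c\<^sup>2 * (2 + 2 * (c\<^sup>2 / \<alpha>\<^sup>2)) + 1" unfolding s_def by (auto intro: add_nonneg_pos)
    have bound: "0 \<le> r \<and> r \<le> norm H + ?N * (?N * s)" if T1: "T \<ge> 1" and PT: "P T r" for T r
    proof -
      obtain XT DXT where rc: "regularized_corrector A T T XT DXT" and r: "r = norm (H - approx_homogenized_matrix A T DXT)"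
        using PT by (auto simp: P_def)
      have T0: "T > 0" using T1 by simp
      have en: "\<bar>approx_homogenized_matrix A T DXT $ k $ j\<bar> \<le> s" for k j
      proof -
        note f = flux_L2[where G = DXT and j = j, OF Am Ac regularized_D(3)[OF rc T1] T0]
        have "avg T (\<lambda>x. (flux A DXT j x $ k)\<^sup>2) \<le> avg T (\<lambda>x. (norm (flux A DXT j x))\<^sup>2)"
          by (rule avg_mono[OF L2_integrable_real[OF L2_component[OF f(1)]] L2_integrable[OF f(1)] T0])
            (use component_le_norm_cart in \<open>auto simp: abs_le_square_iff[symmetric]\<close>)
        also have "\<dots> \<le> c\<^sup>2 * (2 + 2 * avg T (\<lambda>x. (norm (DXT j x))\<^sup>2))" by (rule f(2))
        also have "\<dots> \<le> c\<^sup>2 * (2 + 2 * (c\<^sup>2 / \<alpha>\<^sup>2))"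
          using regularized_energy(1)[OF Am Ac c assms(3) ell rc T1] by (intro mult_left_mono add_left_mono) auto
        also have "\<dots> \<le> s\<^sup>2" unfolding s(2) by simp
        finally show ?thesis unfolding entry[OF rc T1] by (rule avg_abs_le[OF L2_component[OF f(1)] T0 s(1)])
      qed
      have "norm (approx_homogenized_matrix A T DXT) \<le> (\<Sum>k\<in>(UNIV :: 'n set). \<Sum>j\<in>(UNIV :: 'n set). s)"
        by (rule order_trans[OF norm_matrix_le_sum]) (intro sum_mono en)
      then show ?thesis using norm_triangle_ineq4[of H "approx_homogenized_matrix A T DXT"] by (simp add: r)
    qed
    have lim: "\<forall>\<^sub>F T in at_top. \<forall>r. P T r \<longrightarrow> r \<le> \<epsilon>" if \<epsilon>: "\<epsilon> > 0" for \<epsilon>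
    proof -
      define e where "e = \<epsilon> / (?N * ?N)"
      have e: "e > 0" using \<epsilon> by (simp add: e_def)
      have "\<forall>\<^sub>F T in at_top. \<forall>k j. \<forall>XT DXT. regularized_corrector A T T XT DXT \<longrightarrow>
          \<bar>avg T (\<lambda>y. flux A DXT j y $ k) - H $ k $ j\<bar> \<le> e"
        unfolding H_def by (intro eventually_all_finite regularized_limit[OF Am Ac assms(2) c assms(3) ell adm e])
      then show ?thesis using eventually_ge_at_top[of 1]
      proof (eventually_elim, intro allI impI)
        fix T r assume *: "\<forall>k j. \<forall>XT DXT. regularized_corrector A T T XT DXT \<longrightarrow> \<bar>avg T (\<lambda>y. flux A DXT j y $ k) - H $ k $ j\<bar> \<le> e"
          and T: "1 \<le> T" and "P T r"
        then obtain XT DXT where rc: "regularized_corrector A T T XT DXT" and r: "r = norm (H - approx_homogenized_matrix A T DXT)"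
          by (auto simp: P_def)
        have "r \<le> (\<Sum>k\<in>UNIV. \<Sum>j\<in>UNIV. \<bar>(H - approx_homogenized_matrix A T DXT) $ k $ j\<bar>)"
          unfolding r by (rule norm_matrix_le_sum)
        also have "\<dots> \<le> (\<Sum>k\<in>(UNIV :: 'n set). \<Sum>j\<in>(UNIV :: 'n set). e)"
          using * rc by (intro sum_mono) (auto simp: entry[OF rc T] abs_minus_commute)
        also have "\<dots> = \<epsilon>" by (simp add: e_def)
        finally show "r \<le> \<epsilon>" .
      qed
    qed
    show ?thesis
    proof (rule continuous_majorant[of P "norm H + ?N * (?N * s)"])
      show "0 \<le> r \<and> r \<le> norm H + ?N * (?N * s)" if "T \<ge> 1" "P T r" for T r by (rule bound[OF that])
      show "\<forall>\<^sub>F T in at_top. \<forall>r. P T r \<longrightarrow> r \<le> \<epsilon>" if "\<epsilon> > 0" for \<epsilon> by (rule lim[OF that])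
    next
      fix \<eta> assume \<eta>: "continuous_on {1..} \<eta>" "\<And>t. t \<ge> 1 \<Longrightarrow> \<eta> t \<ge> 0" "(\<eta> \<longlongrightarrow> 0) at_top"
        "\<And>T r. T \<ge> 1 \<Longrightarrow> P T r \<Longrightarrow> r \<le> \<eta> T"
      show ?thesis
      proof (intro exI[of _ 1] exI[of _ \<eta>] conjI allI impI)
        fix \<A>' X' DX' T XT DXT
        assume a: "algebra_with_mean_value \<A>' \<and> ergodic \<A>' \<and> (\<forall>i j. (\<lambda>y. A y $ i $ j) \<in> besicovitch 2 \<A>') \<and>
           corrector \<A>' A X' DX' \<and> (\<forall>j. X' j \<in> besicovitch 2 \<A>')"
          and T: "1 \<le> T" and rc: "regularized_corrector A T T XT DXT"
        have "homogenized_matrix \<A>' A DX' = H" by (rule uniq[of _ X']) (use a in \<open>simp add: adm_def\<close>)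
        moreover have "norm (H - approx_homogenized_matrix A T DXT) \<le> \<eta> T"
          by (rule \<eta>(4)[OF T]) (use rc in \<open>auto simp: P_def\<close>)
        ultimately show "norm (homogenized_matrix \<A>' A DX' - approx_homogenized_matrix A T DXT) \<le> 1 * \<eta> T" by simp
      qed (use \<eta> in auto)
    qed
  qed
qed

end
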